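(* Let $(\Lambda_s)_{s\in\mathbb R_+}$ be a family of $m\times m$ generator matrices (indexed by $\mathbf E$) such that $|\Lambda_s(i,j)|\le K$ for all $i,j\in\mathbf E$, $s\in\mathbb R_+$, for some constant $K\in(0,\infty)$, and such that $s\mapsto\Lambda_s$ is continuous. Let $\widetilde\Lambda$ be the associated multiplication operator, $(\widetilde\Lambda g)(s,i)=(\Lambda_s g(s,\cdot))(i)$. Let $v:\overline{\mathbf E}\to\mathbb R$ with $v(i)\ne0$ for all $i\in\mathbf E$, $v(\partial)=0$, both $\mathbf E_+$ and $\mathbf E_-$ non-empty, and $V=\mathrm{diag}\{v(i):i\in\mathbf E\}$. Then there exists a unique quadruple of operators $(S^+,H^+,S^-,H^-)$ which solves the operator equation $$V^{-1}\Big(\frac{\partial}{\partial s}+\widetilde\Lambda\Big)\begin{pmatrix} I^+ & S^-\\ S^+ & I^-\end{pmatrix}\begin{pmatrix} g^+\\ g^-\end{pmatrix}=\begin{pmatrix} I^+ & S^-\\ S^+ & I^-\end{pmatrix}\begin{pmatrix} H^+ & 0\\ 0 & -H^-\end{pmatrix}\begin{pmatrix} g^+\\ g^-\end{pmatrix},\qquad g^\pm\in C_0^1(\overline{\mathcal X_\pm}),$$ subject to the following conditions (for both choices of sign): (a$^\pm$) $S^\pm:C_0(\overline{\mathcal X_\pm})\to C_0(\overline{\mathcal X_\mp})$ is a bounded operator such that (i) for any $g^\pm\in C_c(\overline{\mathcal X_\pm})$ with $\operatorname{supp}g^\pm\subset[0,\eta_{g^\pm}]\times\mathbf E_\pm$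 for some constant $\eta_{g^\pm}\in(0,\infty)$, we have $\operatorname{supp}S^\pm g^\pm\subset[0,\eta_{g^\pm}]\times\mathbf E_\mp$; (ii) for any $g^\pm\in C_0^1(\overline{\mathcal X_\pm})$, we have $S^\pm g^\pm\in C_0^1(\overline{\mathcal X_\mp})$. (b$^\pm$) $H^\pm$ is the strong generator of a strongly continuous positive contraction semigroup $(\mathcal Q^\pm_\ell)_{\ell\in\mathbb R_+}$ on $C_0(\overline{\mathcal X_\pm})$ with domain $\mathscr D(H^\pm)=C_0^1(\overline{\mathcal X_\pm})$.
   Context: $\mathbf E$ is a finite set with $|\mathbf E|=m>1$; $\partial$ is a coffin state isolated from $\mathbf E$; $\overline{\mathbf E}=\mathbf E\cup\{\partial\}$; $\mathbb R_+=[0,\infty)$. A generator matrix has non-negative off-diagonal entries and zero row sums; $\Lambda_\infty:=0$. $\mathbf E_\pm=\{i\in\mathbf E:\pm v(i)>0\}$. $\mathcal X=\mathbb R_+\times\mathbf E$, $\mathcal X_\pm=\mathbb R_+\times\mathbf E_\pm$, and $\overline{\mathcal X}=\mathcal X\cup\{(\infty,\partial)\}$, $\overline{\mathcal X_\pm}=\mathcal X_\pm\cup\{(\infty,\partial)\}$ are the one-point completions. Function spaces (all functions are real-valued): $L^\infty(\overline{\mathcal X})$ is the space of bounded Borel functions $f$ on $\overline{\mathcal X}$ with $f(\infty,\partial)=0$. $C_0(\overline{\mathcal X})$ (resp. $C_c(\overline{\mathcal X})$) is the set of $f\in L^\infty(\overline{\mathcal X})$ such that for every $i\in\mathbf E$,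 $f(\cdot,i)$ is continuous on $\mathbb R_+$ and vanishes at infinity (resp. has compact support). $C_0^1(\overline{\mathcal X})$ is the set of $f\in C_0(\overline{\mathcal X})$ such that for every $i$ the derivative $\partial f(\cdot,i)/\partial s$ exists (one-sided at $s=0$) and belongs to $C_0(\mathbb R_+)$, with the convention $\partial f(\infty,\partial)/\partial s=0$. The spaces on $\overline{\mathcal X_\pm}$ are defined in the same way with $\mathbf E$ replaced by $\mathbf E_\pm$. They carry the supremum norm. A function $g$ on $\overline{\mathcal X}$ is identified with the pair $(g^+,g^-)^T$ of its restrictions to $\overline{\mathcal X_+}$ and $\overline{\mathcal X_-}$. $V^{-1}$ acts by $(V^{-1}g)(s,i)=v(i)^{-1}g(s,i)$, and $I^\pm$ are the identity operators on functions on $\overline{\mathcal X_\pm}$; operator matrices act on pairs in the usual way. The strong generator of a strongly continuous semigroup $(\mathcal Q_\ell)$ is $Hg=\lim_{\ell\to0+}\ell^{-1}(\mathcal Q_\ell g-g)$ (sup-norm limit), with domain the set of all $g$ for which the limit exists. *)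

theory Defs
  imports "HOL-Analysis.Analysis" "HOL-Library.FuncSet"
begin

text \<open>
  The finite set \<open>E\<close> is the universe of a type \<open>'e::finite\<close>, and \<open>E \<union> {\<partial>}\<close> is \<open>'e option\<close> with
  \<open>None = \<partial>\<close>. The one-point completion of \<open>\<real>\<^sub>+ \<times> A\<close>, for \<open>A \<subseteq> E\<close>, is a subset of
  \<open>(real \<times> 'e) option\<close>, where \<open>None\<close> is the point \<open>(\<infinity>,\<partial>)\<close>. A function on it is represented by the
  total function that vanishes off that subset.
\<close>

type_synonym 'e fn = "(real \<times> 'e) option \<Rightarrow> real"
type_synonym 'e oper = "'e fn \<Rightarrow> 'e fn"

definition Xbar :: "'e set \<Rightarrow> (real \<times> 'e) option set" where
  "Xbar A = insert None (Some ` ({0..} \<times> A))"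

definition supnorm :: "'e set \<Rightarrow> 'e fn \<Rightarrow> real" where
  "supnorm A f = (SUP x\<in>Xbar A. \<bar>f x\<bar>)"

text \<open>As \<open>A\<close> is finite and discrete, a function on the completion is Borel iff all its sections
  \<open>f(\<cdot>,i)\<close> are Borel on \<open>\<real>\<^sub>+\<close>.\<close>

definition Linf :: "'e set \<Rightarrow> 'e fn set" where
  "Linf A = {f. (\<forall>x. x \<notin> Xbar A \<longrightarrow> f x = 0) \<and> f None = 0 \<and> bounded (f ` Xbar A) \<and>
     (\<forall>i\<in>A. (\<lambda>s. f (Some (s, i))) \<in> borel_measurable (restrict_space borel {0..}))}"

definition C0 :: "'e set \<Rightarrow> 'e fn set" where
  "C0 A = {f \<in> Linf A. \<forall>i\<in>A. continuous_on {0..} (\<lambda>s. f (Some (s, i))) \<and>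
     ((\<lambda>s. f (Some (s, i))) \<longlongrightarrow> 0) at_top}"

definition section_supp :: "'e fn \<Rightarrow> 'e \<Rightarrow> real set" where
  "section_supp f i = closure {s. 0 \<le> s \<and> f (Some (s, i)) \<noteq> 0}"

definition supp :: "'e set \<Rightarrow> 'e fn \<Rightarrow> (real \<times> 'e) set" where
  "supp A f = {(s, i). i \<in> A \<and> s \<in> section_supp f i}"

definition Cc :: "'e set \<Rightarrow> 'e fn set" where
  "Cc A = {f \<in> Linf A. \<forall>i\<in>A. continuous_on {0..} (\<lambda>s. f (Some (s, i))) \<and>
     compact (section_supp f i)}"

text \<open>The derivative within \<open>[0,\<infinity>)\<close> is one-sided at \<open>0\<close>.\<close>

definition dds :: "'e set \<Rightarrow> 'e oper" where
  "dds A f x = (case x of None \<Rightarrow> 0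
     | Some (s, i) \<Rightarrow> if 0 \<le> s \<and> i \<in> A
         then vector_derivative (\<lambda>r. f (Some (r, i))) (at s within {0..}) else 0)"

definition C01 :: "'e set \<Rightarrow> 'e fn set" where
  "C01 A = {f \<in> C0 A.
     (\<forall>i\<in>A. \<forall>s\<ge>0. (\<lambda>r. f (Some (r, i))) differentiable (at s within {0..})) \<and> dds A f \<in> C0 A}"

definition bounded_operator :: "'e set \<Rightarrow> 'e set \<Rightarrow> 'e oper \<Rightarrow> bool" where
  "bounded_operator A B T \<longleftrightarrow>
     (\<forall>f\<in>C0 A. T f \<in> C0 B) \<and>
     (\<forall>f\<in>C0 A. \<forall>g\<in>C0 A. T (\<lambda>x. f x + g x) = (\<lambda>x. T f x + T g x)) \<and>
     (\<forall>c. \<forall>f\<in>C0 A. T (\<lambda>x. c * f x) = (\<lambda>x. c * T f x)) \<and>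
     (\<exists>M. \<forall>f\<in>C0 A. supnorm B (T f) \<le> M * supnorm A f)"

definition sc_pos_contr_semigroup :: "'e set \<Rightarrow> (real \<Rightarrow> 'e oper) \<Rightarrow> bool" where
  "sc_pos_contr_semigroup A Q \<longleftrightarrow>
     (\<forall>l\<ge>0. bounded_operator A A (Q l)) \<and>
     (\<forall>f\<in>C0 A. Q 0 f = f) \<and>
     (\<forall>k\<ge>0. \<forall>l\<ge>0. \<forall>f\<in>C0 A. Q (k + l) f = Q k (Q l f)) \<and>
     (\<forall>f\<in>C0 A. ((\<lambda>l. supnorm A (\<lambda>x. Q l f x - f x)) \<longlongrightarrow> 0) (at_right 0)) \<and>
     (\<forall>l\<ge>0. \<forall>f\<in>C0 A. (\<forall>x. 0 \<le> f x) \<longrightarrow> (\<forall>x. 0 \<le> Q l f x)) \<and>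
     (\<forall>l\<ge>0. \<forall>f\<in>C0 A. supnorm A (Q l f) \<le> supnorm A f)"

definition generator_limit :: "'e set \<Rightarrow> (real \<Rightarrow> 'e oper) \<Rightarrow> 'e fn \<Rightarrow> 'e fn \<Rightarrow> bool" where
  "generator_limit A Q g h \<longleftrightarrow>
     ((\<lambda>l. supnorm A (\<lambda>x. (Q l g x - g x) / l - h x)) \<longlongrightarrow> 0) (at_right 0)"

text \<open>\<open>H\<close>, with domain exactly \<open>D\<close>, is the strong generator of \<open>Q\<close> on \<open>C0 A\<close>.\<close>

definition strong_generator ::
    "'e set \<Rightarrow> (real \<Rightarrow> 'e oper) \<Rightarrow> 'e fn set \<Rightarrow> 'e oper \<Rightarrow> bool" where
  "strong_generator A Q D H \<longleftrightarrow>
     D = {g \<in> C0 A. \<exists>h\<in>C0 A. generator_limit A Q g h} \<and>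
     (\<forall>g\<in>D. H g \<in> C0 A \<and> generator_limit A Q g (H g))"

definition generator_matrix :: "real ^ 'e ^ 'e \<Rightarrow> bool" where
  "generator_matrix L \<longleftrightarrow> (\<forall>i j. i \<noteq> j \<longrightarrow> 0 \<le> L $ i $ j) \<and> (\<forall>i. (\<Sum>j\<in>UNIV. L $ i $ j) = 0)"

definition mult_op :: "(real \<Rightarrow> real ^ 'e ^ 'e) \<Rightarrow> 'e::finite oper" where
  "mult_op \<Lambda> g x = (case x of None \<Rightarrow> 0
     | Some (s, i) \<Rightarrow> (\<Lambda> s *v (\<chi> j. g (Some (s, j)))) $ i)"

definition Vinv :: "('e option \<Rightarrow> real) \<Rightarrow> 'e oper" where
  "Vinv v g x = (case x of None \<Rightarrow> 0 | Some (s, i) \<Rightarrow> inverse (v (Some i)) * g (Some (s, i)))"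

definition Epos :: "('e option \<Rightarrow> real) \<Rightarrow> 'e set" where
  "Epos v = {i. 0 < v (Some i)}"

definition Eneg :: "('e option \<Rightarrow> real) \<Rightarrow> 'e set" where
  "Eneg v = {i. v (Some i) < 0}"

text \<open>The function on the whole space whose restrictions are the components of the given pair.\<close>

definition glue :: "('e option \<Rightarrow> real) \<Rightarrow> 'e fn \<times> 'e fn \<Rightarrow> 'e fn" where
  "glue v p x = (case x of None \<Rightarrow> 0
     | Some (s, i) \<Rightarrow> if i \<in> Epos v then fst p (Some (s, i))
                     else if i \<in> Eneg v then snd p (Some (s, i)) else 0)"

text \<open>The operator matrix with rows \<open>(T11, T12)\<close> and \<open>(T21, T22)\<close>.\<close>

definition op_matrix ::
    "'e oper \<Rightarrow> 'e oper \<Rightarrow> 'e oper \<Rightarrow> 'e oper \<Rightarrow> 'e fn \<times> 'e fn \<Rightarrow> 'e fn \<times> 'e fn" where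
  "op_matrix T11 T12 T21 T22 p =
     ((\<lambda>x. T11 (fst p) x + T12 (snd p) x), (\<lambda>x. T21 (fst p) x + T22 (snd p) x))"

definition operator_equation ::
    "('e::finite option \<Rightarrow> real) \<Rightarrow> (real \<Rightarrow> real ^ 'e ^ 'e) \<Rightarrow>
     'e oper \<Rightarrow> 'e oper \<Rightarrow> 'e oper \<Rightarrow> 'e oper \<Rightarrow> bool" where
  "operator_equation v \<Lambda> Sp Hp Sm Hm \<longleftrightarrow>
     (\<forall>gp\<in>C01 (Epos v). \<forall>gm\<in>C01 (Eneg v).
        (let g = glue v (op_matrix id Sm Sp id (gp, gm))
         in Vinv v (\<lambda>x. dds UNIV g x + mult_op \<Lambda> g x)) =
        glue v (op_matrix id Sm Sp id
          (op_matrix Hp (\<lambda>_ _. 0) (\<lambda>_ _. 0) (\<lambda>f x. - Hm f x) (gp, gm))))"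

text \<open>
  Operators are extensional (\<open>\<rightarrow>\<^sub>E\<close>, i.e. undefined off their domain), so that equality
  of HOL functions is equality of operators with these domains.
\<close>

definition admissible_S :: "'e set \<Rightarrow> 'e set \<Rightarrow> 'e oper \<Rightarrow> bool" where
  "admissible_S A B S \<longleftrightarrow>
     S \<in> C0 A \<rightarrow>\<^sub>E C0 B \<and> bounded_operator A B S \<and>
     (\<forall>g\<in>Cc A. \<forall>\<eta>>0. supp A g \<subseteq> {0..\<eta>} \<times> A \<longrightarrow> supp B (S g) \<subseteq> {0..\<eta>} \<times> B) \<and>
     (\<forall>g\<in>C01 A. S g \<in> C01 B)"

definition admissible_H :: "'e set \<Rightarrow> 'e oper \<Rightarrow> bool" where
  "admissible_H A H \<longleftrightarrow>
     H \<in> C01 A \<rightarrow>\<^sub>E C0 A \<and>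
     (\<exists>Q. sc_pos_contr_semigroup A Q \<and> strong_generator A Q (C01 A) H)"

end

theory Submission imports Defs begin

text \<open>
  \<^bold>\<open>Splitting.\<close> Setting \<open>g\<^sup>- = 0\<close> and then \<open>g\<^sup>+ = 0\<close> separates the operator equation into one system for
  \<open>(S\<^sup>+, H\<^sup>+)\<close> and one for \<open>(S\<^sup>-, H\<^sup>-)\<close>, and the second is the first with \<open>v\<close> replaced by \<open>-v\<close>
  (\<open>operator_equation_iff\<close>). So let \<open>A\<close> be the set of states of one sign and \<open>nu = \<bar>v\<bar>\<close>. One looks for
  \<open>S : C\<^sub>0(A) \<rightarrow> C\<^sub>0(-A)\<close> and \<open>H\<close> with \<open>H g = nu\<^sup>-\<^sup>1 (\<partial> + \<Lambda>)(g + S g)\<close> on \<open>A\<close> and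
  \<open>S H g = - nu\<^sup>-\<^sup>1 (\<partial> + \<Lambda>)(g + S g)\<close> on \<open>-A\<close> (\<open>half_equation\<close>).

  \<^bold>\<open>Existence.\<close> Run the chain with generators \<open>\<Lambda>\<^sub>s\<close> together with a level that moves up with speed
  \<open>nu\<close> in \<open>A\<close> and down with speed \<open>nu\<close> outside \<open>A\<close>. Let \<open>F(l, s, i)\<close> be the mean of \<open>g\<close>, taken at the
  time and the state in which the level first passes \<open>l\<close>, for the start at time \<open>s\<close> in \<open>i\<close> at level \<open>0\<close>.
  Then \<open>H\<close> generates \<open>Q\<^sub>l g = F(l)\<close> on \<open>A\<close>, and \<open>S g = F(0)\<close> on \<open>-A\<close>. Analytically, \<open>F\<close> is obtained by
  conditioning on the first jump: \<open>\<Lambda> + K\<close> has non-negative entries and row sums \<open>K\<close>, so with jump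
  rate \<open>K\<close> and an additional killing rate \<open>1\<close> the resulting linear map is a strict contraction on
  bounded continuous functions of \<open>l\<close> with values in \<open>C\<^sub>0\<close> (\<open>renewal_contraction\<close>). Uniqueness of its
  fixed point is the semigroup property (\<open>killed_passage_shift\<close>). The fixed point respects all
  upper bounds \<open>e\<^sup>s u(s)\<close> with \<open>u\<close> non-negative and non-increasing (\<open>killed_passage_le\<close>). Multiplication
  by \<open>e\<^sup>-\<^sup>s\<close> turns the killed problem into the original one, but only for data in the dense subspace
  \<open>e\<^sup>-\<^sup>s C\<^sub>0\<close>; there the order bounds give norm at most one, hence an extension to \<open>C\<^sub>0\<close>
  (\<open>extend_along_damp\<close>), and they also give positivity and the support condition. Differentiating
  the two renewal equations at \<open>l = 0\<close> shows that \<open>H\<close> is a bounded perturbation of the generator of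
  the translation semigroup, so that its domain is \<open>C\<^sub>0\<^sup>1\<close> (\<open>genQ_iff\<close>, \<open>C01_gen\<close>, \<open>gen_C01\<close>), and that
  \<open>S\<close> maps \<open>C\<^sub>0\<^sup>1\<close> to itself and satisfies the second equation (\<open>S_gen\<close>).

  \<^bold>\<open>Uniqueness.\<close> Eliminating \<open>H\<close> leaves a Riccati equation for \<open>S\<close>; integrated along the
  translation semigroup \<open>T\<close> it reads \<open>S = T\<^sub>h S T\<^sub>h + \<integral>\<^sub>0\<^sup>h T\<^sub>r \<Phi>(S) T\<^sub>r dr\<close> with a quadratic \<open>\<Phi>\<close>
  (\<open>riccati_mild\<close>). The support condition makes \<open>S\<close> causal: \<open>S g(s)\<close> only sees \<open>g\<close> after time \<open>s\<close>
  (\<open>lift_causal\<close>). Therefore \<open>e\<^sup>a\<^sup>s S e\<^sup>-\<^sup>a\<^sup>s\<close> is bounded by the bound of \<open>S\<close> for every \<open>a \<ge> 0\<close>, while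
  the conjugation adds killing at rate \<open>a\<close> to \<open>T\<close>. For large \<open>a\<close> this makes two bounded solutions equal
  (\<open>mild_riccati_unique\<close>). The first equation then determines \<open>H\<close>.
\<close>

section \<open>The Banach space of continuous functions vanishing at infinity\<close>

lemma bounded_of_vanishing:
  fixes f :: "real \<Rightarrow> real"
  assumes "continuous_on {0..} f" and "(f \<longlongrightarrow> 0) at_top"
  shows "bounded (f ` {0..})"
proof -
  from tendstoD[OF assms(2), of 1] have "\<forall>\<^sub>F s in at_top. \<bar>f s\<bar> < 1" by simp
  then obtain N where N: "\<And>s. s \<ge> N \<Longrightarrow> \<bar>f s\<bar> < 1"
    unfolding eventually_at_top_linorder by blast
  have "continuous_on {0..max 0 N} f"
    by (rule continuous_on_subset[OF assms(1)]) (simp add: subset_iff)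
  then have "compact (f ` {0..max 0 N})"
    by (rule compact_continuous_image) simp
  then have "bounded (f ` {0..max 0 N})" by (rule compact_imp_bounded)
  moreover have "bounded (f ` {max 0 N..})"
  proof (rule boundedI)
    fix y assume "y \<in> f ` {max 0 N..}"
    then obtain s where s: "s \<ge> N" "y = f s" by (metis atLeast_iff imageE max.boundedE)
    with N[of s] show "norm y \<le> 1" by simp
  qed
  ultimately have "bounded (f ` {0..max 0 N} \<union> f ` {max 0 N..})" by simp
  moreover have "f ` {0..} \<subseteq> f ` {0..max 0 N} \<union> f ` {max 0 N..}"
  proof
    fix y assume "y \<in> f ` {0..}"
    then obtain s where s: "0 \<le> s" "y = f s" by auto
    show "y \<in> f ` {0..max 0 N} \<union> f ` {max 0 N..}"
      using s by (cases "s \<le> max 0 N") simp_all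
  qed
  ultimately show ?thesis by (rule bounded_subset)
qed

text \<open>
  Boundedness and measurability are automatic: each of the finitely many sections is continuous
  and vanishes at infinity.
\<close>

lemma C0_iff:
  fixes A :: "'e::finite set"
  shows "f \<in> C0 A \<longleftrightarrow> (\<forall>x. x \<notin> Xbar A \<longrightarrow> f x = 0) \<and> f None = 0 \<and>
    (\<forall>i\<in>A. continuous_on {0..} (\<lambda>s. f (Some (s, i))) \<and> ((\<lambda>s. f (Some (s, i))) \<longlongrightarrow> 0) at_top)"
    (is "_ \<longleftrightarrow> ?R")
proof
  assume R: ?R
  have "bounded (f ` Xbar A)"
  proof -
    have eq: "f ` Xbar A = insert (f None) (\<Union>i\<in>A. (\<lambda>s. f (Some (s, i))) ` {0..})"
    proof (intro equalityI subsetI)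
      fix y assume "y \<in> f ` Xbar A"
      then obtain x where x: "x \<in> Xbar A" "y = f x" by blast
      then show "y \<in> insert (f None) (\<Union>i\<in>A. (\<lambda>s. f (Some (s, i))) ` {0..})"
        by (cases x) (auto simp: Xbar_def)
    next
      fix y assume "y \<in> insert (f None) (\<Union>i\<in>A. (\<lambda>s. f (Some (s, i))) ` {0..})"
      then show "y \<in> f ` Xbar A" unfolding Xbar_def by blast
    qed
    have "bounded ((\<lambda>s. f (Some (s, i))) ` {0..})" if "i \<in> A" for i
      by (rule bounded_of_vanishing) (use R that in auto)
    then show ?thesis unfolding eq by (simp add: bounded_UN)
  qed
  moreover have "\<forall>i\<in>A. (\<lambda>s. f (Some (s, i))) \<in> borel_measurable (restrict_space borel {0..})"
    using R by (blast intro: borel_measurable_continuous_on_restrict)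
  ultimately show "f \<in> C0 A" using R by (simp add: C0_def Linf_def)
qed (simp add: C0_def Linf_def)

lemma C0_add: "f \<in> C0 A \<Longrightarrow> g \<in> C0 A \<Longrightarrow> (\<lambda>x. f x + g x) \<in> C0 (A :: 'e::finite set)"
  unfolding C0_iff by (simp add: continuous_on_add tendsto_add_zero)

lemma C0_scale: "f \<in> C0 A \<Longrightarrow> (\<lambda>x. c * f x) \<in> C0 (A :: 'e::finite set)"
  unfolding C0_iff by (simp add: continuous_on_mult_left tendsto_mult_right_zero)

lemma C0_zero: "(\<lambda>_. 0) \<in> C0 (A :: 'e::finite set)"
  unfolding C0_iff by auto

lemma Xbar_mono: "A \<subseteq> B \<Longrightarrow> Xbar A \<subseteq> Xbar B"
  by (auto simp: Xbar_def)

lemma C0_mono: 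
  fixes A :: "'e::finite set"
  assumes "A \<subseteq> B" "f \<in> C0 A" shows "f \<in> C0 B"
  unfolding C0_iff
proof (intro conjI ballI)
  show "\<forall>x. x \<notin> Xbar B \<longrightarrow> f x = 0" "f None = 0" using assms Xbar_mono[of A B] by (auto simp: C0_iff)
  fix i assume "i \<in> B"
  show "continuous_on {0..} (\<lambda>s. f (Some (s, i)))"
       "((\<lambda>s. f (Some (s, i))) \<longlongrightarrow> 0) at_top"
  proof -
    have f: "\<And>x. x \<notin> Xbar A \<Longrightarrow> f x = 0" using assms(2) by (simp add: C0_iff)
    have "f (Some (s, i)) = 0" if "i \<notin> A" for s
      by (rule f) (use that in \<open>auto simp: Xbar_def\<close>)
    then have "continuous_on {0..} (\<lambda>s. f (Some (s, i))) \<and> ((\<lambda>s. f (Some (s, i))) \<longlongrightarrow> 0) at_top"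
      if "i \<notin> A" using that by simp
    moreover have "continuous_on {0..} (\<lambda>s. f (Some (s, i))) \<and> ((\<lambda>s. f (Some (s, i))) \<longlongrightarrow> 0) at_top"
      if "i \<in> A" using assms(2) that by (simp add: C0_iff)
    ultimately show "continuous_on {0..} (\<lambda>s. f (Some (s, i)))"
       "((\<lambda>s. f (Some (s, i))) \<longlongrightarrow> 0) at_top"
      by blast+
  qed
qed

text \<open>
  All function spaces over subsets \<open>A\<close> are handled inside one Banach space, \<open>C\<^sub>0\<close> over all states:
  \<open>C0 A\<close> is its closed subspace of functions vanishing outside \<open>A\<close> (see \<open>C0_restr_iff\<close>).
\<close>

typedef ('e::finite) c0 = "C0 (UNIV :: 'e set)" morphisms fn_of c0_of
  using C0_zero by blast

lemma c0_of_inverse': "f \<in> C0 A \<Longrightarrow> fn_of (c0_of f) = f"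
  using C0_mono[of A UNIV] c0_of_inverse by blast

text \<open>
  Sections are extended to negative times by their value at \<open>0\<close>; so they are continuous on the whole
  real line and can be composed with any continuous function of time.
\<close>

definition val :: "'e::finite c0 \<Rightarrow> 'e \<Rightarrow> real \<Rightarrow> real" where
  "val f i s = fn_of f (Some (max 0 s, i))"

lemma fn_of_None[simp]: "fn_of f None = 0"
  using fn_of[of f] by (auto simp: C0_iff)

lemma fn_of_Some: "fn_of f (Some (s, i)) = (if 0 \<le> s then val f i s else 0)"
  using fn_of[of f] by (auto simp: C0_iff val_def Xbar_def)

lemma val_cont_nonneg: "continuous_on {0..} (val f i)"
proof -
  have "continuous_on {0..} (\<lambda>s. fn_of f (Some (s, i)))" using fn_of[of f] by (auto simp: C0_iff)
  then show ?thesis by (rule continuous_on_eq) (auto simp: val_def)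
qed

lemma val_max[simp]: "val f i (max 0 s) = val f i s"
  by (simp add: val_def)

lemma val_cont[continuous_intros]: "continuous_on S g \<Longrightarrow> continuous_on S (\<lambda>x. val f i (g x))"
proof -
  assume g: "continuous_on S g"
  have "continuous_on S (\<lambda>x. val f i (max 0 (g x)))"
    by (rule continuous_on_compose2[OF val_cont_nonneg]) (auto intro!: continuous_intros g)
  then show ?thesis by simp
qed

lemma val_lim: "(val f i \<longlongrightarrow> 0) at_top"
proof -
  have "((\<lambda>s. fn_of f (Some (s, i))) \<longlongrightarrow> 0) at_top" using fn_of[of f] by (auto simp: C0_iff)
  then show ?thesis
    by (rule Lim_transform_eventually)
      (auto simp: fn_of_Some eventually_at_top_linorder intro!: exI[of _ 0])
qed

lemma c0_eqI: "(\<And>i s. 0 \<le> s \<Longrightarrow> val f i s = val g i s) \<Longrightarrow> f = g"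
proof -
  assume *: "\<And>i s. 0 \<le> s \<Longrightarrow> val f i s = val g i s"
  have "fn_of f x = fn_of g x" for x
    by (cases x) (auto simp: fn_of_Some *)
  then show "f = g" by (metis fn_of_inject ext)
qed

definition mk :: "('e::finite \<Rightarrow> real \<Rightarrow> real) \<Rightarrow> 'e c0" where
  "mk p = c0_of (\<lambda>x. case x of None \<Rightarrow> 0 | Some (s, i) \<Rightarrow> if 0 \<le> s then p i s else 0)"

lemma val_mk:
  assumes "\<And>i. continuous_on {0..} (p i)" "\<And>i. (p i \<longlongrightarrow> 0) at_top" "0 \<le> s"
  shows "val (mk p) i s = p i s"
proof -
  let ?f = "\<lambda>x. case x of None \<Rightarrow> 0 | Some (s, i) \<Rightarrow> if 0 \<le> s then p i s else 0"
  have "?f \<in> C0 UNIV"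
    unfolding C0_iff
  proof (intro conjI ballI allI impI)
    fix i :: 'a
    show "continuous_on {0..} (\<lambda>s. ?f (Some (s, i)))"
      by (rule continuous_on_eq[OF assms(1)[of i]]) auto
    show "((\<lambda>s. ?f (Some (s, i))) \<longlongrightarrow> 0) at_top"
      by (rule Lim_transform_eventually[OF assms(2)[of i]])
        (auto simp: eventually_at_top_linorder intro!: exI[of _ 0])
  next
    fix x :: "(real \<times> 'a) option" assume "x \<notin> Xbar UNIV"
    then show "?f x = 0" by (cases x) (auto simp: Xbar_def image_iff split: if_splits)
  qed auto
  then show ?thesis using assms(3) by (simp add: val_def mk_def c0_of_inverse)
qed

instantiation c0 :: (finite) real_vector
begin

definition zero_c0 :: "'a c0" where "zero_c0 = c0_of (\<lambda>_. 0)"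
definition plus_c0 :: "'a c0 \<Rightarrow> 'a c0 \<Rightarrow> 'a c0" where "plus_c0 f g = c0_of (\<lambda>x. fn_of f x + fn_of g x)"
definition scaleR_c0 :: "real \<Rightarrow> 'a c0 \<Rightarrow> 'a c0" where "scaleR_c0 c f = c0_of (\<lambda>x. c * fn_of f x)"
definition uminus_c0 :: "'a c0 \<Rightarrow> 'a c0" where "uminus_c0 f = c0_of (\<lambda>x. (-1) * fn_of f x)"
definition minus_c0 :: "'a c0 \<Rightarrow> 'a c0 \<Rightarrow> 'a c0" where "minus_c0 f g = c0_of (\<lambda>x. fn_of f x + (-1) * fn_of g x)"
lemma fn_of_zero [simp]: "fn_of 0 = (\<lambda>_. 0)"
  by (simp add: zero_c0_def c0_of_inverse C0_zero)
lemma fn_of_add: "fn_of (f + g) = (\<lambda>x. fn_of f x + fn_of g x)" for f :: "'a c0"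
  by (simp add: plus_c0_def c0_of_inverse C0_add fn_of)
lemma fn_of_scaleR: "fn_of (c *\<^sub>R f) = (\<lambda>x. c * fn_of f x)" for f :: "'a c0"
  by (simp add: scaleR_c0_def c0_of_inverse C0_scale fn_of)
lemma fn_of_uminus: "fn_of (- f) = (\<lambda>x. - fn_of f x)" for f :: "'a c0"
  using C0_scale[OF fn_of, of "-1" f] by (simp add: uminus_c0_def c0_of_inverse)
lemma fn_of_diff: "fn_of (f - g) = (\<lambda>x. fn_of f x - fn_of g x)" for f :: "'a c0"
  using C0_add[OF fn_of C0_scale[OF fn_of, of "-1"], of f g] by (simp add: minus_c0_def c0_of_inverse)

lemmas fn_of_simps = fn_of_add fn_of_scaleR fn_of_uminus fn_of_diff

instance
proof
  fix f g h :: "'a c0" and a b :: real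
  have eqI: "fn_of x = fn_of y \<Longrightarrow> x = y" for x y :: "'a c0" by (simp add: fn_of_inject)
  show "f + g + h = f + (g + h)" "f + g = g + f" "0 + f = f" "- f + f = 0" "f - g = f + - g"
    "a *\<^sub>R (f + g) = a *\<^sub>R f + a *\<^sub>R g" "(a + b) *\<^sub>R f = a *\<^sub>R f + b *\<^sub>R f"
    "a *\<^sub>R b *\<^sub>R f = (a * b) *\<^sub>R f" "1 *\<^sub>R f = f"
    by (rule eqI; simp add: fn_of_simps algebra_simps)+
qed

end

instantiation c0 :: (finite) real_normed_vector
begin

definition norm_c0 :: "'a c0 \<Rightarrow> real" where "norm_c0 f = supnorm UNIV (fn_of f)"
definition dist_c0 :: "'a c0 \<Rightarrow> 'a c0 \<Rightarrow> real" where "dist_c0 f g = norm (f - g)"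
definition sgn_c0 :: "'a c0 \<Rightarrow> 'a c0" where "sgn_c0 f = f /\<^sub>R norm f"
definition uniformity_c0 :: "('a c0 \<times> 'a c0) filter"
  where "uniformity_c0 = (INF e\<in>{0 <..}. principal {(x, y). dist x y < e})"
definition open_c0 :: "'a c0 set \<Rightarrow> bool"
  where "open_c0 S = (\<forall>x\<in>S. \<forall>\<^sub>F (x', y) in uniformity. x' = x \<longrightarrow> y \<in> S)"

lemma abs_fn_of_le_norm: "\<bar>fn_of f x\<bar> \<le> norm f" for f :: "'a c0"
proof (cases "x \<in> Xbar UNIV")
  case True
  have "bounded (fn_of f ` Xbar UNIV)" using fn_of[of f] by (auto simp: C0_def Linf_def)
  then have "bdd_above ((\<lambda>x. \<bar>fn_of f x\<bar>) ` Xbar UNIV)"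
    by (auto simp: bounded_iff bdd_above_def)
  then show ?thesis unfolding norm_c0_def supnorm_def by (rule cSUP_upper[OF True])
next
  case False
  then have "fn_of f x = 0" using fn_of[of f] by (auto simp: C0_iff)
  moreover have "\<bar>fn_of f None\<bar> \<le> norm f"
    unfolding norm_c0_def supnorm_def
    by (rule cSUP_upper) (use fn_of[of f] in \<open>auto simp: C0_def Linf_def Xbar_def bounded_iff bdd_above_def\<close>)
  ultimately show ?thesis by simp
qed

lemma norm_c0_leI': "(\<And>x. \<bar>fn_of f x\<bar> \<le> b) \<Longrightarrow> norm f \<le> b" for f :: "'a c0"
  unfolding norm_c0_def supnorm_def by (rule cSUP_least) (auto simp: Xbar_def)

instance
proof
  fix f g h :: "'a c0" and a b :: real
  have eqI: "fn_of x = fn_of y \<Longrightarrow> x = y" for x y :: "'a c0" by (simp add: fn_of_inject)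
  show "norm f = 0 \<longleftrightarrow> f = 0"
  proof
    assume 0: "norm f = 0"
    show "f = 0" by (rule eqI, rule ext) (use abs_fn_of_le_norm[of f] 0 in simp)
  next
    assume "f = 0"
    then have "norm f \<le> 0" by (intro norm_c0_leI') simp
    then show "norm f = 0" using abs_fn_of_le_norm[of f None] by simp
  qed
  show "norm (f + g) \<le> norm f + norm g"
    by (rule norm_c0_leI') (auto simp: fn_of_simps intro: abs_triangle_ineq[THEN order_trans] add_mono abs_fn_of_le_norm)
  show "norm (a *\<^sub>R f) = \<bar>a\<bar> * norm f"
  proof (rule antisym)
    have le: "norm (c *\<^sub>R f) \<le> \<bar>c\<bar> * norm f" for c and f :: "'a c0"
      by (rule norm_c0_leI') (auto simp: fn_of_simps abs_mult intro!: mult_left_mono abs_fn_of_le_norm)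
    show "norm (a *\<^sub>R f) \<le> \<bar>a\<bar> * norm f" by (rule le)
    show "\<bar>a\<bar> * norm f \<le> norm (a *\<^sub>R f)"
    proof (cases "a = 0")
      case True
      then show ?thesis using abs_fn_of_le_norm[of "a *\<^sub>R f" None] by simp
    next
      case False
      have "inverse a *\<^sub>R a *\<^sub>R f = f" by (rule eqI) (use False in \<open>simp add: fn_of_simps\<close>)
      then show ?thesis using le[of "inverse a" "a *\<^sub>R f"] False by (simp add: field_simps)
    qed
  qed
qed (rule dist_c0_def sgn_c0_def uniformity_c0_def open_c0_def)+

end

lemma val_zero [simp]: "val 0 i s = 0"
  by (simp add: val_def)
lemma val_add [simp]: "val (f + g) i s = val f i s + val g i s"
  by (simp add: val_def fn_of_simps)
lemma val_scaleR [simp]: "val (c *\<^sub>R f) i s = c * val f i s"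
  by (simp add: val_def fn_of_simps)
lemma val_uminus [simp]: "val (- f) i s = - val f i s"
  by (simp add: val_def fn_of_simps)
lemma val_diff [simp]: "val (f - g) i s = val f i s - val g i s"
  by (simp add: val_def fn_of_simps)

lemma abs_val_le: "\<bar>val f i s\<bar> \<le> norm f"
  unfolding val_def by (rule abs_fn_of_le_norm)

lemma norm_c0_le:
  assumes "0 \<le> b" "\<And>i s. 0 \<le> s \<Longrightarrow> \<bar>val f i s\<bar> \<le> b" shows "norm f \<le> b"
proof (rule norm_c0_leI')
  fix x show "\<bar>fn_of f x\<bar> \<le> b" using assms by (cases x) (auto simp: fn_of_Some)
qed

lemma bounded_linear_val: "bounded_linear (\<lambda>f. val f i s)"
  by (rule bounded_linear_intro[where K = 1]) (auto simp: abs_val_le)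

instance c0 :: (finite) banach
proof
  fix f :: "nat \<Rightarrow> 'a c0" assume C: "Cauchy f"
  have "\<forall>e>0. \<exists>N. \<forall>m n x. N \<le> m \<and> N \<le> n \<and> True \<longrightarrow> dist (fn_of (f m) x) (fn_of (f n) x) < e"
  proof (intro allI impI)
    fix e :: real assume "e > 0"
    with C obtain N where N: "\<And>m n. m \<ge> N \<Longrightarrow> n \<ge> N \<Longrightarrow> dist (f m) (f n) < e"
      unfolding Cauchy_def by blast
    show "\<exists>N. \<forall>m n x. N \<le> m \<and> N \<le> n \<and> True \<longrightarrow> dist (fn_of (f m) x) (fn_of (f n) x) < e"
    proof (intro exI[of _ N] allI impI)
      fix m n x assume "N \<le> m \<and> N \<le> n \<and> True"
      then show "dist (fn_of (f m) x) (fn_of (f n) x) < e"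
        using N[of m n] abs_fn_of_le_norm[of "f m - f n" x] by (simp add: dist_norm fn_of_simps)
    qed
  qed
  then obtain l where l: "\<And>e. e > 0 \<Longrightarrow> \<exists>N. \<forall>n x. N \<le> n \<longrightarrow> dist (fn_of (f n) x) (l x) < e"
    using uniformly_convergent_eq_cauchy[of "\<lambda>_. True" "\<lambda>n. fn_of (f n)"] by auto
  have lim: "(\<lambda>n. fn_of (f n) x) \<longlonglongrightarrow> l x" for x
    unfolding lim_sequentially using l by blast
  have "l \<in> C0 UNIV"
    unfolding C0_iff
  proof (intro conjI ballI allI impI)
    fix x assume "x \<notin> Xbar (UNIV :: 'a set)"
    then have "fn_of (f n) x = 0" for n using fn_of[of "f n"] by (auto simp: C0_iff)
    then show "l x = 0" using lim[of x] by (simp add: LIMSEQ_const_iff)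
  next
    show "l None = 0" using lim[of None] by (simp add: LIMSEQ_const_iff)
  next
    fix i :: 'a
    show "continuous_on {0..} (\<lambda>s. l (Some (s, i)))"
    proof (rule uniform_limit_theorem)
      show "\<forall>\<^sub>F n in sequentially. continuous_on {0..} (\<lambda>s. fn_of (f n) (Some (s, i)))"
        using fn_of[of "f _"] by (auto simp: C0_iff)
      show "uniform_limit {0..} (\<lambda>n s. fn_of (f n) (Some (s, i))) (\<lambda>s. l (Some (s, i))) sequentially"
        unfolding uniform_limit_sequentially_iff using l by blast
    qed simp
    show "((\<lambda>s. l (Some (s, i))) \<longlongrightarrow> 0) at_top"
    proof (rule tendstoI)
      fix e :: real assume "e > 0"
      then obtain n where n: "\<And>x. dist (fn_of (f n) x) (l x) < e/2" using l[of "e/2"] by auto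
      have "((\<lambda>s. fn_of (f n) (Some (s, i))) \<longlongrightarrow> 0) at_top"
        using fn_of[of "f n"] by (auto simp: C0_iff)
      from tendstoD[OF this, of "e/2"] \<open>e > 0\<close>
      have "\<forall>\<^sub>F s in at_top. dist (fn_of (f n) (Some (s, i))) 0 < e/2" by auto
      then show "\<forall>\<^sub>F s in at_top. dist (l (Some (s, i))) 0 < e"
      proof eventually_elim
        case (elim s)
        then show ?case using n[of "Some (s, i)"] unfolding dist_real_def by linarith
      qed
    qed
  qed
  then have fl: "fn_of (c0_of l) = l" by (rule c0_of_inverse)
  have "f \<longlonglongrightarrow> c0_of l"
  proof (rule LIMSEQ_I)
    fix e :: real assume "e > 0"
    then obtain N where N: "\<And>n x. N \<le> n \<Longrightarrow> dist (fn_of (f n) x) (l x) < e/2"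
      using l[of "e/2"] by auto
    have "norm (f n - c0_of l) \<le> e/2" if "n \<ge> N" for n
      by (rule norm_c0_leI') (use N[OF that] in \<open>auto simp: fn_of_simps fl dist_real_def less_imp_le\<close>)
    then show "\<exists>N. \<forall>n\<ge>N. norm (f n - c0_of l) < e" using \<open>e > 0\<close> by fastforce
  qed
  then show "convergent f" by (rule convergentI)
qed

section \<open>Contraction semigroups and their generators\<close>

text \<open>
  Difference quotients are the form in which the strong generator is given.
\<close>

lemma has_vector_derivative_iff_quotient:
  fixes f :: "real \<Rightarrow> 'x::real_normed_vector"
  shows "(f has_vector_derivative D) (at x within S) \<longleftrightarrow>
    ((\<lambda>y. (f y - f x) /\<^sub>R (y - x)) \<longlongrightarrow> D) (at x within S)"
proof -
  have "norm (f y - f x - (y - x) *\<^sub>R D) / norm (y - x) = norm ((f y - f x) /\<^sub>R (y - x) - D)"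
    if "y \<noteq> x" for y
  proof -
    have "f y - f x - (y - x) *\<^sub>R D = (y - x) *\<^sub>R ((f y - f x) /\<^sub>R (y - x) - D)"
      using that by (simp add: scaleR_right_diff_distrib)
    then show ?thesis using that by simp
  qed
  then have "((\<lambda>y. norm (f y - f x - (y - x) *\<^sub>R D) / norm (y - x)) \<longlongrightarrow> 0) (at x within S) \<longleftrightarrow>
    ((\<lambda>y. norm ((f y - f x) /\<^sub>R (y - x) - D)) \<longlongrightarrow> 0) (at x within S)"
    by (intro filterlim_cong) (auto simp: eventually_at_filter)
  then show ?thesis
    unfolding has_vector_derivative_def has_derivative_iff_norm
    by (simp add: bounded_linear_scaleR_left tendsto_norm_zero_iff LIM_zero_iff)
qed

text \<open>
  This yields the derivatives at \<open>0\<close> of all the integral terms in the renewal equations; there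
  the integrand depends on the length \<open>h\<close> of the interval as well.
\<close>

lemma average_tendsto:
  fixes p :: "real \<Rightarrow> real \<Rightarrow> 'x::banach"
  assumes p: "continuous_on UNIV (\<lambda>(h, r). p h r)"
  shows "((\<lambda>h. integral {0..h} (p h) /\<^sub>R h) \<longlongrightarrow> p 0 0) (at_right 0)"
proof (rule tendstoI)
  fix e :: real assume e: "e > 0"
  have "isCont (\<lambda>(h, r). p h r) (0, 0)" using p by (simp add: continuous_on_eq_continuous_at)
  then obtain d where d: "d > 0" "\<And>h r. dist (h, r) (0, 0) < d \<Longrightarrow> dist (p h r) (p 0 0) < e/2"
    using e unfolding continuous_at_eps_delta by (metis (mono_tags, lifting) case_prod_conv half_gt_zero)
  have cont: "continuous_on {0..h} (p h)" for h
  proof -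
    have "continuous_on {0..h} (\<lambda>r. (h, r))" by (intro continuous_intros)
    from continuous_on_compose2[OF p this] show ?thesis by simp
  qed
  have bd: "dist (integral {0..h} (p h) /\<^sub>R h) (p 0 0) < e" if h: "0 < h" "h < d/2" for h
  proof -
    have "norm (integral {0..h} (\<lambda>r. p h r - p 0 0)) \<le> e/2 * (h - 0)"
    proof (rule integral_bound)
      fix r assume r: "r \<in> {0..h}"
      have "dist (h, r) (0, 0) \<le> \<bar>h\<bar> + \<bar>r\<bar>" unfolding dist_Pair_Pair dist_real_def
        using sqrt_sum_squares_le_sum_abs[of h r] by simp
      then show "norm (p h r - p 0 0) \<le> e/2" using d(2)[of h r] r h by (simp add: dist_norm)
    qed (use h in \<open>auto intro!: continuous_intros cont\<close>)
    moreover have "integral {0..h} (\<lambda>r. p h r - p 0 0) = integral {0..h} (p h) - h *\<^sub>R p 0 0"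
      by (subst integral_diff) (use h in \<open>auto intro!: integrable_continuous_real cont\<close>)
    moreover have "integral {0..h} (p h) /\<^sub>R h - p 0 0 = (integral {0..h} (p h) - h *\<^sub>R p 0 0) /\<^sub>R h"
      using h by (simp add: scaleR_right_diff_distrib)
    ultimately have "norm (integral {0..h} (p h) /\<^sub>R h - p 0 0) \<le> inverse h * (e/2 * h)"
      using h by (simp only: norm_scaleR) (simp add: mult_left_mono)
    also have "\<dots> = e/2" using h by simp
    finally have "norm (integral {0..h} (p h) /\<^sub>R h - p 0 0) \<le> e/2" .
    then show ?thesis using e by (simp add: dist_norm)
  qed
  show "\<forall>\<^sub>F h in at_right 0. dist (integral {0..h} (p h) /\<^sub>R h) (p 0 0) < e"
    unfolding eventually_at_right_field by (rule exI[of _ "d/2"]) (use bd d(1) in auto)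
qed

lemma blinfun_integral:
  fixes L :: "'x::banach \<Rightarrow>\<^sub>L 'y::banach"
  assumes "continuous_on {a..b::real} f"
  shows "L (integral {a..b} f) = integral {a..b} (\<lambda>r. L (f r))"
  using integral_blinfun_apply[OF integrable_continuous_real[OF assms]] by metis

locale contraction_semigroup =
  fixes T :: "real \<Rightarrow> 'x::banach \<Rightarrow>\<^sub>L 'x"
  assumes T_zero [simp]: "T 0 x = x"
    and T_add: "0 \<le> a \<Longrightarrow> 0 \<le> b \<Longrightarrow> T (a + b) x = T a (T b x)"
    and T_norm: "norm (T r x) \<le> norm x"
    and T_cont_orbit: "continuous_on UNIV (\<lambda>r. T r x)"
begin

text \<open>
  Strong continuity together with the uniform bound gives joint continuity.
\<close>

lemma T_tendsto:
  assumes "(f \<longlongrightarrow> a) F" "(g \<longlongrightarrow> x) F"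
  shows "((\<lambda>y. T (f y) (g y)) \<longlongrightarrow> T a x) F"
proof -
  have "((\<lambda>y. T (f y) x) \<longlongrightarrow> T a x) F"
  proof (rule isCont_tendsto_compose[OF _ assms(1)])
    show "isCont (\<lambda>r. T r x) a" using T_cont_orbit[of x] by (simp add: continuous_on_eq_continuous_at)
  qed
  moreover have "((\<lambda>y. T (f y) (g y - x)) \<longlongrightarrow> 0) F"
  proof (rule Lim_null_comparison)
    show "\<forall>\<^sub>F y in F. norm (T (f y) (g y - x)) \<le> norm (g y - x)" by (simp add: T_norm)
    show "((\<lambda>y. norm (g y - x)) \<longlongrightarrow> 0) F" using assms(2) by (simp add: tendsto_norm_zero LIM_zero)
  qed
  ultimately have "((\<lambda>y. T (f y) x + T (f y) (g y - x)) \<longlongrightarrow> T a x + 0) F" by (rule tendsto_add)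
  then show ?thesis by (simp add: blinfun.diff_right)
qed

lemma T_cont [continuous_intros]:
  "continuous_on S f \<Longrightarrow> continuous_on S g \<Longrightarrow> continuous_on S (\<lambda>x. T (f x) (g x))"
  unfolding continuous_on_def by (auto intro: T_tendsto)

lemma T_integral: "continuous_on {a..b::real} f \<Longrightarrow> T r (integral {a..b} f) = integral {a..b} (\<lambda>u. T r (f u))"
  by (rule blinfun_integral)

text \<open>
  Every restart argument below rests on this: what happens after the first stage \<open>h\<close> is the same integral, started
  afresh and transported by \<open>T h\<close>.
\<close>

lemma integral_split:
  assumes D: "continuous_on UNIV D" and hk: "0 \<le> h" "0 \<le> k"
  shows "integral {0..h + k} (\<lambda>r. T r (D r)) =
    integral {0..h} (\<lambda>r. T r (D r)) + T h (integral {0..k} (\<lambda>r. T r (D (h + r))))"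
proof -
  let ?f = "\<lambda>r. T r (D r)"
  have f: "continuous_on S ?f" for S by (intro continuous_intros continuous_on_subset[OF D]) auto
  have "integral {0..h + k} ?f = integral {0..h} ?f + integral {h..h + k} ?f"
    by (rule Henstock_Kurzweil_Integration.integral_combine[symmetric])
      (use hk in \<open>auto intro!: integrable_continuous_real f\<close>)
  also have "integral {h..h + k} ?f = integral {0..k} (\<lambda>r. ?f (h + r))"
    using integral_shift_cbox_plus[of 0 k ?f h] by (simp add: o_def add.commute)
  also have "\<dots> = integral {0..k} (\<lambda>r. T h (T r (D (h + r))))"
    by (rule integral_cong) (use hk in \<open>auto simp: T_add\<close>)
  also have "\<dots> = T h (integral {0..k} (\<lambda>r. T r (D (h + r))))"
    by (rule T_integral[symmetric])
      (auto intro!: continuous_intros continuous_on_compose2[OF D])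
  finally show ?thesis .
qed

definition gen :: "'x \<Rightarrow> 'x \<Rightarrow> bool" where
  "gen x z \<longleftrightarrow> ((\<lambda>h. (T h x - x) /\<^sub>R h) \<longlongrightarrow> z) (at_right 0)"

lemma gen_unique: "gen x z \<Longrightarrow> gen x w \<Longrightarrow> z = w"
  unfolding gen_def by (rule tendsto_unique[rotated]) auto

text \<open>
  The generator is a one-sided limit at \<open>0\<close>. The quotients at \<open>r\<close> from either side are obtained from it by
  applying \<open>T\<close> at the earlier of the two times, so joint continuity gives a two-sided derivative.
\<close>

lemma gen_orbit_deriv:
  assumes "gen x z" "0 \<le> r"
  shows "((\<lambda>r. T r x) has_vector_derivative T r z) (at r within {0..})"
proof -
  let ?q = "\<lambda>h. (T h x - x) /\<^sub>R h"
  let ?F = "at r within {0..}"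
  have abs: "filterlim (\<lambda>s. \<bar>s - r\<bar>) (at_right 0) ?F"
    unfolding filterlim_at
    by (auto simp: eventually_at_filter intro!: tendsto_eq_intros)
  have "((\<lambda>s. ?q \<bar>s - r\<bar>) \<longlongrightarrow> z) ?F"
    using filterlim_compose[OF assms(1)[unfolded gen_def] abs] .
  moreover have "((\<lambda>s. min r s) \<longlongrightarrow> r) ?F"
    by (auto intro!: tendsto_eq_intros)
  ultimately have "((\<lambda>s. T (min r s) (?q \<bar>s - r\<bar>)) \<longlongrightarrow> T r z) ?F"
    by (rule T_tendsto[rotated])
  moreover have "\<forall>\<^sub>F s in ?F. T (min r s) (?q \<bar>s - r\<bar>) = (T s x - T r x) /\<^sub>R (s - r)"
  proof -
    have "T (min r s) (?q \<bar>s - r\<bar>) = (T s x - T r x) /\<^sub>R (s - r)" if "s \<noteq> r" "0 \<le> s" for s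
    proof (cases "r < s")
      case True
      then show ?thesis using T_add[of r "s - r" x] assms(2)
        by (simp add: blinfun.diff_right blinfun.scaleR_right)
    next
      case False
      then have "T r x = T s (T (r - s) x)" using T_add[of s "r - s" x] that by simp
      moreover have "inverse (s - r) = - inverse (r - s)" by (metis inverse_minus_eq minus_diff_eq)
      ultimately show ?thesis using False that
        by (simp add: blinfun.diff_right blinfun.scaleR_right min_def scaleR_diff_right)
    qed
    then show ?thesis by (auto simp: eventually_at_filter)
  qed
  ultimately show ?thesis
    unfolding has_vector_derivative_iff_quotient by (rule Lim_transform_eventually)
qed

text \<open>
  Together with \<open>gen_average\<close> this says that the domain of the generator is dense.
\<close>

lemma gen_dense: "((\<lambda>h. integral {0..h} (\<lambda>r. T r x) /\<^sub>R h) \<longlongrightarrow> x) (at_right 0)"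
proof -
  have "continuous_on UNIV (\<lambda>(h::real, r). T r x)" unfolding split_def by (intro continuous_intros)
  from average_tendsto[OF this] show ?thesis by simp
qed

text \<open>
  Integrated form of membership in the graph of the generator; it can be checked pointwise.
\<close>

lemma genI_integral:
  assumes "\<And>h. 0 \<le> h \<Longrightarrow> T h x - x = integral {0..h} (\<lambda>r. T r z)"
  shows "gen x z"
proof -
  show ?thesis unfolding gen_def
    by (rule Lim_transform_eventually[OF gen_dense]) (auto simp: eventually_at_filter assms)
qed

lemma gen_orbit: "gen x z \<Longrightarrow> 0 \<le> r \<Longrightarrow> gen (T r x) (T r z)"
proof -
  assume *: "gen x z" "0 \<le> r"
  have "((\<lambda>h. T r ((T h x - x) /\<^sub>R h)) \<longlongrightarrow> T r z) (at_right 0)"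
    by (rule T_tendsto[OF tendsto_const *(1)[unfolded gen_def]])
  moreover have "\<forall>\<^sub>F h in at_right 0. T r ((T h x - x) /\<^sub>R h) = (T h (T r x) - T r x) /\<^sub>R h"
    using *(2) by (auto simp: eventually_at_filter blinfun.diff_right blinfun.scaleR_right
        T_add[symmetric] add.commute)
  ultimately show ?thesis unfolding gen_def by (rule Lim_transform_eventually)
qed

lemma gen_average:
  assumes "0 \<le> k"
  shows "gen (integral {0..k} (\<lambda>r. T r x)) (T k x - x)"
proof -
  let ?I = "\<lambda>h. integral {0..h} (\<lambda>r. T r x)"
  have avg: "((\<lambda>h. ?I h /\<^sub>R h) \<longlongrightarrow> x) (at_right 0)"
    by (rule gen_dense)
  have "((\<lambda>h. T k (?I h /\<^sub>R h) - ?I h /\<^sub>R h) \<longlongrightarrow> T k x - x) (at_right 0)"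
    by (intro tendsto_diff T_tendsto tendsto_const avg)
  moreover have "T k (?I h /\<^sub>R h) - ?I h /\<^sub>R h = (T h (?I k) - ?I k) /\<^sub>R h" if "0 < h" for h
  proof -
    have "?I (h + k) = ?I h + T h (?I k)" "?I (k + h) = ?I k + T k (?I h)"
      using integral_split[of "\<lambda>_. x" h k] integral_split[of "\<lambda>_. x" k h] that assms by auto
    then have "T h (?I k) - ?I k = T k (?I h) - ?I h" by (simp add: add.commute algebra_simps)
    then show ?thesis by (simp add: blinfun.scaleR_right scaleR_diff_right)
  qed
  then have "\<forall>\<^sub>F h in at_right 0. T k (?I h /\<^sub>R h) - ?I h /\<^sub>R h = (T h (?I k) - ?I k) /\<^sub>R h"
    by (auto simp: eventually_at_filter)
  ultimately show ?thesis unfolding gen_def by (rule Lim_transform_eventually)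
qed

lemma gen_scale: "gen x z \<Longrightarrow> gen (c *\<^sub>R x) (c *\<^sub>R z)"
  unfolding gen_def
  by (drule tendsto_scaleR[OF tendsto_const[of c]])
    (simp add: blinfun.scaleR_right scaleR_diff_right mult.commute)

text \<open>
  Product rule for \<open>T r (y r)\<close> in which \<open>y\<close> need only take its value at \<open>r\<close> in the domain of the generator,
  because the increment of \<open>y\<close> can be absorbed by the contraction at the new time.
\<close>

lemma product_deriv:
  assumes y: "(y has_vector_derivative y') (at r within {0..})"
    and w: "gen (y r) w" and r: "0 \<le> r"
  shows "((\<lambda>r. T r (y r)) has_vector_derivative T r (w + y')) (at r within {0..})"
proof -
  let ?F = "at r within {0..}"
  have "((\<lambda>s. T s ((y s - y r) /\<^sub>R (s - r)) + (T s (y r) - T r (y r)) /\<^sub>R (s - r)) \<longlongrightarrow> T r y' + T r w) ?F"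
    by (intro tendsto_add T_tendsto y[unfolded has_vector_derivative_iff_quotient]
        gen_orbit_deriv[OF w r, unfolded has_vector_derivative_iff_quotient] tendsto_ident_at)
  moreover have "\<forall>\<^sub>F s in ?F. T s ((y s - y r) /\<^sub>R (s - r)) + (T s (y r) - T r (y r)) /\<^sub>R (s - r) =
     (T s (y s) - T r (y r)) /\<^sub>R (s - r)"
    by (rule always_eventually)
      (simp add: blinfun.diff_right blinfun.scaleR_right scaleR_diff_right)
  ultimately show ?thesis
    unfolding has_vector_derivative_iff_quotient blinfun.add_right
    by (subst add.commute) (rule Lim_transform_eventually)
qed

end

section \<open>Damping, translation and jump operators\<close>

text \<open>
  All concrete operators are given by formulas for their values; this is their common construction.
\<close>

lemma pointwise_operator:
  fixes p :: "'e::finite c0 \<Rightarrow> 'e \<Rightarrow> real \<Rightarrow> real"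
  assumes cont: "\<And>f i. continuous_on {0..} (p f i)" and lim: "\<And>f i. (p f i \<longlongrightarrow> 0) at_top"
    and add: "\<And>f g i s. 0 \<le> s \<Longrightarrow> p (f + g) i s = p f i s + p g i s"
    and scale: "\<And>c f i s. 0 \<le> s \<Longrightarrow> p (c *\<^sub>R f) i s = c * p f i s"
    and bound: "\<And>f i s. 0 \<le> s \<Longrightarrow> \<bar>p f i s\<bar> \<le> C * norm f"
  shows "0 \<le> s \<Longrightarrow> val (Blinfun (\<lambda>f. mk (p f)) f) i s = p f i s"
    and "0 \<le> C \<Longrightarrow> norm (Blinfun (\<lambda>f. mk (p f)) f) \<le> C * norm f"
proof -
  have v: "val (mk (p f)) i s = p f i s" if "0 \<le> s" for f i s by (rule val_mk[OF cont lim that])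
  have n: "norm (mk (p f)) \<le> max 0 C * norm f" for f
  proof (rule norm_c0_le)
    fix i and s :: real assume "0 \<le> s"
    then show "\<bar>val (mk (p f)) i s\<bar> \<le> max 0 C * norm f"
      unfolding v[OF \<open>0 \<le> s\<close>] using bound[of s f i] mult_right_mono[of C "max 0 C" "norm f"] by simp
  qed simp
  have "bounded_linear (\<lambda>f. mk (p f))"
  proof (rule bounded_linear_intro[where K = "max 0 C"])
    show "mk (p (f + g)) = mk (p f) + mk (p g)" for f g by (rule c0_eqI) (simp add: v add)
    show "mk (p (c *\<^sub>R f)) = c *\<^sub>R mk (p f)" for c f by (rule c0_eqI) (simp add: v scale)
    show "norm (mk (p f)) \<le> norm f * max 0 C" for f using n[of f] by (simp add: mult.commute)
  qed
  then have b: "Blinfun (\<lambda>f. mk (p f)) f = mk (p f)" for f by (simp add: bounded_linear_Blinfun_apply)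
  show "0 \<le> s \<Longrightarrow> val (Blinfun (\<lambda>f. mk (p f)) f) i s = p f i s" unfolding b by (rule v)
  show "0 \<le> C \<Longrightarrow> norm (Blinfun (\<lambda>f. mk (p f)) f) \<le> C * norm f" unfolding b using n[of f] by simp
qed

definition mulop :: "('e::finite \<Rightarrow> real \<Rightarrow> real) \<Rightarrow> 'e c0 \<Rightarrow>\<^sub>L 'e c0" where
  "mulop w = Blinfun (\<lambda>f. mk (\<lambda>i s. w i s * val f i s))"

lemma mulop:
  assumes w: "\<And>i. continuous_on {0..} (w i)" "\<And>i s. 0 \<le> s \<Longrightarrow> \<bar>w i s\<bar> \<le> c"
  shows val_mulop: "0 \<le> s \<Longrightarrow> val (mulop w f) i s = w i s * val f i s"
    and norm_mulop: "norm (mulop w f) \<le> c * norm f"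
proof -
  let ?p = "\<lambda>f i s. w i s * val f i s"
  have 1: "continuous_on {0..} (?p f i)" for f i
    by (intro continuous_intros w)
  have 2: "(?p f i \<longlongrightarrow> 0) at_top" for f i
  proof (rule Lim_null_comparison)
    show "\<forall>\<^sub>F s in at_top. norm (?p f i s) \<le> c * \<bar>val f i s\<bar>"
      by (auto simp: eventually_at_top_linorder abs_mult intro!: exI[of _ 0] mult_right_mono w)
    show "((\<lambda>s. c * \<bar>val f i s\<bar>) \<longlongrightarrow> 0) at_top"
      by (rule tendsto_mult_right_zero) (rule tendsto_rabs_zero[OF val_lim])
  qed
  have c: "0 \<le> c" using w(2)[of 0 undefined] by (meson abs_ge_zero order_trans order_refl)
  have 3: "\<bar>?p f i s\<bar> \<le> c * norm f" if "0 \<le> s" for f i s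
    unfolding abs_mult by (intro mult_mono w that abs_val_le c) auto
  show "0 \<le> s \<Longrightarrow> val (mulop w f) i s = w i s * val f i s"
    unfolding mulop_def by (rule pointwise_operator(1)[OF 1 2 _ _ 3]) (auto simp: algebra_simps)
  show "norm (mulop w f) \<le> c * norm f"
    unfolding mulop_def by (rule pointwise_operator(2)[OF 1 2 _ _ 3 c]) (auto simp: algebra_simps)
qed

definition restr :: "'e::finite set \<Rightarrow> 'e c0 \<Rightarrow>\<^sub>L 'e c0" where
  "restr A = mulop (\<lambda>i s. if i \<in> A then 1 else 0)"

lemma val_restr [simp]: "val (restr A f) i s = (if i \<in> A then val f i s else 0)"
proof -
  have "val (restr A f) i (max 0 s) = (if i \<in> A then 1 else 0) * val f i (max 0 s)"
    unfolding restr_def by (rule val_mulop[of _ 1]) auto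
  then show ?thesis by simp
qed

lemma norm_restr: "norm (restr A f) \<le> norm f"
  by (rule norm_c0_le) (auto simp: abs_val_le)

text \<open>
  Conjugation with \<open>damp a\<close> exchanges killing at rate \<open>a\<close> for no killing (see \<open>T_damp\<close>).
\<close>

definition damp :: "real \<Rightarrow> 'e::finite c0 \<Rightarrow>\<^sub>L 'e c0" where
  "damp a = mulop (\<lambda>i s. exp (- a * s))"

lemma val_damp: "0 \<le> a \<Longrightarrow> 0 \<le> s \<Longrightarrow> val (damp a f) i s = exp (- a * s) * val f i s"
  unfolding damp_def by (rule val_mulop[of _ 1]) (auto intro!: continuous_intros)

lemma norm_damp: "0 \<le> a \<Longrightarrow> norm (damp a f) \<le> norm f"
proof -
  assume a: "0 \<le> a"
  have "norm (mulop (\<lambda>i s. exp (- a * s)) f) \<le> 1 * norm f"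
    by (rule norm_mulop) (use a in \<open>auto intro!: continuous_intros\<close>)
  then show ?thesis unfolding damp_def by simp
qed

lemma damp_inj: "0 \<le> a \<Longrightarrow> damp a f = damp a g \<Longrightarrow> f = g"
proof (rule c0_eqI)
  fix i and s :: real assume "0 \<le> a" "damp a f = damp a g" "0 \<le> s"
  then show "val f i s = val g i s" using val_damp[of a s f i] val_damp[of a s g i] by simp
qed

text \<open>
  A bounded substitute for multiplication by \<open>e\<^sup>a\<^sup>s\<close>, the inverse of \<open>damp a\<close>, exact up to time \<open>n\<close>.
\<close>

definition grow :: "real \<Rightarrow> nat \<Rightarrow> 'e::finite c0 \<Rightarrow>\<^sub>L 'e c0" where
  "grow a n = mulop (\<lambda>i s. exp (a * min s (real n)))"

lemma val_grow: "0 \<le> a \<Longrightarrow> 0 \<le> s \<Longrightarrow> val (grow a n f) i s = exp (a * min s (real n)) * val f i s"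
  unfolding grow_def by (rule val_mulop[of _ "exp (a * real n)"])
    (auto intro!: continuous_intros mult_left_mono)

text \<open>
  The range of \<open>damp a\<close> is dense, with approximants that depend linearly on \<open>f\<close>: the error lives on
  \<open>[n, \<infinity>)\<close>, where \<open>f\<close> is small.
\<close>

lemma damp_grow: 
  assumes "0 \<le> a"
  shows "(\<lambda>n. damp a (grow a n f)) \<longlonglongrightarrow> f"
proof (rule LIMSEQ_I)
  fix e :: real assume e: "e > 0"
  have "\<exists>N. \<forall>s\<ge>N. \<bar>val f i s\<bar> < e/2" for i
    using e tendstoD[OF val_lim, of "e/2" f i] by (simp add: eventually_at_top_linorder)
  then obtain N where N: "\<And>i s. s \<ge> N i \<Longrightarrow> \<bar>val f i s\<bar> < e/2" by metis
  have "norm (damp a (grow a n f) - f) < e" if n: "n \<ge> nat \<lceil>Max (range N)\<rceil>" for n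
  proof -
    have "norm (damp a (grow a n f) - f) \<le> e/2"
    proof (rule norm_c0_le)
      fix i and s :: real assume s: "0 \<le> s"
      let ?c = "exp (- a * s) * exp (a * min s (real n))"
      have v: "val (damp a (grow a n f) - f) i s = (?c - 1) * val f i s"
        using assms s by (simp add: val_damp val_grow algebra_simps)
      show "\<bar>val (damp a (grow a n f) - f) i s\<bar> \<le> e/2"
      proof (cases "s \<le> real n")
        case True
        then have "?c = 1" by (simp add: exp_add[symmetric])
        then show ?thesis using v e by simp
      next
        case False
        have "N i \<le> Max (range N)" by (rule Max_ge) auto
        then have "N i \<le> real n" using n by linarith
        then have "\<bar>val f i s\<bar> < e/2" using False N by auto
        moreover have "?c = exp (a * (real n - s))" using False by (simp add: exp_add[symmetric] algebra_simps)
        moreover have "a * (real n - s) \<le> 0" using False assms by (intro mult_nonneg_nonpos) auto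
        ultimately have "0 \<le> ?c" "?c \<le> 1" by auto
        then have "\<bar>?c - 1\<bar> * \<bar>val f i s\<bar> \<le> 1 * \<bar>val f i s\<bar>" by (intro mult_right_mono) auto
        then show ?thesis unfolding v abs_mult using \<open>\<bar>val f i s\<bar> < e/2\<close> by simp
      qed
    qed (use e in auto)
    then show ?thesis using e by simp
  qed
  then show "\<exists>N. \<forall>n\<ge>N. norm (damp a (grow a n f) - f) < e" by blast
qed

lemma eq_on_damp_range:
  fixes F G :: "'e::finite c0 \<Rightarrow> 'y::t2_space"
  assumes "0 \<le> a" "continuous_on UNIV F" "continuous_on UNIV G" "\<And>f. F (damp a f) = G (damp a f)"
  shows "F g = G g"
proof (rule LIMSEQ_unique)
  have c: "isCont F g" "isCont G g" using assms by (auto simp: continuous_on_eq_continuous_at)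
  show "(\<lambda>n. F (damp a (grow a n g))) \<longlonglongrightarrow> F g"
    by (rule isCont_tendsto_compose[OF c(1) damp_grow[OF assms(1)]])
  show "(\<lambda>n. F (damp a (grow a n g))) \<longlonglongrightarrow> G g"
    unfolding assms(4) by (rule isCont_tendsto_compose[OF c(2) damp_grow[OF assms(1)]])
qed

text \<open>
  A continuous function with limits at both ends of the line is uniformly continuous.
\<close>

lemma val_uniform:
  fixes f :: "'e::finite c0"
  assumes e: "e > 0"
  shows "\<exists>d>0. \<forall>i. \<forall>s t. \<bar>s - t\<bar> < d \<longrightarrow> \<bar>val f i s - val f i t\<bar> < e"
proof -
  have "\<exists>d>0. \<forall>s t. \<bar>s - t\<bar> < d \<longrightarrow> \<bar>val f i s - val f i t\<bar> < e" for i
  proof -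
    have "\<exists>N. \<forall>s\<ge>N. \<bar>val f i s\<bar> < e/2"
      using e tendstoD[OF val_lim, of "e/2"] by (simp add: eventually_at_top_linorder)
    then obtain N where N: "\<And>s. s \<ge> N \<Longrightarrow> \<bar>val f i s\<bar> < e/2" by metis
    have "uniformly_continuous_on {0..max 0 N + 1} (val f i)"
      by (rule compact_uniformly_continuous) (auto intro!: continuous_intros)
    then obtain d where d: "d > 0"
      "\<And>s t. s \<in> {0..max 0 N + 1} \<Longrightarrow> t \<in> {0..max 0 N + 1} \<Longrightarrow> \<bar>s - t\<bar> < d \<Longrightarrow> \<bar>val f i s - val f i t\<bar> < e"
      using e unfolding uniformly_continuous_on_def dist_real_def by (metis abs_minus_commute)
    have "\<bar>val f i s - val f i t\<bar> < e" if st: "\<bar>s - t\<bar> < min 1 d" for s t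
    proof -
      let ?s = "max 0 s" and ?t = "max 0 t"
      have st': "\<bar>?s - ?t\<bar> < min 1 d" using st by linarith
      show ?thesis
      proof (cases "?s \<le> max 0 N + 1 \<and> ?t \<le> max 0 N + 1")
        case True
        then show ?thesis using d(2)[of ?s ?t] st' by simp
      next
        case False
        then have "?s \<ge> N" "?t \<ge> N" using st' by linarith+
        then show ?thesis using N[of ?s] N[of ?t] by simp
      qed
    qed
    then show ?thesis using d(1) by (intro exI[of _ "min 1 d"]) auto
  qed
  then obtain d where d: "\<And>i. d i > 0" "\<And>i s t. \<bar>s - t\<bar> < d i \<Longrightarrow> \<bar>val f i s - val f i t\<bar> < e" by metis
  have "Min (range d) > 0" using d(1) by simp
  moreover have "Min (range d) \<le> d i" for i by (rule Min_le) auto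
  ultimately show ?thesis using d(2) by (intro exI[of _ "Min (range d)"]) (auto intro: less_le_trans)
qed

lemma val_integral:
  assumes "continuous_on {a..b::real} F"
  shows "val (integral {a..b} F) i s = integral {a..b} (\<lambda>r. val (F r) i s)"
  using integral_linear[OF integrable_continuous_real[OF assms] bounded_linear_val[of i s]]
  by (simp add: o_def)

lemma val_fun_cont:
  "continuous_on S F \<Longrightarrow> continuous_on S (\<lambda>r. val (F r) i s)"
  by (rule bounded_linear.continuous_on[OF bounded_linear_val])

text \<open>
  Bounds the contribution of the first jump, whose density along a trajectory is exponential.
\<close>

lemma exp_integral_bound:
  fixes f :: "real \<Rightarrow> real"
  assumes "0 \<le> h" "continuous_on {0..h} f" "\<And>r. r \<in> {0..h} \<Longrightarrow> f r \<le> C * (k * exp (- k * r))"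
  shows "integral {0..h} f \<le> C * (1 - exp (- k * h))"
proof -
  have "((\<lambda>r. C * (k * exp (- k * r))) has_integral (- C * exp (- k * h) - - C * exp (- k * 0))) {0..h}"
    by (rule fundamental_theorem_of_calculus[OF assms(1)])
      (auto simp flip: has_real_derivative_iff_has_vector_derivative intro!: derivative_eq_intros)
  from integrable_integral[OF integrable_continuous_real[OF assms(2)]] this assms(3)
  have "integral {0..h} f \<le> - C * exp (- k * h) - - C * exp (- k * 0)" by (rule has_integral_le)
  then show ?thesis by (simp add: algebra_simps)
qed

text \<open>
  \<open>nu i\<close> is the speed \<open>\<bar>v(i)\<bar>\<close> of the level in state \<open>i\<close>; the direction of motion is fixed later by a
  set of states.
\<close>

locale generator_family =
  fixes nu :: "'e::finite \<Rightarrow> real" and Lam :: "real \<Rightarrow> real ^ 'e ^ 'e" and K :: real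
  assumes nu_pos: "0 < nu i"
    and Lam_generator: "0 \<le> s \<Longrightarrow> generator_matrix (Lam s)"
    and K_pos: "0 < K"
    and Lam_bound: "0 \<le> s \<Longrightarrow> \<bar>Lam s $ i $ j\<bar> \<le> K"
    and Lam_cont: "continuous_on {0..} Lam"
begin

text \<open>
  Translation by the time needed to move the level by \<open>r\<close>, with killing at rate \<open>k\<close> per unit of
  time. It is extended constantly to \<open>r < 0\<close>, so that orbits are continuous on the whole line.
\<close>

definition T :: "real \<Rightarrow> real \<Rightarrow> 'e c0 \<Rightarrow>\<^sub>L 'e c0" where
  "T k r = Blinfun (\<lambda>f. mk (\<lambda>i s. exp (- k * (max 0 r / nu i)) * val f i (s + max 0 r / nu i)))"

lemma T_facts:
  assumes k: "0 \<le> k"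
  shows val_T_max: "0 \<le> s \<Longrightarrow> val (T k r f) i s = exp (- k * (max 0 r / nu i)) * val f i (s + max 0 r / nu i)"
    and norm_T: "norm (T k r f) \<le> norm f"
proof -
  let ?t = "\<lambda>i. max 0 r / nu i"
  let ?p = "\<lambda>f i s. exp (- k * ?t i) * val f i (s + ?t i)"
  have t: "0 \<le> ?t i" for i using nu_pos[of i] by simp
  have 1: "continuous_on {0..} (?p f i)" for f i by (intro continuous_intros)
  have 2: "(?p f i \<longlongrightarrow> 0) at_top" for f i
  proof (rule tendsto_mult_right_zero)
    have "filterlim (\<lambda>s. s + ?t i) at_top at_top"
      by (rule filterlim_at_top_mono[OF filterlim_ident])
        (auto simp: eventually_at_top_linorder t[of i, simplified])
    then show "((\<lambda>s. val f i (s + ?t i)) \<longlongrightarrow> 0) at_top" by (rule filterlim_compose[OF val_lim])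
  qed
  have 3: "\<bar>?p f i s\<bar> \<le> 1 * norm f" if "0 \<le> s" for f i s
    unfolding abs_mult by (intro mult_mono abs_val_le) (use mult_nonneg_nonneg[OF k t[of i]] in auto)
  show "0 \<le> s \<Longrightarrow> val (T k r f) i s = exp (- k * ?t i) * val f i (s + ?t i)"
    unfolding T_def by (rule pointwise_operator(1)[OF 1 2 _ _ 3]) (auto simp: algebra_simps)
  show "norm (T k r f) \<le> norm f"
    unfolding T_def using pointwise_operator(2)[OF 1 2 _ _ 3, where f = f] by (auto simp: algebra_simps)
qed

lemma val_T: "0 \<le> k \<Longrightarrow> 0 \<le> s \<Longrightarrow> 0 \<le> r \<Longrightarrow> val (T k r f) i s = exp (- k * (r / nu i)) * val f i (s + r / nu i)"
  using val_T_max[of k s r f i] by simp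

text \<open>
  Strong continuity is uniform continuity of the sections. It suffices to treat \<open>r = 0\<close>, since
  \<open>T\<close> at the smaller time can be split off from a difference.
\<close>

lemma T_semigroup:
  assumes k: "0 \<le> k" shows "contraction_semigroup (T k)"
proof
  show "T k 0 x = x" for x by (rule c0_eqI) (simp add: val_T k)
  show add: "T k (a + b) x = T k a (T k b x)" if "0 \<le> a" "0 \<le> b" for a b x
  proof (rule c0_eqI)
    fix i and s :: real assume s: "0 \<le> s"
    have "0 \<le> s + a / nu i" using s that nu_pos[of i] by simp
    then show "val (T k (a + b) x) i s = val (T k a (T k b x)) i s"
      using s that k by (simp add: val_T exp_add[symmetric] add_divide_distrib algebra_simps)
  qed
  show n: "norm (T k r x) \<le> norm x" for r x by (rule norm_T[OF k])
  show "continuous_on UNIV (\<lambda>r. T k r x)" for x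
  proof -
    have right: "\<exists>d>0. \<forall>h. 0 \<le> h \<and> h < d \<longrightarrow> norm (T k h x - x) < e" if e: "e > 0" for e
    proof -
      obtain d where d: "d > 0" "\<And>i s t. \<bar>s - t\<bar> < d \<Longrightarrow> \<bar>val x i s - val x i t\<bar> < e/3"
        using val_uniform[of "e/3" x] e by auto
      define m where "m = Min (range nu)"
      have m: "m > 0" "\<And>i. m \<le> nu i" using nu_pos unfolding m_def by auto
      have "((\<lambda>h. exp (- k * (h / m)) * norm x) \<longlongrightarrow> exp (- k * (0 / m)) * norm x) (at 0)"
        by (intro tendsto_intros) (use m in auto)
      then have "((\<lambda>h. exp (- k * (h / m)) * norm x) \<longlongrightarrow> norm x) (at 0)" by simp
      from tendstoD[OF this, of "e/3"] e obtain d' where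
        d': "d' > 0" "\<And>h. h \<noteq> 0 \<Longrightarrow> \<bar>h\<bar> < d' \<Longrightarrow> \<bar>exp (- k * (h / m)) * norm x - norm x\<bar> < e/3"
        unfolding eventually_at by (auto simp: dist_real_def)
      have "norm (T k h x - x) < e" if h: "0 \<le> h" "h < min (d * m) d'" for h
      proof -
        have "norm (T k h x - x) \<le> 2 * e/3"
        proof (rule norm_c0_le)
          fix i and s :: real assume s: "0 \<le> s"
          let ?E = "exp (- k * (h / nu i))"
          have hm: "h / nu i \<le> h / m" using m h by (intro divide_left_mono) (auto simp: nu_pos)
          have "h / m < d" using h m by (simp add: divide_less_eq)
          then have a: "\<bar>val x i (s + h / nu i) - val x i s\<bar> < e/3"
            using hm h nu_pos[of i] by (intro d(2)) auto
          have E: "exp (- k * (h / m)) \<le> ?E" "?E \<le> 1"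
            using mult_left_mono[OF hm k] mult_nonneg_nonneg[of k "h / nu i"] k h nu_pos[of i] by auto
          have b: "(1 - exp (- k * (h / m))) * norm x < e/3"
          proof (cases "h = 0")
            case False
            with d'(2)[of h] h have "\<bar>exp (- k * (h / m)) * norm x - norm x\<bar> < e/3" by simp
            then show ?thesis unfolding left_diff_distrib by linarith
          qed (use e in simp)
          have "val (T k h x - x) i s = ?E * (val x i (s + h / nu i) - val x i s) - (1 - ?E) * val x i s"
            using s h k by (simp add: val_T algebra_simps)
          also have "\<bar>\<dots>\<bar> \<le> \<bar>?E * (val x i (s + h / nu i) - val x i s)\<bar> + \<bar>(1 - ?E) * val x i s\<bar>" by linarith
          also have "\<bar>?E * (val x i (s + h / nu i) - val x i s)\<bar> \<le> 1 * \<bar>val x i (s + h / nu i) - val x i s\<bar>"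
            unfolding abs_mult by (intro mult_right_mono) (use E in auto)
          also have "\<bar>(1 - ?E) * val x i s\<bar> \<le> (1 - exp (- k * (h / m))) * norm x"
            unfolding abs_mult by (intro mult_mono abs_val_le) (use E in auto)
          finally show "\<bar>val (T k h x - x) i s\<bar> \<le> 2 * e/3" using a b by simp
        qed (use e in simp)
        then show ?thesis using e by simp
      qed
      then show ?thesis using d(1) d'(1) m by (intro exI[of _ "min (d * m) d'"]) auto
    qed
    have max: "T k r x = T k (max 0 r) x" for r by (simp add: T_def)
    have le: "norm (T k b x - T k a x) \<le> norm (T k (b - a) x - x)" if "0 \<le> a" "a \<le> b" for a b
      using n[of a "T k (b - a) x - x"] add[of a "b - a" x] that by (simp add: blinfun.diff_right)
    show ?thesis
      unfolding continuous_on_iff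
    proof (intro ballI allI impI)
      fix r e :: real assume "e > 0"
      then obtain d where d: "d > 0" "\<And>h. 0 \<le> h \<Longrightarrow> h < d \<Longrightarrow> norm (T k h x - x) < e" using right by metis
      show "\<exists>d>0. \<forall>r'\<in>UNIV. dist r' r < d \<longrightarrow> dist (T k r' x) (T k r x) < e"
      proof (intro exI[of _ d] conjI ballI impI d(1))
        fix r' assume "dist r' r < d"
        then have ab: "\<bar>max 0 r' - max 0 r\<bar> < d" unfolding dist_real_def by linarith
        have near: "dist (T k b x) (T k a x) < e" if "0 \<le> a" "a \<le> b" "b - a < d" for a b
          using le[OF that(1,2)] d(2)[of "b - a"] that unfolding dist_norm by linarith
        have "dist (T k (max 0 r') x) (T k (max 0 r) x) < e"
        proof (cases "max 0 r \<le> max 0 r'")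
          case True
          then show ?thesis using ab by (intro near) linarith+
        next
          case False
          then show ?thesis using ab by (subst dist_commute, intro near) linarith+
        qed
        then show "dist (T k r' x) (T k r x) < e" by (simp flip: max)
      qed
    qed
  qed
qed

lemma T_restr: "0 \<le> k \<Longrightarrow> restr A (T k r f) = T k r (restr A f)"
  by (rule c0_eqI) (simp add: val_T_max)

lemma T_damp:
  assumes "0 \<le> k" "0 \<le> a" shows "damp a (T (k + a) r f) = T k r (damp a f)"
proof (rule c0_eqI)
  fix i and s :: real assume s: "0 \<le> s"
  define t where "t = max 0 r / nu i"
  have t: "0 \<le> t" using nu_pos[of i] by (simp add: t_def)
  have "- a * s + - (k + a) * t = - k * t + - a * (s + t)" by (simp add: algebra_simps)
  then have "exp (- a * s) * exp (- (k + a) * t) = exp (- k * t) * exp (- a * (s + t))"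
    unfolding exp_add[symmetric] by simp
  then show "val (damp a (T (k + a) r f)) i s = val (T k r (damp a f)) i s"
    using assms s t by (simp add: val_damp val_T_max flip: t_def)
qed

text \<open>
  Uniformization: adding \<open>K\<close> on the diagonal makes all entries non-negative with row sums \<open>K\<close>.
\<close>

definition rate :: "real \<Rightarrow> 'e \<Rightarrow> 'e \<Rightarrow> real" where
  "rate s i j = Lam (max 0 s) $ i $ j + (if i = j then K else 0)"

lemma rate_nonneg: "0 \<le> rate s i j"
  using Lam_generator[of "max 0 s"] Lam_bound[of "max 0 s" i i]
  by (auto simp: rate_def generator_matrix_def)

lemma rate_sum: "(\<Sum>j\<in>UNIV. rate s i j) = K"
  using Lam_generator[of "max 0 s"] by (simp add: rate_def generator_matrix_def sum.distrib)

text \<open>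
  The jump operator per unit of level. The generator \<open>nu\<^sup>-\<^sup>1 (\<partial> + \<Lambda>)\<close> equals \<open>nu\<^sup>-\<^sup>1 (\<partial> - K)\<close>, which generates
  \<open>T K\<close>, plus \<open>P\<close>.
\<close>

definition P :: "'e c0 \<Rightarrow>\<^sub>L 'e c0" where
  "P = Blinfun (\<lambda>f. mk (\<lambda>i s. (\<Sum>j\<in>UNIV. rate s i j * val f j s) / nu i))"

lemma rate_mono: "(\<And>j. x j \<le> u) \<Longrightarrow> (\<Sum>j\<in>UNIV. rate s i j * x j) \<le> K * u"
proof -
  assume "\<And>j. x j \<le> u"
  then have "(\<Sum>j\<in>UNIV. rate s i j * x j) \<le> (\<Sum>j\<in>UNIV. rate s i j * u)"
    by (intro sum_mono mult_left_mono rate_nonneg)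
  also have "\<dots> = K * u" unfolding sum_distrib_right[symmetric] rate_sum ..
  finally show ?thesis .
qed

lemma P_facts:
  shows val_P: "0 \<le> s \<Longrightarrow> val (P f) i s = (\<Sum>j\<in>UNIV. rate s i j * val f j s) / nu i"
    and norm_P: "norm (P f) \<le> (K / Min (range nu)) * norm f"
proof -
  let ?p = "\<lambda>f i s. (\<Sum>j\<in>UNIV. rate s i j * val f j s) / nu i"
  have "continuous_on {0..} (\<lambda>s. Lam s $ i $ j)" for i j
    by (intro continuous_intros Lam_cont)
  then have rc: "continuous_on {0..} (\<lambda>s. rate s i j)" for i j
    by (rule continuous_on_eq[OF continuous_on_add[OF _ continuous_on_const]]) (auto simp: rate_def)
  have nu0: "nu i \<noteq> 0" for i using nu_pos[of i] by simp
  have 1: "continuous_on {0..} (?p f i)" for f i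
    by (intro continuous_intros rc) (auto simp: nu0)
  have ab: "\<bar>?p f i s\<bar> \<le> (K / nu i) * u" if "\<And>j. \<bar>val f j s\<bar> \<le> u" for f i s u
  proof -
    have "(\<Sum>j\<in>UNIV. rate s i j * val f j s) \<le> K * u" using that by (intro rate_mono) (simp add: abs_le_iff)
    moreover have "(\<Sum>j\<in>UNIV. rate s i j * (- val f j s)) \<le> K * u" using that by (intro rate_mono) (simp add: abs_le_iff)
    ultimately have "\<bar>\<Sum>j\<in>UNIV. rate s i j * val f j s\<bar> \<le> K * u" by (simp add: sum_negf)
    then show ?thesis using nu_pos[of i] by (simp add: divide_right_mono)
  qed
  have 2: "(?p f i \<longlongrightarrow> 0) at_top" for f i
  proof (rule Lim_null_comparison)
    have "\<bar>val f j s\<bar> \<le> (\<Sum>j\<in>UNIV. \<bar>val f j s\<bar>)" for j s by (rule member_le_sum) auto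
    then show "\<forall>\<^sub>F s in at_top. norm (?p f i s) \<le> (K / nu i) * (\<Sum>j\<in>UNIV. \<bar>val f j s\<bar>)"
      using ab by simp
    have "((\<lambda>s. \<Sum>j\<in>UNIV. \<bar>val f j s\<bar>) \<longlongrightarrow> (\<Sum>j\<in>(UNIV::'e set). 0)) at_top"
      by (intro tendsto_sum tendsto_rabs_zero val_lim)
    then show "((\<lambda>s. (K / nu i) * (\<Sum>j\<in>UNIV. \<bar>val f j s\<bar>)) \<longlongrightarrow> 0) at_top"
      by (intro tendsto_mult_right_zero) simp
  qed
  have m: "0 < Min (range nu)" "Min (range nu) \<le> nu i" for i using nu_pos by auto
  have 3: "\<bar>?p f i s\<bar> \<le> (K / Min (range nu)) * norm f" if "0 \<le> s" for f i s
  proof -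
    have "K / nu i \<le> K / Min (range nu)" using m K_pos nu_pos[of i] by (intro divide_left_mono) auto
    then show ?thesis using ab[of f s "norm f" i] abs_val_le
      by (meson mult_right_mono norm_ge_zero order_trans)
  qed
  show "0 \<le> s \<Longrightarrow> val (P f) i s = (\<Sum>j\<in>UNIV. rate s i j * val f j s) / nu i"
    unfolding P_def by (rule pointwise_operator(1)[OF 1 2 _ _ 3])
      (auto simp: algebra_simps sum.distrib sum_distrib_left add_divide_distrib)
  show "norm (P f) \<le> (K / Min (range nu)) * norm f"
    unfolding P_def
  proof (rule pointwise_operator(2)[OF 1 2 _ _ 3])
    show "0 \<le> K / Min (range nu)" by (rule divide_nonneg_nonneg[OF less_imp_le[OF K_pos] less_imp_le[OF m(1)]])
  qed (auto simp: algebra_simps sum.distrib sum_distrib_left add_divide_distrib)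
qed

lemma P_le: "0 \<le> s \<Longrightarrow> (\<And>j. val f j s \<le> u) \<Longrightarrow> val (P f) i s \<le> K / nu i * u"
  using rate_mono[of "\<lambda>j. val f j s" u s i] nu_pos[of i] by (simp add: val_P divide_right_mono)

lemma P_damp: "0 \<le> a \<Longrightarrow> damp a (P f) = P (damp a f)"
  by (rule c0_eqI) (simp add: val_damp val_P sum_distrib_left algebra_simps)

end

lemma damp_restr: "0 \<le> a \<Longrightarrow> damp a (restr A f) = restr A (damp a f)"
  by (rule c0_eqI) (simp add: val_damp)

section \<open>First passage with killing\<close>

lemma continuous_on_apply_UNIV:
  "continuous_on UNIV F \<Longrightarrow> continuous_on S f \<Longrightarrow> continuous_on S (\<lambda>x. F (f x))"
  by (rule continuous_on_compose2) auto

lemma continuous_on_blinfun_const: "continuous_on S f \<Longrightarrow> continuous_on S (\<lambda>x. blinfun_apply L (f x))"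
  by (intro blinfun.continuous_on continuous_on_const)

text \<open>
  Rescaling to the unit interval moves a variable endpoint into the integrand, so that continuity in
  the endpoint follows from continuity of parameter integrals.
\<close>

lemma integral_scale_unit:
  fixes f :: "real \<Rightarrow> 'x::banach"
  assumes "0 \<le> l"
  shows "integral {0..l} f = l *\<^sub>R integral {0..1} (\<lambda>t. f (l * t))"
proof (cases "l = 0")
  case False
  then have "(\<lambda>x. x / l) ` {0..l} = {0..1}"
    using assms by (auto simp: image_iff intro!: bexI[of _ "l * _"])
  then show ?thesis using integral_stretch_real[of l 0 l f] False assms by simp
qed simp

lemma integral_continuous_param:
  fixes f :: "'a::topological_space \<Rightarrow> real \<Rightarrow> 'x::banach"
  assumes "continuous_on UNIV (\<lambda>(x, t). f x t)"
  shows "continuous_on UNIV (\<lambda>x. integral {a..b} (f x))"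
  using integral_continuous_on_param[of UNIV a b f] continuous_on_subset[OF assms] by (simp add: box_real)

lemma bounded_linear_apply_bcontfun: "bounded_linear (\<lambda>F :: 'a::topological_space \<Rightarrow>\<^sub>C 'b::real_normed_vector. F x)"
  by (rule bounded_linear_intro[where K = 1])
    (auto simp: plus_bcontfun.rep_eq scaleR_bcontfun.rep_eq norm_bounded)

text \<open>
  The level rises in the states of \<open>A\<close> and falls in the others.
\<close>

locale first_passage = generator_family nu Lam K
  for nu :: "'e::finite \<Rightarrow> real" and Lam and K +
  fixes A :: "'e set"
begin

abbreviation "PA \<equiv> restr A"
abbreviation "PB \<equiv> restr (- A)"

text \<open>
  Conditioning on the first jump for a start in \<open>A\<close>, where \<open>F l\<close> is the expected value of \<open>g\<close> at the
  passage over \<open>l\<close>: either the level rises to \<open>l\<close> without a jump, or a jump occurs when \<open>l - r\<close> is left.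
\<close>

definition up :: "real \<Rightarrow> 'e c0 \<Rightarrow> (real \<Rightarrow> 'e c0) \<Rightarrow> real \<Rightarrow> 'e c0" where
  "up k g F l = T k l (PA g) + integral {0..l} (\<lambda>r. T k r (PA (P (F (l - r)))))"

text \<open>
  The same for a start outside \<open>A\<close>: either the level falls by \<open>h\<close> without a jump, so that \<open>l + h\<close> is
  left, or a jump occurs at depth \<open>r < h\<close>.
\<close>

definition down :: "real \<Rightarrow> real \<Rightarrow> (real \<Rightarrow> 'e c0) \<Rightarrow> real \<Rightarrow> 'e c0" where
  "down k h F l = T k h (PB (F (l + h))) + integral {0..h} (\<lambda>r. T k r (PB (P (F (l + r)))))"

definition passage_equations :: "real \<Rightarrow> 'e c0 \<Rightarrow> (real \<Rightarrow> 'e c0) \<Rightarrow> bool" where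
  "passage_equations k g F \<longleftrightarrow> (\<forall>l\<ge>0. PA (F l) = up k g F l \<and> (\<forall>h\<ge>0. PB (F l) = down k h F l))"

lemma T_cont:
  "0 \<le> k \<Longrightarrow> continuous_on S f \<Longrightarrow> continuous_on S g \<Longrightarrow> continuous_on S (\<lambda>x. T k (f x) (g x))"
  by (rule contraction_semigroup.T_cont[OF T_semigroup])

lemmas cont_rules = T_cont continuous_on_blinfun_const

lemma flow_cont:
  assumes "0 \<le> k" "continuous_on UNIV G"
  shows "continuous_on S (\<lambda>r. T k r (restr X (P (G r))))"
  by (intro T_cont continuous_on_blinfun_const continuous_on_id assms(1) continuous_on_subset[OF assms(2)]) simp

lemma shift_cont:
  fixes F :: "real \<Rightarrow> 'e c0"
  assumes "continuous_on UNIV F"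
  shows "continuous_on UNIV (\<lambda>r. F (l - r))" and "continuous_on UNIV (\<lambda>r. F (l + r))"
proof -
  have "continuous_on UNIV (\<lambda>r. l - r)"
    by (rule continuous_on_diff[OF continuous_on_const continuous_on_id])
  moreover have "continuous_on UNIV (\<lambda>r. l + r)"
    by (rule continuous_on_add[OF continuous_on_const continuous_on_id])
  ultimately show "continuous_on UNIV (\<lambda>r. F (l - r))" "continuous_on UNIV (\<lambda>r. F (l + r))"
    using assms by (auto intro: continuous_on_compose2)
qed

lemma up_cont:
  assumes k: "0 \<le> k" and F: "continuous_on UNIV F"
  shows "continuous_on {0..} (up k g F)"
proof -
  let ?f = "\<lambda>l t. T k (l * t) (PA (P (F (l - l * t))))"
  have "continuous_on UNIV (\<lambda>(l, t). ?f l t)"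
    unfolding split_def by (intro cont_rules continuous_intros continuous_on_apply_UNIV[OF F] k)
  then have "continuous_on UNIV (\<lambda>l. T k l (PA g) + l *\<^sub>R integral {0..1} (?f l))"
    by (intro continuous_intros integral_continuous_param cont_rules k)
  then have "continuous_on {0..} (\<lambda>l. T k l (PA g) + l *\<^sub>R integral {0..1} (?f l))"
    by (rule continuous_on_subset) simp
  then show ?thesis
  proof (rule continuous_on_eq)
    fix l :: real assume "l \<in> {0..}"
    then show "T k l (PA g) + l *\<^sub>R integral {0..1} (?f l) = up k g F l"
      unfolding up_def using integral_scale_unit[of l "\<lambda>r. T k r (PA (P (F (l - r))))"] by simp
  qed
qed

lemma down_cont:
  assumes k: "0 \<le> k" and F: "continuous_on UNIV F"
  shows "continuous_on UNIV (down k h F)"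
proof -
  have "continuous_on UNIV (\<lambda>(l, r). T k r (PB (P (F (l + r)))))"
    unfolding split_def by (intro cont_rules continuous_intros continuous_on_apply_UNIV[OF F] k)
  then show ?thesis unfolding down_def
    by (intro continuous_intros integral_continuous_param cont_rules continuous_on_apply_UNIV[OF F] k)
qed

lemma up_lin:
  assumes k: "0 \<le> k" and F: "continuous_on UNIV F" "continuous_on UNIV G"
  shows "up k (f + g) (\<lambda>r. F r + G r) l = up k f F l + up k g G l"
    and "up k (c *\<^sub>R f) (\<lambda>r. c *\<^sub>R F r) l = c *\<^sub>R up k f F l"
proof -
  show "up k (f + g) (\<lambda>r. F r + G r) l = up k f F l + up k g G l"
    unfolding up_def blinfun.add_right
    by (subst integral_add) (simp_all add: integrable_continuous_real flow_cont shift_cont k F)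
  show "up k (c *\<^sub>R f) (\<lambda>r. c *\<^sub>R F r) l = c *\<^sub>R up k f F l"
    unfolding up_def blinfun.scaleR_right by (simp add: scaleR_add_right)
qed

lemma down_lin:
  assumes k: "0 \<le> k" and F: "continuous_on UNIV F" "continuous_on UNIV G"
  shows "down k h (\<lambda>r. F r + G r) l = down k h F l + down k h G l"
    and "down k h (\<lambda>r. c *\<^sub>R F r) l = c *\<^sub>R down k h F l"
proof -
  show "down k h (\<lambda>r. F r + G r) l = down k h F l + down k h G l"
    unfolding down_def blinfun.add_right
    by (subst integral_add) (simp_all add: integrable_continuous_real flow_cont shift_cont k F)
  show "down k h (\<lambda>r. c *\<^sub>R F r) l = c *\<^sub>R down k h F l"
    unfolding down_def blinfun.scaleR_right by (simp add: scaleR_add_right)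
qed

lemma restr_up:
  assumes "0 \<le> k" "continuous_on UNIV F"
  shows "PA (up k g F l) = up k g F l" "PB (up k g F l) = 0"
proof -
  have i: "restr X (integral {0..l} (\<lambda>r. T k r (PA (P (F (l - r)))))) =
    integral {0..l} (\<lambda>r. T k r (restr X (PA (P (F (l - r))))))" for X
    by (subst blinfun_integral) (simp_all add: flow_cont shift_cont assms T_restr[OF assms(1)])
  have "PA (PA f) = PA f" "PB (PA f) = 0" for f by (auto intro!: c0_eqI)
  then show "PA (up k g F l) = up k g F l" "PB (up k g F l) = 0"
    by (simp_all add: up_def blinfun.add_right i T_restr[OF assms(1)] blinfun.zero_right)
qed

lemma restr_down:
  assumes "0 \<le> k" "continuous_on UNIV F"
  shows "PA (down k h F l) = 0" "PB (down k h F l) = down k h F l"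
proof -
  have i: "restr X (integral {0..h} (\<lambda>r. T k r (PB (P (F (l + r)))))) =
    integral {0..h} (\<lambda>r. T k r (restr X (PB (P (F (l + r))))))" for X
    by (subst blinfun_integral) (simp_all add: flow_cont shift_cont assms T_restr[OF assms(1)])
  have "PA (PB f) = 0" "PB (PB f) = PB f" for f by (auto intro!: c0_eqI)
  then show "PA (down k h F l) = 0" "PB (down k h F l) = down k h F l"
    by (simp_all add: down_def blinfun.add_right i T_restr[OF assms(1)] blinfun.zero_right)
qed

lemma up_shift:
  assumes k: "0 \<le> k" and F: "continuous_on UNIV F" and lm: "0 \<le> l" "0 \<le> m"
  shows "up k g F (m + l) = T k l (up k g F m) + integral {0..l} (\<lambda>r. T k r (PA (P (F (m + l - r)))))"
proof -
  interpret contraction_semigroup "T k" by (rule T_semigroup[OF k])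
  have "integral {0..l + m} (\<lambda>r. T k r (PA (P (F (m + l - r))))) =
    integral {0..l} (\<lambda>r. T k r (PA (P (F (m + l - r))))) +
    T k l (integral {0..m} (\<lambda>r. T k r (PA (P (F (m + l - (l + r)))))))"
    by (rule integral_split) (intro cont_rules continuous_intros continuous_on_apply_UNIV[OF F] lm)+
  then show ?thesis
    using T_add[OF lm, of "PA g"] by (simp add: up_def blinfun.add_right add.commute algebra_simps)
qed

lemma down_shift:
  assumes k: "0 \<le> k" and F: "continuous_on UNIV F" and hm: "0 \<le> h" "0 \<le> m"
  shows "down k (h + m) F l = T k h (down k m F (l + h)) + integral {0..h} (\<lambda>r. T k r (PB (P (F (l + r)))))"
proof -
  interpret contraction_semigroup "T k" by (rule T_semigroup[OF k])
  have "integral {0..h + m} (\<lambda>r. T k r (PB (P (F (l + r))))) =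
    integral {0..h} (\<lambda>r. T k r (PB (P (F (l + r))))) +
    T k h (integral {0..m} (\<lambda>r. T k r (PB (P (F (l + (h + r)))))))"
    by (rule integral_split) (intro cont_rules continuous_intros continuous_on_apply_UNIV[OF F] hm)+
  then show ?thesis
    using T_add[OF hm, of "PB (F (l + (h + m)))"]
    by (simp add: down_def blinfun.add_right add.assoc algebra_simps)
qed

lemma flow_le:
  assumes a: "0 \<le> a" "a \<le> 1" and h: "0 \<le> h" and s: "0 \<le> s"
    and U: "0 \<le> U s" "\<And>t. 0 \<le> t \<Longrightarrow> U (s + t) \<le> exp (a * t) * U s"
    and g: "\<And>j t. s \<le> t \<Longrightarrow> val g j t \<le> U t"
  shows "val (T (K + 1) h g) i s \<le> exp (- ((K + 1 - a) / nu i) * h) * U s"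
proof -
  let ?t = "h / nu i"
  have t: "0 \<le> ?t" using h nu_pos[of i] by simp
  have "val (T (K + 1) h g) i s = exp (- (K + 1) * ?t) * val g i (s + ?t)"
    using K_pos by (simp add: val_T s h)
  also have "\<dots> \<le> exp (- (K + 1) * ?t) * (exp (a * ?t) * U s)"
    using g[of "s + ?t" i] U(2)[OF t] t by (intro mult_left_mono) auto
  also have "exp (- (K + 1) * ?t) * (exp (a * ?t) * U s) = exp (- (K + 1) * ?t + a * ?t) * U s"
    by (simp add: exp_add)
  also have "- (K + 1) * ?t + a * ?t = - ((K + 1 - a) / nu i) * h"
    using nu_pos[of i] by (simp add: field_simps)
  finally show ?thesis .
qed

text \<open>
  The weight \<open>U\<close> may grow at rate \<open>a\<close> in time, which uses up the part \<open>a\<close> of the killing. The case \<open>a = 0\<close> with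
  constant \<open>U\<close> gives a factor \<open>K/(K+1) < 1\<close>, hence contraction; for \<open>a = 1\<close> the factor is \<open>1\<close>, hence
  invariance of weighted order bounds.
\<close>

lemma flow_integral_le:
  assumes a: "0 \<le> a" "a \<le> 1" and h: "0 \<le> h" and s: "0 \<le> s"
    and U: "0 \<le> U s" "\<And>t. 0 \<le> t \<Longrightarrow> U (s + t) \<le> exp (a * t) * U s"
    and G: "continuous_on UNIV G" "\<And>r j t. 0 \<le> r \<Longrightarrow> r \<le> h \<Longrightarrow> s \<le> t \<Longrightarrow> val (G r) j t \<le> U t"
  shows "val (integral {0..h} (\<lambda>r. T (K + 1) r (restr X (P (G r))))) i s
    \<le> K / (K + 1 - a) * U s * (1 - exp (- ((K + 1 - a) / nu i) * h))"
proof -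
  let ?b = "(K + 1 - a) / nu i"
  have K1: "0 \<le> K + 1" "0 < K + 1 - a" using K_pos a by auto
  have c: "continuous_on {0..h} (\<lambda>r. T (K + 1) r (restr X (P (G r))))"
    by (rule flow_cont[OF K1(1) G(1)])
  show ?thesis unfolding val_integral[OF c]
  proof (rule exp_integral_bound[OF h val_fun_cont[OF c]])
    fix r assume r: "r \<in> {0..h}"
    let ?t = "r / nu i"
    have t: "0 \<le> ?t" using r nu_pos[of i] by simp
    have nonneg: "0 \<le> K / nu i * (exp (a * ?t) * U s)" using K_pos nu_pos[of i] U(1) by simp
    have "val (P (G r)) i (s + ?t) \<le> K / nu i * U (s + ?t)"
      using s t r G(2)[of r "s + ?t"] by (intro P_le) auto
    also have "\<dots> \<le> K / nu i * (exp (a * ?t) * U s)"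
      using K_pos nu_pos[of i] U(2)[OF t] by (intro mult_left_mono) auto
    finally have "val (restr X (P (G r))) i (s + ?t) \<le> K / nu i * (exp (a * ?t) * U s)"
      using nonneg by simp
    then have "exp (- (K + 1) * ?t) * val (restr X (P (G r))) i (s + ?t)
        \<le> exp (- (K + 1) * ?t) * (K / nu i * (exp (a * ?t) * U s))"
      by (rule mult_left_mono) simp
    also have "\<dots> = K / nu i * U s * exp (- (K + 1) * ?t + a * ?t)"
      by (simp add: exp_add)
    also have "- (K + 1) * ?t + a * ?t = - ?b * r"
      using nu_pos[of i] by (simp add: field_simps)
    also have "K / nu i * U s = K / (K + 1 - a) * U s * ?b"
      using K1 by simp
    finally show "val (T (K + 1) r (restr X (P (G r)))) i s \<le> K / (K + 1 - a) * U s * (?b * exp (- ?b * r))"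
      using r s K1 by (simp add: val_T mult.assoc)
  qed
qed

lemma up_le:
  assumes a: "0 \<le> a" "a \<le> 1" and l: "0 \<le> l" and s: "0 \<le> s"
    and U: "0 \<le> U s" "\<And>t. 0 \<le> t \<Longrightarrow> U (s + t) \<le> exp (a * t) * U s"
    and W: "0 \<le> W s" "\<And>t. 0 \<le> t \<Longrightarrow> W (s + t) \<le> exp (a * t) * W s"
    and g: "\<And>j t. s \<le> t \<Longrightarrow> val (PA g) j t \<le> W t"
    and F: "continuous_on UNIV F" "\<And>r j t. s \<le> t \<Longrightarrow> val (F r) j t \<le> U t"
  defines "E \<equiv> \<lambda>i. exp (- ((K + 1 - a) / nu i) * l)"
  shows "val (up (K + 1) g F l) i s \<le> E i * W s + K / (K + 1 - a) * U s * (1 - E i)"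
  unfolding up_def val_add E_def
proof (rule add_mono)
  show "val (T (K + 1) l (PA g)) i s \<le> exp (- ((K + 1 - a) / nu i) * l) * W s"
    by (rule flow_le[where U = W, OF a l s W g])
  show "val (integral {0..l} (\<lambda>r. T (K + 1) r (PA (P (F (l - r)))))) i s
      \<le> K / (K + 1 - a) * U s * (1 - exp (- ((K + 1 - a) / nu i) * l))"
    by (rule flow_integral_le[where U = U, OF a l s U shift_cont(1)[OF F(1)] F(2)])
qed

lemma down_le:
  assumes a: "0 \<le> a" "a \<le> 1" and h: "0 \<le> h" and s: "0 \<le> s"
    and U: "\<And>t. s \<le> t \<Longrightarrow> 0 \<le> U t" "\<And>t. 0 \<le> t \<Longrightarrow> U (s + t) \<le> exp (a * t) * U s"
    and F: "continuous_on UNIV F" "\<And>r j t. s \<le> t \<Longrightarrow> val (F r) j t \<le> U t"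
  defines "E \<equiv> \<lambda>i. exp (- ((K + 1 - a) / nu i) * h)"
  shows "val (down (K + 1) h F l) i s \<le> E i * U s + K / (K + 1 - a) * U s * (1 - E i)"
proof -
  have le: "val (PB (F (l + h))) j t \<le> U t" if "s \<le> t" for j t
    using F(2)[OF that] U(1)[OF that] by simp
  have "val (T (K + 1) h (PB (F (l + h)))) i s \<le> exp (- ((K + 1 - a) / nu i) * h) * U s"
    by (rule flow_le[where U = U, OF a h s U(1)[OF order_refl] U(2) le])
  moreover have "val (integral {0..h} (\<lambda>r. T (K + 1) r (PB (P (F (l + r)))))) i s
      \<le> K / (K + 1 - a) * U s * (1 - exp (- ((K + 1 - a) / nu i) * h))"
    by (rule flow_integral_le[where U = U, OF a h s U(1)[OF order_refl] U(2) shift_cont(2)[OF F(1)] F(2)])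
  ultimately show ?thesis unfolding down_def val_add E_def by (rule add_mono)
qed

text \<open>
  A finite depth \<open>h = 1\<close> in the downward equation avoids improper integrals; all other depths follow
  in \<open>killed_passage_down\<close>.
\<close>

definition renewal_at :: "'e c0 \<Rightarrow> (real \<Rightarrow> 'e c0) \<Rightarrow> real \<Rightarrow> 'e c0" where
  "renewal_at g F l = up (K + 1) g F (max 0 l) + down (K + 1) 1 F (max 0 l)"

lemma K1: "0 \<le> K + 1"
  using K_pos by simp

lemma renewal_at_cont:
  assumes F: "continuous_on UNIV F" shows "continuous_on UNIV (renewal_at g F)"
proof -
  have "continuous_on UNIV (\<lambda>l. up (K + 1) g F (max 0 l))"
    by (rule continuous_on_compose2[OF up_cont[OF K1 F]]) (auto intro!: continuous_intros)
  moreover have "continuous_on UNIV (\<lambda>l. down (K + 1) 1 F (max 0 l))"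
    by (rule continuous_on_compose2[OF down_cont[OF K1 F]]) (auto intro!: continuous_intros)
  ultimately show ?thesis unfolding renewal_at_def by (rule continuous_on_add)
qed

lemma renewal_at_lin:
  assumes F: "continuous_on UNIV F" "continuous_on UNIV G"
  shows "renewal_at (f + g) (\<lambda>r. F r + G r) l = renewal_at f F l + renewal_at g G l"
    and "renewal_at (c *\<^sub>R f) (\<lambda>r. c *\<^sub>R F r) l = c *\<^sub>R renewal_at f F l"
  using K1 F by (simp_all add: renewal_at_def up_lin down_lin scaleR_add_right)

lemma restr_renewal_at:
  assumes "continuous_on UNIV F"
  shows "PA (renewal_at g F l) = up (K + 1) g F (max 0 l)" "PB (renewal_at g F l) = down (K + 1) 1 F (max 0 l)"
  using K1 assms by (simp_all add: renewal_at_def blinfun.add_right restr_up restr_down)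

lemma renewal_at_le:
  assumes a: "0 \<le> a" "a \<le> 1" and s: "0 \<le> s"
    and U: "\<And>t. s \<le> t \<Longrightarrow> 0 \<le> U t" "\<And>t. 0 \<le> t \<Longrightarrow> U (s + t) \<le> exp (a * t) * U s"
    and W: "0 \<le> W s" "\<And>t. 0 \<le> t \<Longrightarrow> W (s + t) \<le> exp (a * t) * W s"
    and g: "\<And>j t. s \<le> t \<Longrightarrow> val (PA g) j t \<le> W t"
    and F: "continuous_on UNIV F" "\<And>r j t. s \<le> t \<Longrightarrow> val (F r) j t \<le> U t"
  defines "E \<equiv> \<lambda>i l. exp (- ((K + 1 - a) / nu i) * l)"
  shows "i \<in> A \<Longrightarrow> val (renewal_at g F l) i s \<le> E i (max 0 l) * W s + K / (K + 1 - a) * U s * (1 - E i (max 0 l))"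
    and "i \<notin> A \<Longrightarrow> val (renewal_at g F l) i s \<le> E i 1 * U s + K / (K + 1 - a) * U s * (1 - E i 1)"
proof -
  have *: "val (renewal_at g F l) i s = val (if i \<in> A then PA (renewal_at g F l) else PB (renewal_at g F l)) i s" by simp
  show "val (renewal_at g F l) i s \<le> E i (max 0 l) * W s + K / (K + 1 - a) * U s * (1 - E i (max 0 l))" if "i \<in> A"
    unfolding * restr_renewal_at[OF F(1)] E_def using that up_le[where F = F and U = U and W = W and l = "max 0 l", OF a _ s U(1)[OF order_refl] U(2) W g F]
    by simp
  show "val (renewal_at g F l) i s \<le> E i 1 * U s + K / (K + 1 - a) * U s * (1 - E i 1)" if "i \<notin> A"
    unfolding * restr_renewal_at[OF F(1)] E_def using that down_le[where F = F and U = U and h = 1 and l = "max 0 l", OF a _ s U F]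
    by simp
qed

text \<open>
  The maximum over \<open>i\<close> of \<open>m\<^sub>i + K/(K+1) (1 - m\<^sub>i)\<close>, where \<open>m\<^sub>i\<close> is the probability to fall by \<open>1\<close> without a
  jump and without being killed.
\<close>

definition contr_factor :: real where
  "contr_factor = (K + Max (range (\<lambda>i. exp (- ((K + 1) / nu i))))) / (K + 1)"

lemma contr_factor: "0 < contr_factor" "contr_factor < 1" "K / (K + 1) \<le> contr_factor"
  "exp (- ((K + 1) / nu i)) + K / (K + 1) * (1 - exp (- ((K + 1) / nu i))) \<le> contr_factor"
proof -
  define m where "m = Max (range (\<lambda>i. exp (- ((K + 1) / nu i))))"
  have "m \<in> range (\<lambda>i. exp (- ((K + 1) / nu i)))" unfolding m_def by (rule Max_in) auto
  then have m: "0 < m" "m < 1" using K_pos nu_pos by (auto simp: divide_neg_pos)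
  have e: "exp (- ((K + 1) / nu i)) \<le> m" unfolding m_def by (rule Max_ge) (rule finite_imageI[OF finite], rule rangeI)
  have c: "contr_factor = (K + m) / (K + 1)" by (simp add: contr_factor_def m_def)
  show "0 < contr_factor" "contr_factor < 1" "K / (K + 1) \<le> contr_factor" using m K_pos by (auto simp: c divide_right_mono)
  have "exp (- ((K + 1) / nu i)) + K / (K + 1) * (1 - exp (- ((K + 1) / nu i))) = (K + exp (- ((K + 1) / nu i))) / (K + 1)"
    using K_pos by (simp add: field_simps)
  also have "\<dots> \<le> contr_factor" unfolding c using e K_pos by (intro divide_right_mono) auto
  finally show "exp (- ((K + 1) / nu i)) + K / (K + 1) * (1 - exp (- ((K + 1) / nu i))) \<le> contr_factor" .
qed

lemma convex_le: 
  fixes c :: real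
  assumes "0 \<le> E" "E \<le> 1" "q \<le> 1" "0 \<le> c"
  shows "E * c + q * c * (1 - E) \<le> c"
proof -
  have "q * (c * (1 - E)) \<le> 1 * (c * (1 - E))" using assms by (intro mult_right_mono) auto
  then show ?thesis by (simp add: algebra_simps)
qed

lemma E_le_1: "0 \<le> l \<Longrightarrow> a \<le> 1 \<Longrightarrow> exp (- ((K + 1 - a) / nu i) * l) \<le> 1"
  using K_pos nu_pos[of i] by (simp add: mult_nonneg_nonneg)

lemma renewal_at_uminus:
  assumes "continuous_on UNIV F" shows "renewal_at (- g) (\<lambda>r. - F r) l = - renewal_at g F l"
  using renewal_at_lin(2)[of F F "-1" g l] assms by simp

lemma renewal_at_norm_le:
  assumes F: "continuous_on UNIV F" "\<And>r. norm (F r) \<le> c" and g: "norm g \<le> c"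
  shows "norm (renewal_at g F l) \<le> c"
proof -
  have c: "0 \<le> c" using g norm_ge_zero order_trans by blast
  have le: "val (renewal_at g F l) i s \<le> c"
    if "0 \<le> s" "continuous_on UNIV F" "\<And>r. norm (F r) \<le> c" "norm g \<le> c" for g F i s
  proof -
    have 1: "val (PA g) j t \<le> c" for j t using abs_val_le[of "PA g" j t] norm_restr[of A g] that(4) by linarith
    have 2: "val (F r) j t \<le> c" for r j t using abs_val_le[of "F r" j t] that(3)[of r] by linarith
    have q: "K / (K + 1) \<le> 1" using K_pos by simp
    show ?thesis
      using renewal_at_le[of 0 s "\<lambda>_. c" "\<lambda>_. c" g F i l] that c 1 2
        convex_le[OF _ E_le_1[of "max 0 l" 0 i] q c] convex_le[OF _ E_le_1[of 1 0 i] q c]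
      by (cases "i \<in> A") force+
  qed
  show ?thesis
  proof (rule norm_c0_le[OF c])
    fix i and s :: real assume s: "0 \<le> s"
    have "val (- renewal_at g F l) i s \<le> c"
      unfolding renewal_at_uminus[OF F(1), symmetric] using F g s by (intro le continuous_on_minus) auto
    then show "\<bar>val (renewal_at g F l) i s\<bar> \<le> c" using le[OF s F g, of i] by simp
  qed
qed

lemma renewal_at_contraction:
  assumes F: "continuous_on UNIV F" "\<And>r. norm (F r) \<le> c"
  shows "norm (renewal_at 0 F l) \<le> contr_factor * c"
proof -
  have c: "0 \<le> c" using F(2)[of 0] norm_ge_zero order_trans by blast
  have le: "val (renewal_at 0 F l) i s \<le> contr_factor * c"
    if "0 \<le> s" "continuous_on UNIV F" "\<And>r. norm (F r) \<le> c" for F i s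
  proof -
    have 2: "val (F r) j t \<le> c" for r j t using abs_val_le[of "F r" j t] that(3)[of r] by linarith
    show ?thesis
    proof (cases "i \<in> A")
      case True
      let ?E = "exp (- ((K + 1 - 0) / nu i) * max 0 l)"
      have "val (renewal_at 0 F l) i s \<le> ?E * 0 + K / (K + 1 - 0) * c * (1 - ?E)"
        by (rule renewal_at_le(1)[where U = "\<lambda>_. c" and W = "\<lambda>_. 0"]) (use that c 2 True in \<open>auto simp: blinfun.zero_right\<close>)
      also have "\<dots> \<le> K / (K + 1) * c * 1"
        using K_pos c by (simp only: mult_zero_right add_0 diff_0_right) (intro mult_left_mono; simp)
      also have "\<dots> \<le> contr_factor * c" using mult_right_mono[OF contr_factor(3) c] by simp
      finally show ?thesis .
    next
      case False
      let ?E = "exp (- ((K + 1) / nu i))"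
      have "val (renewal_at 0 F l) i s \<le> ?E * c + K / (K + 1) * c * (1 - ?E)"
        using renewal_at_le(2)[of 0 s "\<lambda>_. c" "\<lambda>_. 0" 0 F i l] that c 2 False by (auto simp: blinfun.zero_right)
      also have "\<dots> = (?E + K / (K + 1) * (1 - ?E)) * c" by (simp add: algebra_simps)
      also have "\<dots> \<le> contr_factor * c" using contr_factor(4) c by (intro mult_right_mono)
      finally show ?thesis .
    qed
  qed
  show ?thesis
  proof (rule norm_c0_le)
    show "0 \<le> contr_factor * c" using contr_factor(1) c by simp
    fix i and s :: real assume s: "0 \<le> s"
    have "val (- renewal_at 0 F l) i s \<le> contr_factor * c"
      using renewal_at_uminus[OF F(1), of 0 l] le[OF s, of "\<lambda>r. - F r" i] F by (auto intro!: continuous_on_minus)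
    then show "\<bar>val (renewal_at 0 F l) i s\<bar> \<le> contr_factor * c" using le[OF s F, of i] by simp
  qed
qed

definition renewal :: "'e c0 \<Rightarrow> (real \<Rightarrow>\<^sub>C 'e c0) \<Rightarrow> real \<Rightarrow>\<^sub>C 'e c0" where
  "renewal g F = Bcontfun (renewal_at g (apply_bcontfun F))"

lemma renewal_apply: "apply_bcontfun (renewal g F) = renewal_at g (apply_bcontfun F)"
proof -
  have "renewal_at g (apply_bcontfun F) \<in> bcontfun"
    by (rule bcontfun_normI[of _ "max (norm g) (norm F)"])
      (simp_all add: renewal_at_cont renewal_at_norm_le max.coboundedI2[OF norm_bounded])
  then show ?thesis by (simp add: renewal_def Bcontfun_inverse)
qed

lemma renewal_contraction: "dist (renewal g F) (renewal g G) \<le> contr_factor * dist F G"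
proof (rule dist_bound)
  fix l
  have "renewal g F l - renewal g G l = renewal_at 0 (\<lambda>r. F r - G r) l"
    using renewal_at_lin(1)[of F "\<lambda>r. - G r" g "- g" l] renewal_at_uminus[of G g l]
    by (simp add: renewal_apply continuous_on_minus)
  also have "norm \<dots> \<le> contr_factor * dist F G"
    by (rule renewal_at_contraction) (auto intro!: continuous_on_diff simp: dist_bounded simp flip: dist_norm)
  finally show "dist (renewal g F l) (renewal g G l) \<le> contr_factor * dist F G" by (simp add: dist_norm)
qed

lemma renewal_fix_in:
  assumes "closed S" "S \<noteq> {}" "renewal g ` S \<subseteq> S"
  shows "\<exists>!F\<in>S. renewal g F = F"
  by (rule Banach_fix[where c = contr_factor])
    (use assms contr_factor in \<open>auto intro: renewal_contraction simp: complete_eq_closed\<close>)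

definition killed_passage :: "'e c0 \<Rightarrow> real \<Rightarrow>\<^sub>C 'e c0" where
  "killed_passage g = (THE F. renewal g F = F)"

lemma renewal_fix: "\<exists>!F. renewal g F = F"
  using renewal_fix_in[of UNIV g] by simp

lemma renewal_killed_passage: "renewal g (killed_passage g) = killed_passage g"
  unfolding killed_passage_def by (rule theI'[OF renewal_fix])

lemma killed_passage_unique: "renewal g F = F \<Longrightarrow> killed_passage g = F"
  using renewal_fix renewal_killed_passage by blast

lemma killed_passage_in: "closed S \<Longrightarrow> S \<noteq> {} \<Longrightarrow> renewal g ` S \<subseteq> S \<Longrightarrow> killed_passage g \<in> S"
  using renewal_fix_in killed_passage_unique by metis

lemma killed_passage_add: "killed_passage (f + g) = killed_passage f + killed_passage g"
proof (rule killed_passage_unique, rule bcontfun_eqI)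
  fix l
  have "renewal_at f (killed_passage f) l = killed_passage f l" "renewal_at g (killed_passage g) l = killed_passage g l"
    using renewal_killed_passage renewal_apply by metis+
  then show "renewal (f + g) (killed_passage f + killed_passage g) l = (killed_passage f + killed_passage g) l"
    using renewal_at_lin(1)[of "killed_passage f" "killed_passage g" f g l] by (simp add: renewal_apply plus_bcontfun.rep_eq)
qed

lemma killed_passage_scale: "killed_passage (c *\<^sub>R f) = c *\<^sub>R killed_passage f"
proof (rule killed_passage_unique, rule bcontfun_eqI)
  fix l
  have "renewal_at f (killed_passage f) l = killed_passage f l" using renewal_killed_passage renewal_apply by metis
  then show "renewal (c *\<^sub>R f) (c *\<^sub>R killed_passage f) l = (c *\<^sub>R killed_passage f) l"
    using renewal_at_lin(2)[of "killed_passage f" "killed_passage f" c f l] by (simp add: renewal_apply scaleR_bcontfun.rep_eq)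
qed

lemma killed_passage_uminus: "killed_passage (- f) = - killed_passage f"
  using killed_passage_scale[of "-1" f] by simp

lemma killed_passage_restr: "killed_passage (PA g) = killed_passage g"
proof (rule killed_passage_unique)
  have "PA (PA g) = PA g" by (rule c0_eqI) simp
  then have "renewal (PA g) (killed_passage g) = renewal g (killed_passage g)"
    by (simp add: renewal_def renewal_at_def[abs_def] up_def)
  then show "renewal (PA g) (killed_passage g) = killed_passage g" by (simp add: renewal_killed_passage)
qed

text \<open>
  Upper bounds that grow at most like \<open>e\<^sup>t\<close> are preserved by the renewal map, and the functions obeying them
  form a closed set.
\<close>

lemma killed_passage_le:
  assumes U: "\<And>t. 0 \<le> t \<Longrightarrow> 0 \<le> U t" "\<And>s t. 0 \<le> s \<Longrightarrow> 0 \<le> t \<Longrightarrow> U (s + t) \<le> exp t * U s"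
    and g: "\<And>j t. j \<in> A \<Longrightarrow> 0 \<le> t \<Longrightarrow> val g j t \<le> U t"
    and s: "0 \<le> s"
  shows "val (killed_passage g l) i s \<le> U s"
proof -
  define S where "S = {F :: real \<Rightarrow>\<^sub>C 'e c0. \<forall>l i s. 0 \<le> s \<longrightarrow> val (F l) i s \<le> U s}"
  have "closed {F :: real \<Rightarrow>\<^sub>C 'e c0. 0 \<le> s \<longrightarrow> val (F l) i s \<le> U s}" for l i s
  proof (cases "0 \<le> s")
    case True
    have "bounded_linear (\<lambda>F :: real \<Rightarrow>\<^sub>C 'e c0. val (F l) i s)"
      by (rule bounded_linear_compose[OF bounded_linear_val bounded_linear_apply_bcontfun])
    then have "continuous_on UNIV (\<lambda>F :: real \<Rightarrow>\<^sub>C 'e c0. val (F l) i s)"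
      by (rule linear_continuous_on)
    then show ?thesis using True by (simp add: closed_Collect_le)
  qed simp
  then have "closed S" unfolding S_def by (intro closed_Collect_all)
  moreover have "0 \<in> S" using U(1) by (simp add: S_def)
  moreover have "renewal g F \<in> S" if "F \<in> S" for F
    unfolding S_def mem_Collect_eq
  proof (intro allI impI)
    fix l i and s :: real assume s: "0 \<le> s"
    have 1: "val (PA g) j t \<le> U t" if "s \<le> t" for j t using g[of j t] U(1)[of t] that s by simp
    have 2: "val (F r) j t \<le> U t" if "s \<le> t" for r j t using \<open>F \<in> S\<close> that s by (simp add: S_def)
    have q: "K / (K + 1 - 1) \<le> 1" by simp
    have "val (renewal_at g F l) i s \<le> U s"
      using renewal_at_le[of 1 s U U g F i l] s 1 2 U
        convex_le[OF _ E_le_1[of "max 0 l" 1 i] q U(1)[OF s]] convex_le[OF _ E_le_1[of 1 1 i] q U(1)[OF s]]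
      by (cases "i \<in> A") force+
    then show "val (renewal g F l) i s \<le> U s" by (simp add: renewal_apply)
  qed
  ultimately have "killed_passage g \<in> S" by (intro killed_passage_in) auto
  then show ?thesis using s by (simp add: S_def)
qed

lemma killed_passage_fixed_point: "renewal_at g (killed_passage g) l = killed_passage g l"
  using renewal_killed_passage[of g] renewal_apply[of g "killed_passage g"] by metis

lemma restr_decomp: "PA f + PB f = f"
  by (rule c0_eqI) simp

lemma norm_T_one: "norm (T (K + 1) 1 f) \<le> contr_factor * norm f"
proof (rule norm_c0_le)
  fix i and s :: real assume s: "0 \<le> s"
  let ?E = "exp (- ((K + 1) / nu i))"
  have "?E \<le> 1" using nu_pos[of i] K_pos by simp
  then have "0 \<le> K / (K + 1) * (1 - ?E)" using K_pos by (intro mult_nonneg_nonneg) auto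
  then have "?E \<le> contr_factor" using contr_factor(4)[of i] by linarith
  then have "\<bar>?E\<bar> * \<bar>val f i (s + 1 / nu i)\<bar> \<le> contr_factor * norm f"
    using contr_factor(1) abs_val_le by (intro mult_mono) auto
  moreover have "- (K + 1) * (1 / nu i) = - ((K + 1) / nu i)"
    unfolding minus_divide_left times_divide_eq_right mult_1_right ..
  ultimately show "\<bar>val (T (K + 1) 1 f) i s\<bar> \<le> contr_factor * norm f"
    unfolding val_T[OF K1 s zero_le_one] abs_mult by simp
qed (use contr_factor in simp)

text \<open>
  The defect \<open>D l\<close> of the downward equation at depth \<open>h\<close> satisfies \<open>D l = T 1 (D (l + 1))\<close>, because
  falling by \<open>h\<close> and by \<open>1\<close> can be done in either order. As \<open>D\<close> is bounded and \<open>T 1\<close> is a strict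
  contraction, \<open>D = 0\<close>.
\<close>

lemma killed_passage_down:
  assumes h: "0 \<le> h" and l: "0 \<le> l"
  shows "PB (killed_passage g l) = down (K + 1) h (killed_passage g) l"
proof -
  let ?F = "apply_bcontfun (killed_passage g)"
  let ?D = "\<lambda>l. PB (?F l) - down (K + 1) h ?F l"
  have F: "continuous_on UNIV ?F" by simp
  have one: "PB (?F l) = down (K + 1) 1 ?F l" if "0 \<le> l" for l
    using restr_renewal_at(2)[OF F, of g l] killed_passage_fixed_point[of g l] that by simp
  have rec: "?D l = T (K + 1) 1 (?D (l + 1))" if l: "0 \<le> l" for l
  proof -
    \<comment> \<open>fall by \<open>h\<close> first, then by \<open>1\<close>\<close>
    have "down (K + 1) (h + 1) ?F l = down (K + 1) h ?F l"
      unfolding down_shift[OF K1 F h zero_le_one] using one[of "l + h"] l h by (simp add: down_def)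
    \<comment> \<open>fall by \<open>1\<close> first, then by \<open>h\<close>\<close>
    moreover have "PB (?F l) - down (K + 1) (1 + h) ?F l = T (K + 1) 1 (?D (l + 1))"
      unfolding down_shift[OF K1 F zero_le_one h] one[OF l] down_def[of _ 1]
      by (simp add: blinfun.diff_right)
    ultimately show ?thesis by (simp add: add.commute)
  qed
  define B where "B = norm (killed_passage g) + (norm (killed_passage g) + K / Min (range nu) * norm (killed_passage g) * (h - 0))"
  have B: "norm (?D l) \<le> B" for l
  proof -
    have P: "norm (P (?F r)) \<le> K / Min (range nu) * norm (killed_passage g)" for r
      by (rule order_trans[OF norm_P mult_left_mono[OF norm_bounded]])
        (intro divide_nonneg_nonneg less_imp_le[OF K_pos], use nu_pos in \<open>simp add: less_imp_le\<close>)
    have "norm (integral {0..h} (\<lambda>r. T (K + 1) r (PB (P (?F (l + r)))))) \<le> K / Min (range nu) * norm (killed_passage g) * (h - 0)"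
      by (rule integral_bound[OF h flow_cont[OF K1 shift_cont(2)[OF F]]])
        (rule order_trans[OF norm_T[OF K1] order_trans[OF norm_restr P]])
    moreover have "norm (T (K + 1) h (PB (?F (l + h)))) \<le> norm (killed_passage g)" "norm (PB (?F l)) \<le> norm (killed_passage g)"
      by (rule order_trans[OF norm_T[OF K1] order_trans[OF norm_restr norm_bounded]],
          rule order_trans[OF norm_restr norm_bounded])
    ultimately show ?thesis unfolding down_def B_def by (intro norm_triangle_le_diff norm_triangle_le add_mono)
  qed
  have pow: "norm (?D l) \<le> contr_factor ^ n * B" if "0 \<le> l" for l n
    using that
  proof (induction n arbitrary: l)
    case 0 then show ?case using B by simp
  next
    case (Suc n)
    have "norm (?D l) \<le> contr_factor * norm (?D (l + 1))" using rec[OF Suc.prems] norm_T_one by metis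
    also have "\<dots> \<le> contr_factor * (contr_factor ^ n * B)" using Suc contr_factor(1) by (intro mult_left_mono Suc.IH) auto
    finally show ?case by simp
  qed
  have "(\<lambda>n. contr_factor ^ n * B) \<longlonglongrightarrow> 0 * B"
    by (intro tendsto_mult LIMSEQ_power_zero tendsto_const) (use contr_factor in auto)
  then have "norm (?D l) \<le> 0" using pow[OF l] by (intro LIMSEQ_le_const) auto
  then show ?thesis by simp
qed

lemma killed_passage_solves: "passage_equations (K + 1) g (killed_passage g)"
  unfolding passage_equations_def
proof (intro allI impI conjI)
  fix l :: real assume l: "0 \<le> l"
  show "PA (killed_passage g l) = up (K + 1) g (killed_passage g) l"
    using restr_renewal_at(1)[of "killed_passage g" g l] killed_passage_fixed_point[of g l] l by simp
  show "PB (killed_passage g l) = down (K + 1) h (killed_passage g) l" if "0 \<le> h" for h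
    using killed_passage_down[OF that l] .
qed

text \<open>
  Markov property at the passage over \<open>m\<close>: both sides solve the renewal equation whose data are the
  values at level \<open>m\<close>.
\<close>

lemma killed_passage_shift:
  assumes m: "0 \<le> m" and l: "0 \<le> l"
  shows "killed_passage (killed_passage g m) l = killed_passage g (m + l)"
proof -
  let ?F = "apply_bcontfun (killed_passage g)"
  have F: "continuous_on UNIV ?F" by simp
  define G where "G = Bcontfun (\<lambda>l. ?F (m + max 0 l))"
  have "(\<lambda>l. ?F (m + max 0 l)) \<in> bcontfun"
    by (rule bcontfun_normI[of _ "norm (killed_passage g)"])
      (auto intro!: continuous_on_apply_UNIV[OF F] continuous_intros norm_bounded)
  then have G: "apply_bcontfun G = (\<lambda>l. ?F (m + max 0 l))" by (simp add: G_def Bcontfun_inverse)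
  have sv: "PA (?F l) = up (K + 1) g ?F l" "PB (?F l) = down (K + 1) 1 ?F l" if "0 \<le> l" for l
    using killed_passage_solves[of g] that zero_le_one unfolding passage_equations_def by blast+
  have "renewal (killed_passage g m) G = G"
  proof (rule bcontfun_eqI)
    fix x :: real
    let ?l = "max 0 x :: real"
    have "up (K + 1) (?F m) G ?l = up (K + 1) g ?F (m + ?l)"
    proof -
      have "integral {0..?l} (\<lambda>r. T (K + 1) r (PA (P (G (?l - r))))) =
        integral {0..?l} (\<lambda>r. T (K + 1) r (PA (P (?F (m + ?l - r)))))"
        by (rule integral_cong) (auto simp: G algebra_simps max_def)
      then show ?thesis
        unfolding up_def[of _ "?F m"] sv(1)[OF m] up_shift[OF K1 F max.cobounded1 m] by simp
    qed
    moreover have "down (K + 1) 1 G ?l = down (K + 1) 1 ?F (m + ?l)"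
    proof -
      have "integral {0..1} (\<lambda>r. T (K + 1) r (PB (P (G (?l + r))))) =
        integral {0..1} (\<lambda>r. T (K + 1) r (PB (P (?F (m + ?l + r)))))"
        by (rule integral_cong) (auto simp: G algebra_simps max_def)
      moreover have "G (?l + 1) = ?F (m + ?l + 1)" by (simp add: G add.assoc max_def)
      ultimately show ?thesis unfolding down_def by simp
    qed
    ultimately have "renewal_at (?F m) G x = PA (?F (m + ?l)) + PB (?F (m + ?l))"
      unfolding renewal_at_def using sv[of "m + ?l"] m by simp
    then show "renewal (?F m) G x = G x" by (simp add: renewal_apply restr_decomp G)
  qed
  then have "killed_passage (?F m) = G" by (rule killed_passage_unique)
  then show ?thesis using l by (simp add: G)
qed

end

section \<open>First passage without killing\<close>

instance bcontfun :: (metric_space, banach) banach ..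

lemma apply_bcontfun_tendsto:
  fixes F :: "'b \<Rightarrow> real \<Rightarrow>\<^sub>C 'x::real_normed_vector"
  assumes "(F \<longlongrightarrow> G) net" "(r \<longlongrightarrow> a) net"
  shows "((\<lambda>x. apply_bcontfun (F x) (r x)) \<longlongrightarrow> apply_bcontfun G a) net"
proof -
  have "isCont (apply_bcontfun G) a"
    by (rule continuous_on_interior[OF continuous_on_apply_bcontfun[of UNIV G]]) simp
  then have 1: "((\<lambda>x. G (r x)) \<longlongrightarrow> G a) net" by (rule isCont_tendsto_compose[OF _ assms(2)])
  have 2: "((\<lambda>x. F x (r x) - G (r x)) \<longlongrightarrow> 0) net"
  proof (rule Lim_null_comparison)
    show "\<forall>\<^sub>F x in net. norm (F x (r x) - G (r x)) \<le> dist (F x) G"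
      by (intro always_eventually allI) (simp add: dist_bounded flip: dist_norm)
    show "((\<lambda>x. dist (F x) G) \<longlongrightarrow> 0) net" using assms(1) tendsto_dist_iff by blast
  qed
  from tendsto_add[OF 2 1] show ?thesis by simp
qed

lemma apply_bcontfun_cont:
  fixes F :: "'b::topological_space \<Rightarrow> real \<Rightarrow>\<^sub>C 'x::real_normed_vector"
  assumes "continuous_on S F" "continuous_on S r"
  shows "continuous_on S (\<lambda>x. apply_bcontfun (F x) (r x))"
  using assms unfolding continuous_on_def by (auto intro: apply_bcontfun_tendsto)

text \<open>
  A linear map that is bounded with respect to the weaker norm \<open>norm (damp 1 f)\<close> factors through \<open>damp 1\<close>.
  The approximants \<open>L (grow 1 n g)\<close> are linear in \<open>g\<close> and form Cauchy sequences, so their limit is linear as well.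
\<close>

lemma extend_along_damp:
  fixes L :: "'e::finite c0 \<Rightarrow> 'y::banach"
  assumes add: "\<And>f g. L (f + g) = L f + L g" and scale: "\<And>c f. L (c *\<^sub>R f) = c *\<^sub>R L f"
    and bound: "\<And>f. norm (L f) \<le> norm (damp 1 f)"
  shows "\<exists>L' :: 'e c0 \<Rightarrow>\<^sub>L 'y. (\<forall>f. L' (damp 1 f) = L f) \<and> (\<forall>g. (\<lambda>n. L (grow 1 n g)) \<longlonglongrightarrow> L' g)"
proof -
  have diff: "L (f - g) = L f - L g" for f g
    using add[of f "-1 *\<^sub>R g"] scale[of "-1" g] by simp
  have "convergent (\<lambda>n. L (grow 1 n g))" for g
  proof -
    have "Cauchy (\<lambda>n. damp 1 (grow 1 n g))" using damp_grow[of 1 g] by (simp add: LIMSEQ_imp_Cauchy)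
    have "Cauchy (\<lambda>n. L (grow 1 n g))"
    proof (rule metric_CauchyI)
      fix e :: real assume "e > 0"
      with \<open>Cauchy (\<lambda>n. damp 1 (grow 1 n g))\<close> obtain M where
        M: "\<And>m n. m \<ge> M \<Longrightarrow> n \<ge> M \<Longrightarrow> dist (damp 1 (grow 1 m g)) (damp 1 (grow 1 n g)) < e"
        by (meson metric_CauchyD)
      have "dist (L (grow 1 m g)) (L (grow 1 n g)) \<le> dist (damp 1 (grow 1 m g)) (damp 1 (grow 1 n g))" for m n
        using bound[of "grow 1 m g - grow 1 n g"] by (simp add: dist_norm diff blinfun.diff_right)
      then show "\<exists>M. \<forall>m\<ge>M. \<forall>n\<ge>M. dist (L (grow 1 m g)) (L (grow 1 n g)) < e"
        using M by (meson le_less_trans)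
    qed
    then show ?thesis by (simp add: Cauchy_convergent)
  qed
  then obtain L0 where L0: "\<And>g. (\<lambda>n. L (grow 1 n g)) \<longlonglongrightarrow> L0 g"
    unfolding convergent_def by metis
  have "bounded_linear L0"
  proof (rule bounded_linear_intro[where K = 1])
    fix f g and c :: real
    have "(\<lambda>n. L (grow 1 n f) + L (grow 1 n g)) \<longlonglongrightarrow> L0 f + L0 g" by (intro tendsto_add L0)
    then have "(\<lambda>n. L (grow 1 n (f + g))) \<longlonglongrightarrow> L0 f + L0 g" by (simp add: blinfun.add_right add)
    then show "L0 (f + g) = L0 f + L0 g" using L0 LIMSEQ_unique by blast
    have "(\<lambda>n. c *\<^sub>R L (grow 1 n f)) \<longlonglongrightarrow> c *\<^sub>R L0 f" by (intro tendsto_scaleR tendsto_const L0)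
    then have "(\<lambda>n. L (grow 1 n (c *\<^sub>R f))) \<longlonglongrightarrow> c *\<^sub>R L0 f" by (simp add: blinfun.scaleR_right scale)
    then show "L0 (c *\<^sub>R f) = c *\<^sub>R L0 f" using L0 LIMSEQ_unique by blast
    have "(\<lambda>n. norm (L (grow 1 n f))) \<longlonglongrightarrow> norm (L0 f)" by (intro tendsto_norm L0)
    moreover have "(\<lambda>n. norm (damp 1 (grow 1 n f))) \<longlonglongrightarrow> norm f" by (intro tendsto_norm damp_grow) simp
    ultimately have "norm (L0 f) \<le> norm f" by (rule LIMSEQ_le) (use bound in blast)
    then show "norm (L0 f) \<le> norm f * 1" by simp
  qed
  then have b: "blinfun_apply (Blinfun L0) = L0" by (rule bounded_linear_Blinfun_apply)
  have "L0 (damp 1 f) = L f" for f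
  proof -
    have "(\<lambda>n. damp 1 (grow 1 n (damp 1 f)) - damp 1 f) \<longlonglongrightarrow> damp 1 f - damp 1 f"
      by (intro tendsto_diff damp_grow tendsto_const) simp
    then have "(\<lambda>n. norm (damp 1 (grow 1 n (damp 1 f)) - damp 1 f)) \<longlonglongrightarrow> 0"
      by (simp add: tendsto_norm_zero)
    then have "(\<lambda>n. L (grow 1 n (damp 1 f)) - L f) \<longlonglongrightarrow> 0"
      by (rule Lim_null_comparison[rotated])
        (use bound[of "grow 1 _ (damp 1 f) - f"] in \<open>simp add: diff blinfun.diff_right\<close>)
    from LIMSEQ_unique[OF L0 LIM_zero_cancel[OF this]] show ?thesis .
  qed
  then show ?thesis using L0 b by (intro exI[of _ "Blinfun L0"]) simp
qed

context first_passage
begin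

lemma K0: "0 \<le> K" using K_pos by simp

definition damped_passage :: "'e c0 \<Rightarrow> real \<Rightarrow>\<^sub>C 'e c0" where
  "damped_passage f = Bcontfun (\<lambda>l. damp 1 (killed_passage f l))"

lemma damped_passage: "damped_passage f l = damp 1 (killed_passage f l)"
proof -
  have "(\<lambda>l. damp 1 (killed_passage f l)) \<in> bcontfun"
    by (rule bcontfun_normI[of _ "norm (killed_passage f)"])
      (auto intro!: continuous_on_blinfun_const order_trans[OF norm_damp norm_bounded])
  then show ?thesis by (simp add: damped_passage_def Bcontfun_inverse)
qed

lemma damped_passage_le:
  assumes u: "\<And>t. 0 \<le> t \<Longrightarrow> 0 \<le> u t" "\<And>s t. 0 \<le> s \<Longrightarrow> 0 \<le> t \<Longrightarrow> u (s + t) \<le> u s"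
    and f: "\<And>j t. j \<in> A \<Longrightarrow> 0 \<le> t \<Longrightarrow> val f j t \<le> exp t * u t"
    and s: "0 \<le> s"
  shows "val (damped_passage f l) i s \<le> u s"
proof -
  have "val (killed_passage f l) i s \<le> exp s * u s"
    by (rule killed_passage_le[where U = "\<lambda>s. exp s * u s"]) (use u f s in \<open>auto simp: exp_add intro!: mult_left_mono\<close>)
  then have "exp (- s) * val (killed_passage f l) i s \<le> exp (- s) * (exp s * u s)" by (rule mult_left_mono) simp
  moreover have "exp (- s) * (exp s * u s) = u s" by (simp add: exp_minus)
  ultimately show ?thesis using s val_damp[of 1 s "killed_passage f l" i] by (simp add: damped_passage)
qed

text \<open>
  The bound \<open>e\<^sup>s u(s)\<close> on the data becomes \<open>u(s)\<close> after damping; here \<open>u\<close> is constant.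
\<close>

lemma damped_passage_norm: "norm (damped_passage f) \<le> norm (damp 1 f)"
proof (rule norm_bound, rule norm_c0_le)
  fix l i and s :: real assume s: "0 \<le> s"
  have le: "val g j t \<le> exp t * norm (damp 1 f)" if "g = f \<or> g = - f" "0 \<le> t" for g j t
  proof -
    have "exp (- t) * val g j t \<le> norm (damp 1 f)"
      using abs_val_le[of "damp 1 f" j t] that by (auto simp: val_damp)
    then have "exp t * (exp (- t) * val g j t) \<le> exp t * norm (damp 1 f)" by (rule mult_left_mono) simp
    moreover have "exp t * (exp (- t) * val g j t) = val g j t" by (simp add: exp_minus)
    ultimately show ?thesis by simp
  qed
  have "val (damped_passage g l) i s \<le> norm (damp 1 f)" if "g = f \<or> g = - f" for g
    by (rule damped_passage_le[where u = "\<lambda>_. norm (damp 1 f)"]) (use le that s in auto)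
  from this[of f] this[of "- f"] show "\<bar>val (damped_passage f l) i s\<bar> \<le> norm (damp 1 f)"
    by (simp add: damped_passage killed_passage_uminus blinfun.minus_right)
qed simp

text \<open>
  First passage without killing, as the extension of \<open>damped_passage\<close> from the dense range of
  \<open>damp 1\<close>.
\<close>

definition passage :: "'e c0 \<Rightarrow>\<^sub>L (real \<Rightarrow>\<^sub>C 'e c0)" where
  "passage = (SOME L' :: 'e c0 \<Rightarrow>\<^sub>L (real \<Rightarrow>\<^sub>C 'e c0). (\<forall>f. L' (damp 1 f) = damped_passage f) \<and> (\<forall>g. (\<lambda>n. damped_passage (grow 1 n g)) \<longlonglongrightarrow> L' g))"

lemma passage_ex: "(\<forall>f. passage (damp 1 f) = damped_passage f) \<and> (\<forall>g. (\<lambda>n. damped_passage (grow 1 n g)) \<longlonglongrightarrow> passage g)"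
proof -
  have "\<exists>L' :: 'e c0 \<Rightarrow>\<^sub>L (real \<Rightarrow>\<^sub>C 'e c0).
    (\<forall>f. L' (damp 1 f) = damped_passage f) \<and> (\<forall>g. (\<lambda>n. damped_passage (grow 1 n g)) \<longlonglongrightarrow> L' g)"
  proof (rule extend_along_damp[of damped_passage])
    show "damped_passage (f + g) = damped_passage f + damped_passage g" for f g
      by (rule bcontfun_eqI) (simp add: damped_passage killed_passage_add blinfun.add_right)
    show "damped_passage (c *\<^sub>R f) = c *\<^sub>R damped_passage f" for c f
      by (rule bcontfun_eqI) (simp add: damped_passage killed_passage_scale blinfun.scaleR_right)
  qed (rule damped_passage_norm)
  from someI_ex[OF this] show ?thesis unfolding passage_def .
qed

lemma passage_damp: "passage (damp 1 f) l = damp 1 (killed_passage f l)"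
  using passage_ex damped_passage by simp

lemma passage_lim: "(\<lambda>n. val (damped_passage (grow 1 n g) l) i s) \<longlonglongrightarrow> val (passage g l) i s"
  using passage_ex bounded_linear.tendsto[OF bounded_linear_compose[OF bounded_linear_val bounded_linear_apply_bcontfun]]
  by blast

text \<open>
  The master estimate for the problem without killing: constant bounds give positivity and
  contraction, bounds that vanish after a time \<open>\<eta>\<close> give the support condition.
\<close>

lemma passage_le:
  assumes u: "\<And>t. 0 \<le> t \<Longrightarrow> 0 \<le> u t" "\<And>s t. 0 \<le> s \<Longrightarrow> 0 \<le> t \<Longrightarrow> u (s + t) \<le> u s"
    and g: "\<And>j t. j \<in> A \<Longrightarrow> 0 \<le> t \<Longrightarrow> val g j t \<le> u t"
    and s: "0 \<le> s"
  shows "val (passage g l) i s \<le> u s"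
proof (rule LIMSEQ_le_const2[OF passage_lim], intro exI allI impI)
  fix n
  show "val (damped_passage (grow 1 n g) l) i s \<le> u s"
  proof (rule damped_passage_le[OF u _ s])
    fix j t assume j: "j \<in> A" and t: "(0::real) \<le> t"
    have "val (grow 1 n g) j t \<le> exp (min t (real n)) * u t"
      using g[OF j t] t by (simp add: val_grow)
    also have "\<dots> \<le> exp t * u t" using u(1)[OF t] by (intro mult_right_mono) auto
    finally show "val (grow 1 n g) j t \<le> exp t * u t" .
  qed auto
qed

lemma passage_abs_le:
  assumes u: "\<And>t. 0 \<le> t \<Longrightarrow> 0 \<le> u t" "\<And>s t. 0 \<le> s \<Longrightarrow> 0 \<le> t \<Longrightarrow> u (s + t) \<le> u s"
    and g: "\<And>j t. j \<in> A \<Longrightarrow> 0 \<le> t \<Longrightarrow> \<bar>val g j t\<bar> \<le> u t"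
    and s: "0 \<le> s"
  shows "\<bar>val (passage g l) i s\<bar> \<le> u s"
proof -
  have "val (passage g l) i s \<le> u s" by (rule passage_le[where u = u]) (use u g s in \<open>auto simp: abs_le_iff\<close>)
  moreover have "val (passage (- g) l) i s \<le> u s" by (rule passage_le[where u = u]) (use u g s in \<open>auto simp: abs_le_iff\<close>)
  ultimately show ?thesis by (simp add: blinfun.minus_right)
qed

lemma passage_norm: "norm (passage g l) \<le> norm g"
  by (rule norm_c0_le, simp, rule passage_abs_le[where u = "\<lambda>_. norm g"]) (auto simp: abs_val_le)

lemma passage_nonneg: "(\<And>j t. 0 \<le> t \<Longrightarrow> 0 \<le> val g j t) \<Longrightarrow> 0 \<le> s \<Longrightarrow> 0 \<le> val (passage g l) i s"
  using passage_le[of "\<lambda>_. 0" "- g" s l i] by (simp add: blinfun.minus_right)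

lemma passage_support:
  assumes "\<And>j t. j \<in> A \<Longrightarrow> \<eta> < t \<Longrightarrow> val g j t = 0" "0 \<le> s" "\<eta> < s"
  shows "val (passage g l) i s = 0"
  using passage_abs_le[of "\<lambda>t. if t \<le> \<eta> then norm g else 0" g s l i] assms
  by (auto simp: abs_val_le)

lemma damp_up:
  assumes F: "continuous_on UNIV F"
  shows "damp 1 (up (K + 1) g F l) = up K (damp 1 g) (\<lambda>r. damp 1 (F r)) l"
proof -
  have "damp 1 (integral {0..l} (\<lambda>r. T (K + 1) r (PA (P (F (l - r)))))) =
    integral {0..l} (\<lambda>r. T K r (PA (P (damp 1 (F (l - r))))))"
    by (subst blinfun_integral) (simp_all add: flow_cont shift_cont F K1 T_damp K0 damp_restr P_damp)
  then show ?thesis by (simp add: up_def blinfun.add_right T_damp K0 damp_restr)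
qed

lemma damp_down:
  assumes F: "continuous_on UNIV F"
  shows "damp 1 (down (K + 1) h F l) = down K h (\<lambda>r. damp 1 (F r)) l"
proof -
  have "damp 1 (integral {0..h} (\<lambda>r. T (K + 1) r (PB (P (F (l + r)))))) =
    integral {0..h} (\<lambda>r. T K r (PB (P (damp 1 (F (l + r))))))"
    by (subst blinfun_integral) (simp_all add: flow_cont shift_cont F K1 T_damp K0 damp_restr P_damp)
  then show ?thesis by (simp add: down_def blinfun.add_right T_damp K0 damp_restr)
qed

lemma passage_cont [continuous_intros]:
  "continuous_on S g \<Longrightarrow> continuous_on S r \<Longrightarrow> continuous_on S (\<lambda>x. apply_bcontfun (passage (g x)) (r x))"
  by (intro apply_bcontfun_cont continuous_on_blinfun_const)

text \<open>
  Both sides depend continuously on \<open>g\<close>, and on the range of \<open>damp 1\<close> the equations are the killed ones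
  multiplied by \<open>e\<^sup>-\<^sup>s\<close>.
\<close>

lemma passage_solves: "passage_equations K g (passage g)"
  unfolding passage_equations_def
proof (intro allI impI conjI)
  fix l :: real assume l: "0 \<le> l"
  have damp: "apply_bcontfun (passage (damp 1 f)) = (\<lambda>r. damp 1 (killed_passage f r))" for f
    by (rule ext) (rule passage_damp)
  show "PA (passage g l) = up K g (passage g) l"
  proof (rule eq_on_damp_range[of 1 "\<lambda>g. PA (passage g l)" "\<lambda>g. up K g (passage g) l"])
    show "continuous_on UNIV (\<lambda>g. PA (passage g l))"
      by (intro continuous_on_blinfun_const passage_cont continuous_on_id continuous_on_const)
    have "continuous_on UNIV (\<lambda>(g, r). T K r (PA (P (passage g (l - r)))))"
      unfolding split_def by (intro T_cont K0 continuous_on_blinfun_const passage_cont continuous_intros)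
    then show "continuous_on UNIV (\<lambda>g. up K g (passage g) l)"
      unfolding up_def
      by (intro continuous_on_add integral_continuous_param T_cont K0 continuous_on_blinfun_const
          continuous_on_id continuous_on_const)
    show "PA (passage (damp 1 f) l) = up K (damp 1 f) (passage (damp 1 f)) l" for f
      using killed_passage_solves[of f] l unfolding damp damp_up[OF continuous_on_apply_bcontfun, symmetric]
      by (simp add: passage_equations_def flip: damp_restr)
  qed simp
  fix h :: real assume h: "0 \<le> h"
  show "PB (passage g l) = down K h (passage g) l"
  proof (rule eq_on_damp_range[of 1 "\<lambda>g. PB (passage g l)" "\<lambda>g. down K h (passage g) l"])
    show "continuous_on UNIV (\<lambda>g. PB (passage g l))"
      by (intro continuous_on_blinfun_const passage_cont continuous_on_id continuous_on_const)
    have "continuous_on UNIV (\<lambda>(g, r). T K r (PB (P (passage g (l + r)))))"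
      unfolding split_def by (intro T_cont K0 continuous_on_blinfun_const passage_cont continuous_intros)
    then show "continuous_on UNIV (\<lambda>g. down K h (passage g) l)"
      unfolding down_def
      by (intro continuous_on_add integral_continuous_param T_cont K0 continuous_on_blinfun_const
          continuous_on_id continuous_on_const passage_cont)
    show "PB (passage (damp 1 f) l) = down K h (passage (damp 1 f)) l" for f
      using killed_passage_down[OF h l, of f] unfolding damp damp_down[OF continuous_on_apply_bcontfun, symmetric]
      by (simp flip: damp_restr)
  qed simp
qed

lemma passage_restr: "passage (PA g) = passage g"
proof (rule eq_on_damp_range[of 1 "\<lambda>g. passage (PA g)" "\<lambda>g. passage g"])
  show "passage (PA (damp 1 f)) = passage (damp 1 f)" for f
  proof (rule bcontfun_eqI)
    fix l
    show "passage (PA (damp 1 f)) l = passage (damp 1 f) l"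
      using passage_damp[of "PA f" l] passage_damp[of f l] by (simp add: damp_restr killed_passage_restr)
  qed
qed (auto intro!: continuous_on_blinfun_const continuous_on_id)

lemma passage_shift:
  assumes "0 \<le> m" "0 \<le> l"
  shows "passage (passage g m) l = passage g (m + l)"
proof (rule eq_on_damp_range[of 1 "\<lambda>g. passage (passage g m) l" "\<lambda>g. passage g (m + l)"])
  show "passage (passage (damp 1 f) m) l = passage (damp 1 f) (m + l)" for f
    unfolding passage_damp killed_passage_shift[OF assms] ..
qed (auto intro!: passage_cont continuous_on_id continuous_on_const)

lemma passage_zero: "PA (passage g 0) = PA g"
proof -
  interpret contraction_semigroup "T K" by (rule T_semigroup[OF K0])
  show ?thesis using passage_solves[of g] by (simp add: passage_equations_def up_def)
qed

definition Q :: "real \<Rightarrow> 'e c0 \<Rightarrow> 'e c0" where "Q l g = PA (passage g l)"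
definition S :: "'e c0 \<Rightarrow> 'e c0" where "S g = PB (passage g 0)"

lemma passage_0_eq: "PA g = g \<Longrightarrow> passage g 0 = g + S g"
  using restr_decomp[of "passage g 0"] passage_zero[of g] by (simp add: S_def)

text \<open>
  A start outside \<open>A\<close> must first return to level \<open>0\<close> before it can reach \<open>l\<close>.
\<close>

lemma passage_split: "0 \<le> l \<Longrightarrow> PB (passage g l) = S (Q l g)"
  using passage_shift[of l 0 g] by (simp add: S_def Q_def passage_restr)

lemma Q_add: "0 \<le> a \<Longrightarrow> 0 \<le> b \<Longrightarrow> Q (a + b) g = Q a (Q b g)"
  using passage_shift[of b a g] by (simp add: Q_def passage_restr add.commute)

abbreviation "genT \<equiv> contraction_semigroup.gen (T K)"

definition genQ :: "'e c0 \<Rightarrow> 'e c0 \<Rightarrow> bool" where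
  "genQ x y \<longleftrightarrow> ((\<lambda>h. (Q h x - x) /\<^sub>R h) \<longlongrightarrow> y) (at_right 0)"

text \<open>
  By the upward equation \<open>Q h x\<close> differs from \<open>T K h x\<close> by an integral whose average tends to a bounded
  operator applied to \<open>x\<close>. So on functions that vanish outside \<open>A\<close> both generators have the same domain.
\<close>

lemma genQ_iff:
  assumes x: "PA x = x"
  shows "genQ x y \<longleftrightarrow> genT x (y - PA (P (passage x 0)))"
proof -
  interpret contraction_semigroup "T K" by (rule T_semigroup[OF K0])
  let ?i = "\<lambda>h. integral {0..h} (\<lambda>r. T K r (PA (P (passage x (h - r)))))"
  have "continuous_on UNIV (\<lambda>(h, r). T K r (PA (P (passage x (h - r)))))"
    unfolding split_def by (intro T_cont K0 continuous_on_blinfun_const passage_cont continuous_intros)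
  from average_tendsto[OF this]
  have avg: "((\<lambda>h. ?i h /\<^sub>R h) \<longlongrightarrow> PA (P (passage x 0))) (at_right 0)" by simp
  have eq: "\<forall>\<^sub>F h in at_right 0. (Q h x - x) /\<^sub>R h = (T K h x - x) /\<^sub>R h + ?i h /\<^sub>R h"
  proof -
    have "(Q h x - x) /\<^sub>R h = (T K h x - x) /\<^sub>R h + ?i h /\<^sub>R h" if "0 < h" for h
    proof -
      have "Q h x = up K x (passage x) h"
        using passage_solves[of x] that unfolding passage_equations_def Q_def by (meson less_imp_le)
      then show ?thesis using x by (simp add: up_def scaleR_right_diff_distrib scaleR_right_distrib)
    qed
    then show ?thesis by (auto simp: eventually_at_filter)
  qed
  show ?thesis
  proof
    assume "genQ x y"
    then have "((\<lambda>h. (T K h x - x) /\<^sub>R h + ?i h /\<^sub>R h) \<longlongrightarrow> y) (at_right 0)"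
      unfolding genQ_def using eq by (rule Lim_transform_eventually)
    from tendsto_diff[OF this avg] show "gen x (y - PA (P (passage x 0)))" by (simp add: gen_def)
  next
    assume "gen x (y - PA (P (passage x 0)))"
    from tendsto_add[OF this[unfolded gen_def] avg]
    have "((\<lambda>h. (T K h x - x) /\<^sub>R h + ?i h /\<^sub>R h) \<longlongrightarrow> y) (at_right 0)" by simp
    then show "genQ x y" unfolding genQ_def
      by (rule Lim_transform_eventually) (rule eventually_mono[OF eq sym])
  qed
qed

lemma Q_cont: "continuous_on X g \<Longrightarrow> continuous_on X r \<Longrightarrow> continuous_on X (\<lambda>x. Q (r x) (g x))"
  unfolding Q_def by (intro continuous_on_blinfun_const passage_cont)

lemma S_bounded_linear: "bounded_linear S"
  unfolding S_def
  by (rule bounded_linear_intro[where K = 1])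
    (auto simp: blinfun.add_right blinfun.scaleR_right plus_bcontfun.rep_eq scaleR_bcontfun.rep_eq
      intro: order_trans[OF norm_restr passage_norm])

text \<open>
  The downward equation at level \<open>0\<close> reads \<open>S x = T h (S (Q h x)) + \<dots>\<close>. Hence
  \<open>(T h (S x) - S x) / h\<close> is \<open>- T h (S ((Q h x - x) / h))\<close> minus the average of the jump term.
\<close>

lemma S_gen:
  assumes "PA x = x" "genQ x y"
  shows "genT (S x) (- S y - PB (P (passage x 0)))"
proof -
  interpret contraction_semigroup "T K" by (rule T_semigroup[OF K0])
  interpret S: bounded_linear S by (rule S_bounded_linear)
  let ?i = "\<lambda>h. integral {0..h} (\<lambda>r. T K r (PB (P (passage x r))))"
  have "continuous_on UNIV (\<lambda>(h :: real, r). T K r (PB (P (passage x r))))"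
    unfolding split_def by (intro T_cont K0 continuous_on_blinfun_const passage_cont continuous_intros)
  from average_tendsto[OF this]
  have avg: "((\<lambda>h. ?i h /\<^sub>R h) \<longlongrightarrow> PB (P (passage x 0))) (at_right 0)" by simp
  have "((\<lambda>h. T K h (- S ((Q h x - x) /\<^sub>R h)) - ?i h /\<^sub>R h) \<longlongrightarrow> T K 0 (- S y) - PB (P (passage x 0))) (at_right 0)"
    by (intro tendsto_diff avg T_tendsto tendsto_minus S.tendsto assms(2)[unfolded genQ_def] tendsto_ident_at)
  moreover have "T K h (- S ((Q h x - x) /\<^sub>R h)) - ?i h /\<^sub>R h = (T K h (S x) - S x) /\<^sub>R h" if "0 < h" for h
  proof -
    have "S x = T K h (S (Q h x)) + ?i h"
    proof -
      have "PB (passage x 0) = down K h (passage x) 0"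
        using passage_solves[of x] that unfolding passage_equations_def by (meson less_imp_le order_refl)
      then show ?thesis using passage_split[of h x] that by (simp add: down_def S_def)
    qed
    then have "T K h (S x) - S x = T K h (- S (Q h x - x)) - ?i h"
      by (simp add: S.diff blinfun.diff_right blinfun.minus_right)
    then have "(T K h (S x) - S x) /\<^sub>R h = T K h (- S (Q h x - x)) /\<^sub>R h - ?i h /\<^sub>R h"
      by (simp only: scaleR_diff_right)
    then show ?thesis by (simp only: S.scaleR blinfun.scaleR_right blinfun.minus_right scaleR_minus_right)
  qed
  then have "\<forall>\<^sub>F h in at_right 0. T K h (- S ((Q h x - x) /\<^sub>R h)) - ?i h /\<^sub>R h = (T K h (S x) - S x) /\<^sub>R h"
    by (auto simp: eventually_at_filter)
  ultimately show ?thesis unfolding gen_def T_zero by (rule Lim_transform_eventually)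
qed

end

section \<open>The domain of the translation generator\<close>

lemma C0_restr_iff: "fn_of f \<in> C0 A \<longleftrightarrow> restr A f = f"
proof
  assume "fn_of f \<in> C0 A"
  then have 0: "\<And>x. x \<notin> Xbar A \<Longrightarrow> fn_of f x = 0" by (simp add: C0_iff)
  have "val f i s = 0" if "i \<notin> A" for i s
    unfolding val_def by (rule 0) (use that in \<open>auto simp: Xbar_def\<close>)
  then show "restr A f = f" by (intro c0_eqI) simp
next
  assume r: "restr A f = f"
  have "val f i s = 0" if "i \<notin> A" for i s
    using arg_cong[OF r, of "\<lambda>f. val f i s"] that by simp
  then have "fn_of f x = 0" if "x \<notin> Xbar A" for x
  proof (cases x)
    case (Some p)
    then obtain t i where x: "x = Some (t, i)" by (cases p) auto
    then have "t < 0 \<or> i \<notin> A" using that by (auto simp: Xbar_def)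
    then show ?thesis using \<open>\<And>i s. i \<notin> A \<Longrightarrow> val f i s = 0\<close> by (auto simp: x fn_of_Some)
  qed simp
  then show "fn_of f \<in> C0 A" using fn_of[of f] by (simp add: C0_iff)
qed

lemma restr_c0_of: "g \<in> C0 A \<Longrightarrow> restr A (c0_of g) = c0_of g"
  by (simp add: c0_of_inverse' flip: C0_restr_iff)

lemma supnorm_fn_of: "restr A f = f \<Longrightarrow> supnorm A (fn_of f) = norm f"
proof (rule antisym)
  assume r: "restr A f = f"
  show "supnorm A (fn_of f) \<le> norm f"
    unfolding supnorm_def by (rule cSUP_least) (auto simp: Xbar_def abs_fn_of_le_norm)
  have "bdd_above ((\<lambda>x. \<bar>fn_of f x\<bar>) ` Xbar A)" by (rule bdd_aboveI2) (rule abs_fn_of_le_norm)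
  then have le: "\<bar>fn_of f x\<bar> \<le> supnorm A (fn_of f)" if "x \<in> Xbar A" for x
    unfolding supnorm_def using that by (intro cSUP_upper)
  have "0 \<le> supnorm A (fn_of f)" using le[of None] by (simp add: Xbar_def)
  moreover have "fn_of f x = 0" if "x \<notin> Xbar A" for x
    using that r by (simp add: C0_iff flip: C0_restr_iff)
  ultimately show "norm f \<le> supnorm A (fn_of f)"
    using le by (intro norm_c0_leI') (metis abs_zero)
qed

lemma at_within_Ici_neq_bot: "0 \<le> s \<Longrightarrow> at s within {0::real..} \<noteq> bot"
proof -
  assume "0 \<le> s"
  have "s islimpt {s..s + 1}" by (simp add: islimpt_Icc)
  then have "s islimpt {0..}" by (rule islimpt_subset) (use \<open>0 \<le> s\<close> in auto)
  then show ?thesis by (simp add: trivial_limit_within)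
qed

context generator_family
begin

text \<open>
  The direction from the generator to the derivative evaluates orbits at time \<open>0\<close>: the value of \<open>T K r f\<close>
  there is \<open>e\<^sup>-\<^sup>K\<^sup>t f(t)\<close> with \<open>t = r / nu i\<close>, and orbits are differentiable. The converse is the fundamental
  theorem of calculus along characteristics.
\<close>

lemma genT_iff_deriv:
  "contraction_semigroup.gen (T K) f z \<longleftrightarrow>
    (\<forall>i. \<forall>s\<ge>0. (val f i has_real_derivative (nu i * val z i s + K * val f i s)) (at s within {0..}))"
proof -
  have K0: "0 \<le> K" using K_pos by simp
  interpret contraction_semigroup "T K" by (rule T_semigroup[OF K0])
  show ?thesis
  proof (intro iffI allI impI)
    fix i and s :: real assume g: "gen f z" and s: "0 \<le> s"
    let ?p = "\<lambda>r. exp (- K * (r / nu i)) * val f i (r / nu i)"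
    have vT: "val (T K r g) i 0 = exp (- K * (r / nu i)) * val g i (r / nu i)" if "0 \<le> r" for r g
      using that by (simp add: val_T K0)
    have ns: "0 \<le> nu i * s" using s nu_pos[of i] by simp
    have "((\<lambda>r. val (T K r f) i 0) has_vector_derivative val (T K (nu i * s) z) i 0) (at (nu i * s) within {0..})"
      by (rule bounded_linear.has_vector_derivative[OF bounded_linear_val gen_orbit_deriv[OF g ns]])
    then have "(?p has_vector_derivative val (T K (nu i * s) z) i 0) (at (nu i * s) within {0..})"
      by (rule has_vector_derivative_transform[rotated 2]) (use ns in \<open>auto simp: vT\<close>)
    then have p: "(?p has_real_derivative exp (- K * s) * val z i s) (at (nu i * s) within {0..})"
      using vT[OF ns, of z] nu_pos[of i] by (simp add: has_real_derivative_iff_has_vector_derivative)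
    have sub: "(\<lambda>t. nu i * t) ` {0..} \<subseteq> {0..}" using nu_pos[of i] by auto
    have d: "((\<lambda>t. nu i * t) has_real_derivative nu i) (at s within {0..})"
      by (auto intro!: derivative_eq_intros)
    have "(?p \<circ> (\<lambda>t. nu i * t) has_real_derivative (exp (- K * s) * val z i s) * nu i) (at s within {0..})"
      by (rule DERIV_image_chain[OF DERIV_subset[OF p sub] d])
    then have "((\<lambda>t. exp (- K * t) * val f i t) has_real_derivative (exp (- K * s) * val z i s) * nu i) (at s within {0..})"
      using nu_pos[of i] by (simp add: o_def)
    moreover have "((\<lambda>t. exp (K * t)) has_real_derivative K * exp (K * s)) (at s within {0..})"
      by (auto intro!: derivative_eq_intros)
    ultimately have "((\<lambda>t. exp (K * t) * (exp (- K * t) * val f i t)) has_real_derivative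
        K * exp (K * s) * (exp (- K * s) * val f i s) + (exp (- K * s) * val z i s) * nu i * exp (K * s)) (at s within {0..})"
      by (rule DERIV_mult[rotated])
    moreover have "(\<lambda>t. exp (K * t) * (exp (- K * t) * val f i t)) = val f i"
      by (rule ext) (simp add: exp_minus)
    moreover have "K * exp (K * s) * (exp (- K * s) * x) + (exp (- K * s) * y) * nu i * exp (K * s) = nu i * y + K * x" for x y
      by (simp add: exp_minus field_simps)
    ultimately show "(val f i has_real_derivative (nu i * val z i s + K * val f i s)) (at s within {0..})"
      by simp
  next
    assume d: "\<forall>i. \<forall>s\<ge>0. (val f i has_real_derivative (nu i * val z i s + K * val f i s)) (at s within {0..})"
    show "gen f z"
    proof (rule genI_integral, rule c0_eqI)
      fix h s :: real and i assume h: "0 \<le> h" and s: "0 \<le> s"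
      let ?t = "\<lambda>r. s + r / nu i"
      have t: "0 \<le> ?t r" if "0 \<le> r" for r using s that nu_pos[of i] by simp
      have "((\<lambda>r. exp (- K * (r / nu i)) * val f i (?t r)) has_real_derivative exp (- K * (r / nu i)) * val z i (?t r))
          (at r within {0..h})" if r: "r \<in> {0..h}" for r
      proof -
        have tr: "0 \<le> ?t r" using t r by simp
        have sub: "?t ` {0..h} \<subseteq> {0..}"
        proof
          fix x assume "x \<in> ?t ` {0..h}"
          then obtain r' where "0 \<le> r'" "x = ?t r'" by auto
          then show "x \<in> {0..}" using t[of r'] by simp
        qed
        have "(?t has_real_derivative 1 / nu i) (at r within {0..h})"
          using nu_pos[of i] by (auto intro!: derivative_eq_intros)
        from DERIV_image_chain[OF DERIV_subset[OF d[rule_format, OF tr, of i] sub] this]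
        have c: "((\<lambda>r. val f i (?t r)) has_real_derivative (nu i * val z i (?t r) + K * val f i (?t r)) * (1 / nu i)) (at r within {0..h})"
          by (simp add: o_def)
        have e: "((\<lambda>r. exp (- K * (r / nu i))) has_real_derivative exp (- K * (r / nu i)) * (- K / nu i)) (at r within {0..h})"
          using nu_pos[of i] by (auto intro!: derivative_eq_intros)
        show ?thesis
          by (rule DERIV_cong[OF DERIV_mult[OF e c]]) (use nu_pos[of i] in \<open>simp add: field_simps\<close>)
      qed
      then have "((\<lambda>r. exp (- K * (r / nu i)) * val z i (?t r)) has_integral
          exp (- K * (h / nu i)) * val f i (?t h) - exp (- K * (0 / nu i)) * val f i (?t 0)) {0..h}"
        by (intro fundamental_theorem_of_calculus h) (simp add: has_real_derivative_iff_has_vector_derivative)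
      then have "integral {0..h} (\<lambda>r. exp (- K * (r / nu i)) * val z i (?t r)) = val (T K h f - f) i s"
        using s h K0 by (simp add: val_T integral_unique)
      moreover have "continuous_on {0..h} (\<lambda>r. T K r z)"
        using T_cont_orbit by (rule continuous_on_subset) simp
      then have "val (integral {0..h} (\<lambda>r. T K r z)) i s = integral {0..h} (\<lambda>r. exp (- K * (r / nu i)) * val z i (?t r))"
        unfolding val_integral[OF \<open>continuous_on {0..h} (\<lambda>r. T K r z)\<close>]
        by (intro integral_cong) (use s K0 in \<open>simp add: val_T\<close>)
      ultimately show "val (T K h f - f) i s = val (integral {0..h} (\<lambda>r. T K r z)) i s" by simp
    qed
  qed
qed

text \<open>
  The value of the generator is \<open>genT_iff_deriv\<close> solved for \<open>z\<close>; the converse is \<open>gen_C01\<close>.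
\<close>

lemma C01_gen:
  assumes "g \<in> C01 A"
  shows "contraction_semigroup.gen (T K) (c0_of g)
    (mk (\<lambda>i s. (val (c0_of (dds A g)) i s - K * val (c0_of g) i s) / nu i))"
proof -
  let ?f = "c0_of g" and ?d = "c0_of (dds A g)"
  let ?z = "mk (\<lambda>i s. (val ?d i s - K * val ?f i s) / nu i)"
  have g: "g \<in> C0 A" and d: "dds A g \<in> C0 A"
    and diff: "\<And>i s. i \<in> A \<Longrightarrow> 0 \<le> s \<Longrightarrow> (\<lambda>r. g (Some (r, i))) differentiable (at s within {0..})"
    using assms by (auto simp: C01_def)
  have z: "val ?z i s = (val ?d i s - K * val ?f i s) / nu i" if "0 \<le> s" for i s
  proof (rule val_mk[OF _ _ that])
    fix i
    have "nu i \<noteq> 0" using nu_pos[of i] by simp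
    then show "continuous_on {0..} (\<lambda>s. (val ?d i s - K * val ?f i s) / nu i)"
      by (intro continuous_intros) auto
    have "((\<lambda>s. (val ?d i s - K * val ?f i s) / nu i) \<longlongrightarrow> (0 - K * 0) / nu i) at_top"
      by (intro tendsto_intros val_lim) (use \<open>nu i \<noteq> 0\<close> in auto)
    then show "((\<lambda>s. (val ?d i s - K * val ?f i s) / nu i) \<longlongrightarrow> 0) at_top" by simp
  qed
  show ?thesis
    unfolding genT_iff_deriv
  proof (intro allI impI)
    fix i and s :: real assume s: "0 \<le> s"
    have e: "nu i * val ?z i s + K * val ?f i s = val ?d i s"
      using s nu_pos[of i] by (simp add: z)
    show "(val ?f i has_real_derivative (nu i * val ?z i s + K * val ?f i s)) (at s within {0..})"
      unfolding e
    proof (cases "i \<in> A")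
      case True
      have "((\<lambda>r. g (Some (r, i))) has_vector_derivative vector_derivative (\<lambda>r. g (Some (r, i))) (at s within {0..})) (at s within {0..})"
        using diff[OF True s] by (simp add: vector_derivative_works)
      then have "((\<lambda>r. g (Some (r, i))) has_vector_derivative val ?d i s) (at s within {0..})"
        using True s by (simp add: val_def c0_of_inverse'[OF d]) (simp add: dds_def)
      then have "(val ?f i has_vector_derivative val ?d i s) (at s within {0..})"
        by (rule has_vector_derivative_transform[rotated 2]) (use s in \<open>auto simp: val_def c0_of_inverse'[OF g]\<close>)
      then show "(val ?f i has_real_derivative val ?d i s) (at s within {0..})"
        by (simp add: has_real_derivative_iff_has_vector_derivative)
    next
      case False
      have "val ?d i s = 0" "val ?f i = (\<lambda>_. 0)"
        using arg_cong[OF restr_c0_of[OF d], of "\<lambda>f. val f i s"] False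
          fun_cong[OF arg_cong[OF restr_c0_of[OF g], of "\<lambda>f. val f i"]] by (auto simp: fun_eq_iff)
      then show "(val ?f i has_real_derivative val ?d i s) (at s within {0..})" by simp
    qed
  qed
qed

lemma gen_C01:
  assumes g: "g \<in> C0 A" and gen: "contraction_semigroup.gen (T K) (c0_of g) z"
  shows "g \<in> C01 A" 
    and "i \<in> A \<Longrightarrow> 0 \<le> s \<Longrightarrow> dds A g (Some (s, i)) = nu i * val z i s + K * val (c0_of g) i s"
proof -
  let ?f = "c0_of g"
  have der: "((\<lambda>r. g (Some (r, i))) has_vector_derivative nu i * val z i s + K * val ?f i s) (at s within {0..})"
    if "0 \<le> s" for i s
  proof -
    have "(val ?f i has_vector_derivative nu i * val z i s + K * val ?f i s) (at s within {0..})"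
      using gen that by (simp add: genT_iff_deriv has_real_derivative_iff_has_vector_derivative)
    then show ?thesis
      by (rule has_vector_derivative_transform[rotated 2]) (use that in \<open>auto simp: val_def c0_of_inverse'[OF g]\<close>)
  qed
  show dds: "dds A g (Some (s, i)) = nu i * val z i s + K * val ?f i s" if "i \<in> A" "0 \<le> s" for i s
    using that vector_derivative_within[OF at_within_Ici_neq_bot[OF that(2)] der[OF that(2)]]
    by (simp add: dds_def)
  define w where "w = mk (\<lambda>i s. nu i * val z i s + K * val ?f i s)"
  have w: "val w i s = nu i * val z i s + K * val ?f i s" if "0 \<le> s" for i s
    unfolding w_def
  proof (rule val_mk[OF _ _ that])
    fix i
    show "continuous_on {0..} (\<lambda>s. nu i * val z i s + K * val ?f i s)" by (intro continuous_intros)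
    have "((\<lambda>s. nu i * val z i s + K * val ?f i s) \<longlongrightarrow> nu i * 0 + K * 0) at_top"
      by (intro tendsto_intros val_lim)
    then show "((\<lambda>s. nu i * val z i s + K * val ?f i s) \<longlongrightarrow> 0) at_top" by simp
  qed
  have "dds A g x = fn_of (restr A w) x" for x
  proof (cases x)
    case (Some p)
    then show ?thesis using dds w by (cases p) (auto simp: fn_of_Some dds_def)
  qed (simp add: dds_def)
  then have "dds A g = fn_of (restr A w)" by (rule ext)
  moreover have "restr A (restr A w) = restr A w" by (rule c0_eqI) simp
  ultimately have "dds A g \<in> C0 A" by (simp add: C0_restr_iff)
  moreover have "(\<lambda>r. g (Some (r, i))) differentiable (at s within {0..})" if "0 \<le> s" for i s
    using der[OF that] differentiableI_vector by blast
  ultimately show "g \<in> C01 A" using g by (auto simp: C01_def)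
qed

end

section \<open>The Riccati equation\<close>

context generator_family
begin

lemma T_decay:
  assumes k: "0 \<le> k" and h: "0 \<le> h"
  shows "norm (T k h f) \<le> exp (- k * (h / Max (range nu))) * norm f"
proof (rule norm_c0_le)
  fix i and s :: real assume s: "0 \<le> s"
  have le: "nu i \<le> Max (range nu)" by (rule Max_ge) (rule finite_imageI[OF finite], rule rangeI)
  have "h / Max (range nu) \<le> h / nu i"
    by (rule divide_left_mono[OF le h]) (rule mult_pos_pos[OF less_le_trans[OF nu_pos le] nu_pos])
  from mult_left_mono[OF this k]
  have "exp (- k * (h / nu i)) \<le> exp (- k * (h / Max (range nu)))" by simp
  then show "\<bar>val (T k h f) i s\<bar> \<le> exp (- k * (h / Max (range nu))) * norm f"
    unfolding val_T[OF k s h] abs_mult by (intro mult_mono abs_val_le) auto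
qed simp

end

context first_passage
begin

text \<open>
  On functions \<open>f\<close> on \<open>A\<close> this is the quadratic expression
  \<open>P\<^sub>-\<^sub>+ + P\<^sub>-\<^sub>- R + R P\<^sub>+\<^sub>+ + R P\<^sub>+\<^sub>- R\<close> in the blocks of the jump operator, with \<open>+\<close> for \<open>A\<close> and
  \<open>-\<close> for its complement.
\<close>

definition riccati_rhs :: "('e c0 \<Rightarrow>\<^sub>L 'e c0) \<Rightarrow> 'e c0 \<Rightarrow> 'e c0" where
  "riccati_rhs R f = PB (P (PA f + R f)) + R (PA (P (PA f + R f)))"

definition mild_riccati :: "real \<Rightarrow> ('e c0 \<Rightarrow>\<^sub>L 'e c0) \<Rightarrow> bool" where
  "mild_riccati k R \<longleftrightarrow> (\<forall>h\<ge>0. \<forall>f.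
     T k h (R (T k h f)) - R f = - integral {0..h} (\<lambda>r. T k r (riccati_rhs R (T k r f))))"

lemma riccati_rhs_cont: "continuous_on X g \<Longrightarrow> continuous_on X (\<lambda>x. riccati_rhs R (g x))"
  unfolding riccati_rhs_def by (intro continuous_on_add continuous_on_blinfun_const)

text \<open>
  The Riccati equation says that \<open>r \<mapsto> T r R T r g\<close> has derivative \<open>- T r (riccati_rhs R (T r g))\<close> for \<open>g\<close> in the domain of
  the generator. Integration removes the derivative, and density extends the result to all \<open>f\<close>.
\<close>

lemma riccati_mild:
  fixes R :: "'e c0 \<Rightarrow>\<^sub>L 'e c0"
  assumes R: "\<And>f. R (PA f) = R f"
    and ric: "\<And>g z. PA g = g \<Longrightarrow> genT g z \<Longrightarrow>
      genT (R g) (- PB (P (g + R g)) - R (z + PA (P (g + R g))))"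
  shows "mild_riccati K R"
  unfolding mild_riccati_def
proof (intro allI impI)
  fix h :: real and f assume h: "0 \<le> h"
  interpret contraction_semigroup "T K" by (rule T_semigroup[OF K0])
  define E where "E f = T K h (R (T K h f)) - R f + integral {0..h} (\<lambda>r. T K r (riccati_rhs R (T K r f)))" for f
  have dom: "E g = 0" if g: "PA g = g" and gz: "gen g z" for g z
  proof -
    have "((\<lambda>r. T K r (R (T K r g))) has_vector_derivative - T K r (riccati_rhs R (T K r g))) (at r within {0..h})"
      if r: "0 \<le> r" for r
    proof -
      have y: "((\<lambda>r. R (T K r g)) has_vector_derivative R (T K r z)) (at r within {0..})"
        by (rule bounded_linear.has_vector_derivative[OF blinfun.bounded_linear_right gen_orbit_deriv[OF gz r]])
      have PA: "PA (T K r g) = T K r g" by (simp add: T_restr K0 g)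
      have "((\<lambda>r. T K r (R (T K r g))) has_vector_derivative
          T K r (- PB (P (T K r g + R (T K r g))) - R (T K r z + PA (P (T K r g + R (T K r g)))) + R (T K r z)))
          (at r within {0..})"
        by (rule product_deriv[OF y ric[OF PA gen_orbit[OF gz r]] r])
      also have "- PB (P (T K r g + R (T K r g))) - R (T K r z + PA (P (T K r g + R (T K r g)))) + R (T K r z)
          = - riccati_rhs R (T K r g)"
        by (simp add: riccati_rhs_def PA blinfun.add_right)
      finally show ?thesis
        unfolding blinfun.minus_right by (rule has_vector_derivative_within_subset) auto
    qed
    then have "((\<lambda>r. - T K r (riccati_rhs R (T K r g))) has_integral
        T K h (R (T K h g)) - T K 0 (R (T K 0 g))) {0..h}"
      by (intro fundamental_theorem_of_calculus h) auto
    from integral_unique[OF this] have "T K h (R (T K h g)) - R g = - integral {0..h} (\<lambda>r. T K r (riccati_rhs R (T K r g)))"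
      by simp
    then show ?thesis unfolding E_def by (simp only: left_minus)
  qed
  have "continuous_on UNIV (\<lambda>(f, r). T K r (riccati_rhs R (T K r f)))"
    unfolding split_def by (intro T_cont riccati_rhs_cont continuous_intros)
  then have Ec: "continuous_on UNIV E"
    unfolding E_def
    by (intro continuous_on_add continuous_on_diff integral_continuous_param T_cont
        continuous_on_blinfun_const continuous_on_const continuous_on_id)
  have "E (PA f) = 0"
  proof (rule tendsto_unique)
    let ?a = "\<lambda>h. integral {0..h} (\<lambda>r. T K r (PA f)) /\<^sub>R h"
    show "((\<lambda>h. E (?a h)) \<longlongrightarrow> E (PA f)) (at_right 0)"
      by (rule isCont_tendsto_compose[OF _ gen_dense]) (use Ec in \<open>simp add: continuous_on_eq_continuous_at\<close>)
    have "E (?a u) = 0" if "0 < u" for u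
    proof (rule dom)
      have "PA (integral {0..u} (\<lambda>r. T K r (PA f))) = integral {0..u} (\<lambda>r. T K r (PA (PA f)))"
        by (subst blinfun_integral) (auto intro!: T_cont continuous_on_id continuous_on_const simp: T_restr K0)
      also have "PA (PA f) = PA f" by (rule c0_eqI) simp
      finally show "PA (?a u) = ?a u" by (simp add: blinfun.scaleR_right)
      show "gen (?a u) ((T K u (PA f) - PA f) /\<^sub>R u)"
        by (rule gen_scale[OF gen_average]) (use that in simp)
    qed
    then show "((\<lambda>h. E (?a h)) \<longlongrightarrow> 0) (at_right 0)"
      by (intro tendsto_eventually) (auto simp: eventually_at_filter)
  qed simp
  moreover have "E (PA f) = E f"
  proof -
    have "R (T K r (PA f)) = R (T K r f)" for r using R[of "T K r f"] by (simp add: T_restr K0)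
    moreover have "riccati_rhs R (T K r (PA f)) = riccati_rhs R (T K r f)" for r
    proof -
      have "PA (PA (T K r f)) = PA (T K r f)" by (rule c0_eqI) simp
      then have "riccati_rhs R (PA (T K r f)) = riccati_rhs R (T K r f)" by (simp add: riccati_rhs_def R)
      then show ?thesis by (simp add: T_restr K0)
    qed
    ultimately show ?thesis by (simp add: E_def R)
  qed
  ultimately have "E f = 0" by simp
  then show "T K h (R (T K h f)) - R f = - integral {0..h} (\<lambda>r. T K r (riccati_rhs R (T K r f)))"
    by (simp add: E_def eq_neg_iff_add_eq_0)
qed

definition causal :: "real \<Rightarrow> ('e c0 \<Rightarrow>\<^sub>L 'e c0) \<Rightarrow> bool" where
  "causal N R \<longleftrightarrow> (\<forall>g s c. 0 \<le> s \<longrightarrow> (\<forall>j t. s \<le> t \<longrightarrow> \<bar>val g j t\<bar> \<le> c) \<longrightarrow> (\<forall>i. \<bar>val (R g) i s\<bar> \<le> N * c))"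

text \<open>
  The conjugate \<open>e\<^sup>a\<^sup>s R e\<^sup>-\<^sup>a\<^sup>s\<close>. Causality lets \<open>R\<close> see only times \<open>t \<ge> s\<close>, where \<open>e\<^sup>-\<^sup>a\<^sup>t \<le> e\<^sup>-\<^sup>a\<^sup>s\<close>;
  this compensates the factor \<open>e\<^sup>a\<^sup>s\<close> and makes the bound independent of \<open>a\<close>.
\<close>

lemma causal_conj:
  fixes R :: "'e c0 \<Rightarrow>\<^sub>L 'e c0"
  assumes R: "causal N R" and N: "0 \<le> N" and a: "0 \<le> a"
  shows "\<exists>R' :: 'e c0 \<Rightarrow>\<^sub>L 'e c0. (\<forall>f. damp a (blinfun_apply R' f) = R (damp a f)) \<and> norm R' \<le> N"
proof -
  let ?p = "\<lambda>f i s. exp (a * s) * val (R (damp a f)) i s"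
  have le: "\<bar>?p f i s\<bar> \<le> N * c" if s: "0 \<le> s" and c: "\<And>j t. s \<le> t \<Longrightarrow> \<bar>val f j t\<bar> \<le> c" for f i s c
  proof -
    have "\<bar>val (damp a f) j t\<bar> \<le> exp (- a * s) * c" if "s \<le> t" for j t
    proof -
      have "exp (- a * t) \<le> exp (- a * s)" using mult_left_mono[OF that a] by simp
      then show ?thesis using s that a c[OF that] by (simp add: val_damp abs_mult mult_mono)
    qed
    then have "\<bar>val (R (damp a f)) i s\<bar> \<le> N * (exp (- a * s) * c)"
      using R s unfolding causal_def by blast
    then have "exp (a * s) * \<bar>val (R (damp a f)) i s\<bar> \<le> exp (a * s) * (N * (exp (- a * s) * c))"
      by (rule mult_left_mono) simp
    also have "\<dots> = N * c" by (simp add: exp_minus)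
    finally show ?thesis by (simp add: abs_mult)
  qed
  have 1: "continuous_on {0..} (?p f i)" for f i by (intro continuous_intros)
  have 2: "(?p f i \<longlongrightarrow> 0) at_top" for f i
  proof (rule tendstoI)
    fix e :: real assume e: "e > 0"
    define e' where "e' = e / (2 * (N + 1))"
    have e': "0 < e'" using e N by (simp add: e'_def)
    have "\<exists>M. \<forall>s\<ge>M. \<bar>val f j s\<bar> < e'" for j
      using e' tendstoD[OF val_lim, of e' f j] by (simp add: eventually_at_top_linorder)
    then obtain M where M: "\<And>j s. s \<ge> M j \<Longrightarrow> \<bar>val f j s\<bar> < e'" by metis
    have "\<bar>?p f i s\<bar> < e" if s: "s \<ge> max 0 (Max (range M))" for s
    proof -
      have "M j \<le> s" for j
      proof -
        have "M j \<le> Max (range M)" by (rule Max_ge) (rule finite_imageI[OF finite], rule rangeI)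
        then show ?thesis using s by simp
      qed
      then have "\<bar>?p f i s\<bar> \<le> N * e'"
        using s M by (intro le) (auto intro!: less_imp_le[OF M] intro: order_trans)
      also have "N * e' < (N + 1) * e'" using e' by simp
      also have "(N + 1) * e' = e / 2"
      proof -
        have "N + 1 \<noteq> 0" using N by simp
        then show ?thesis unfolding e'_def by (simp add: divide_simps)
      qed
      finally show ?thesis using e by simp
    qed
    then show "\<forall>\<^sub>F s in at_top. dist (?p f i s) 0 < e"
      unfolding eventually_at_top_linorder dist_real_def by (intro exI[of _ "max 0 (Max (range M))"]) simp
  qed
  have 3: "\<bar>?p f i s\<bar> \<le> N * norm f" if "0 \<le> s" for f i s
    by (rule le[OF that abs_val_le])
  define R' :: "'e c0 \<Rightarrow>\<^sub>L 'e c0" where "R' = Blinfun (\<lambda>f. mk (?p f))"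
  have v: "val (R' f) i s = ?p f i s" if "0 \<le> s" for f i s
    unfolding R'_def by (rule pointwise_operator(1)[OF 1 2 _ _ 3 that])
      (auto simp: blinfun.add_right blinfun.scaleR_right algebra_simps)
  have n: "norm (R' f) \<le> N * norm f" for f
    unfolding R'_def by (rule pointwise_operator(2)[OF 1 2 _ _ 3 N])
      (auto simp: blinfun.add_right blinfun.scaleR_right algebra_simps)
  have "damp a (R' f) = R (damp a f)" for f
    by (rule c0_eqI) (simp add: val_damp a v exp_minus)
  moreover have "norm R' \<le> N" by (rule norm_blinfun_bound[OF N n])
  ultimately show ?thesis by blast
qed

lemma mild_riccati_conj:
  fixes R R' :: "'e c0 \<Rightarrow>\<^sub>L 'e c0"
  assumes R: "mild_riccati K R" and R': "\<And>f. damp a (R' f) = R (damp a f)" and a: "0 \<le> a"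
  shows "mild_riccati (K + a) R'"
  unfolding mild_riccati_def
proof (intro allI impI)
  fix h :: real and f assume h: "0 \<le> h"
  have Ka: "0 \<le> K + a" using K0 a by simp
  have riccati_rhs: "damp a (riccati_rhs R' f) = riccati_rhs R (damp a f)" for f
    by (simp add: riccati_rhs_def blinfun.add_right R' damp_restr a P_damp)
  have i: "damp a (integral {0..h} (\<lambda>r. T (K + a) r (riccati_rhs R' (T (K + a) r f)))) =
      integral {0..h} (\<lambda>r. T K r (riccati_rhs R (T K r (damp a f))))"
    by (subst blinfun_integral)
      (auto intro!: T_cont riccati_rhs_cont continuous_on_id continuous_on_const Ka simp: T_damp K0 a riccati_rhs)
  show "T (K + a) h (R' (T (K + a) h f)) - R' f = - integral {0..h} (\<lambda>r. T (K + a) r (riccati_rhs R' (T (K + a) r f)))"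
    by (rule damp_inj[OF a], unfold blinfun.diff_right blinfun.minus_right T_damp[OF K0 a] R' i)
      (use R h in \<open>simp add: mild_riccati_def\<close>)
qed

text \<open>
  The difference \<open>D\<close> of two solutions satisfies \<open>\<parallel>D\<parallel> \<le> (q + h C) \<parallel>D\<parallel>\<close>, where \<open>q\<close> bounds \<open>T h\<close> and \<open>C\<close> is a
  Lipschitz constant of the quadratic term on the ball of radius \<open>N\<close>. A small \<open>h\<close> controls the second part, and then
  a large killing rate \<open>a\<close> the first.
\<close>

lemma mild_riccati_unique:
  assumes N: "0 \<le> N"
  shows "\<exists>a\<ge>0. \<forall>R1 R2. mild_riccati (K + a) R1 \<longrightarrow> mild_riccati (K + a) R2 \<longrightarrow>
    norm R1 \<le> N \<longrightarrow> norm R2 \<le> N \<longrightarrow> R1 = R2"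
proof -
  define p where "p = K / Min (range nu)"
  define C where "C = p + p * (1 + N) + N * p"
  have p: "0 < p" unfolding p_def using K_pos nu_pos by (intro divide_pos_pos) auto
  then have C: "0 < C" using N by (simp add: C_def add_pos_pos add_pos_nonneg)
  \<comment> \<open>with this \<open>h\<close> the quadratic term contributes the factor \<open>h C = 1/4\<close>\<close>
  define h where "h = 1 / (4 * C)"
  have h: "0 < h" using C by (simp add: h_def)
  have "nu undefined \<le> Max (range nu)"
    by (rule Max_ge) (rule finite_imageI[OF finite], rule rangeI)
  with nu_pos have m: "0 < Max (range nu)" by (rule less_le_trans)
  \<comment> \<open>\<open>T (K + a) h\<close> has norm at most \<open>e\<^sup>-\<^sup>a\<^sup>h\<^sup>/\<^sup>M \<le> e\<^sup>-\<^sup>1\<close> with \<open>M = Max (range nu)\<close>\<close>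
  define a where "a = Max (range nu) / h"
  have a: "0 < a" using m h by (simp add: a_def)
  have "R1 = R2" if mr: "mild_riccati (K + a) R1" "mild_riccati (K + a) R2" and n: "norm R1 \<le> N" "norm R2 \<le> N" for R1 R2
  proof -
    have Ka: "0 \<le> K + a" using K_pos a by simp
    define D where "D = R1 - R2"
    have D: "D f = R1 f - R2 f" for f by (simp add: D_def blinfun.diff_left)
    have nb: "norm (R f) \<le> M * norm f" if "norm R \<le> M" for R :: "'e c0 \<Rightarrow>\<^sub>L 'e c0" and f M
      using norm_blinfun[of R f] mult_right_mono[OF that norm_ge_zero[of f]] by linarith
    have P: "norm (restr X (P f)) \<le> p * norm f" for X f
      using norm_restr[of X "P f"] norm_P[of f] unfolding p_def by linarith
    have riccati_rhs: "norm (riccati_rhs R1 f - riccati_rhs R2 f) \<le> C * norm D * norm f" for f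
    proof -
      have "riccati_rhs R1 f - riccati_rhs R2 f = PB (P (D f)) + D (PA (P (PA f + R1 f))) + R2 (PA (P (D f)))"
        by (simp add: riccati_rhs_def D blinfun.add_right blinfun.diff_right algebra_simps)
      also have "norm \<dots> \<le> norm (PB (P (D f))) + norm (D (PA (P (PA f + R1 f)))) + norm (R2 (PA (P (D f))))"
        by (intro norm_triangle_le add_mono order_refl norm_triangle_ineq)
      also have "norm (PB (P (D f))) \<le> p * (norm D * norm f)"
        using P[of "- A" "D f"] mult_left_mono[OF norm_blinfun[of D f] less_imp_le[OF p]] by linarith
      also have "norm (D (PA (P (PA f + R1 f)))) \<le> norm D * (p * ((1 + N) * norm f))"
      proof -
        have "norm (PA f + R1 f) \<le> (1 + N) * norm f"
          using norm_triangle_ineq[of "PA f" "R1 f"] norm_restr[of A f] nb[OF n(1), of f] by (simp add: algebra_simps)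
        from mult_left_mono[OF this less_imp_le[OF p]]
        have "norm (PA (P (PA f + R1 f))) \<le> p * ((1 + N) * norm f)" using P[of A "PA f + R1 f"] by linarith
        from mult_left_mono[OF this norm_ge_zero[of D]] show ?thesis
          using norm_blinfun[of D "PA (P (PA f + R1 f))"] by linarith
      qed
      also have "norm (R2 (PA (P (D f)))) \<le> N * (p * (norm D * norm f))"
      proof -
        have "norm (PA (P (D f))) \<le> p * (norm D * norm f)"
          using P[of A "D f"] mult_left_mono[OF norm_blinfun[of D f] less_imp_le[OF p]] by linarith
        from mult_left_mono[OF this N] show ?thesis using nb[OF n(2), of "PA (P (D f))"] by linarith
      qed
      finally show ?thesis by (simp add: C_def algebra_simps)
    qed
    have "norm (D f) \<le> 3/4 * norm D * norm f" for f
    proof -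
      let ?T = "T (K + a)"
      have c: "continuous_on {0..h} (\<lambda>r. ?T r (riccati_rhs R (?T r f)))" for R
        by (intro T_cont riccati_rhs_cont continuous_on_id continuous_on_const Ka)
      have "D f = ?T h (D (?T h f)) + (integral {0..h} (\<lambda>r. ?T r (riccati_rhs R1 (?T r f))) - integral {0..h} (\<lambda>r. ?T r (riccati_rhs R2 (?T r f))))"
      proof -
        have grp: "b = a + c" if "a - b = - c" for a b c :: "'e c0"
        proof -
          have "b - a = c" using arg_cong[OF that, of uminus] by simp
          then show ?thesis by auto
        qed
        have 1: "R1 f = ?T h (R1 (?T h f)) + integral {0..h} (\<lambda>r. ?T r (riccati_rhs R1 (?T r f)))"
          by (rule grp) (use mr(1) h in \<open>simp add: mild_riccati_def\<close>)
        have 2: "R2 f = ?T h (R2 (?T h f)) + integral {0..h} (\<lambda>r. ?T r (riccati_rhs R2 (?T r f)))"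
          by (rule grp) (use mr(2) h in \<open>simp add: mild_riccati_def\<close>)
        show ?thesis
          unfolding D[of f] D[of "?T h f"] blinfun.diff_right by (subst 1, subst 2) simp
      qed
      also have "integral {0..h} (\<lambda>r. ?T r (riccati_rhs R1 (?T r f))) - integral {0..h} (\<lambda>r. ?T r (riccati_rhs R2 (?T r f)))
          = integral {0..h} (\<lambda>r. ?T r (riccati_rhs R1 (?T r f)) - ?T r (riccati_rhs R2 (?T r f)))"
        by (rule integral_diff[symmetric]) (intro integrable_continuous_real c)+
      finally have "D f = ?T h (D (?T h f)) + integral {0..h} (\<lambda>r. ?T r (riccati_rhs R1 (?T r f)) - ?T r (riccati_rhs R2 (?T r f)))" .
      then have "norm (D f) \<le> norm (?T h (D (?T h f))) + norm (integral {0..h} (\<lambda>r. ?T r (riccati_rhs R1 (?T r f)) - ?T r (riccati_rhs R2 (?T r f))))"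
        by (rule ord_eq_le_trans[OF arg_cong[of _ _ norm] norm_triangle_ineq])
      also have "norm (integral {0..h} (\<lambda>r. ?T r (riccati_rhs R1 (?T r f)) - ?T r (riccati_rhs R2 (?T r f)))) \<le> C * norm D * norm f * (h - 0)"
      proof (rule integral_bound)
        fix r assume "r \<in> {0..h}"
        have "norm (?T r (riccati_rhs R1 (?T r f)) - ?T r (riccati_rhs R2 (?T r f))) \<le> norm (riccati_rhs R1 (?T r f) - riccati_rhs R2 (?T r f))"
          using norm_T[OF Ka] by (simp flip: blinfun.diff_right)
        also have "\<dots> \<le> C * norm D * norm (?T r f)" by (rule riccati_rhs)
        also have "\<dots> \<le> C * norm D * norm f" using C norm_T[OF Ka] by (intro mult_left_mono) auto
        finally show "norm (?T r (riccati_rhs R1 (?T r f)) - ?T r (riccati_rhs R2 (?T r f))) \<le> C * norm D * norm f" .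
      qed (use h in \<open>auto intro!: continuous_on_diff c\<close>)
      also have "C * norm D * norm f * (h - 0) = 1/4 * norm D * norm f" using C by (simp add: h_def)
      also have "norm (?T h (D (?T h f))) \<le> 1/2 * norm D * norm f"
      proof -
        have "1 + 1 \<le> exp (1::real)" by (rule exp_ge_add_one_self)
        then have e1: "exp (- 1 :: real) \<le> 1/2" by (simp add: exp_minus field_simps)
        have "1 \<le> (K + a) * (h / Max (range nu))"
        proof -
          have "a * (h / Max (range nu)) = 1" using m h by (simp add: a_def)
          moreover have "0 \<le> K * (h / Max (range nu))" using K_pos h m by simp
          ultimately show ?thesis unfolding distrib_right by linarith
        qed
        then have "exp (- (K + a) * (h / Max (range nu))) \<le> exp (- 1)"
          unfolding exp_le_cancel_iff mult_minus_left by linarith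
        with e1 have e: "exp (- (K + a) * (h / Max (range nu))) \<le> 1/2" by linarith
        have "norm (?T h (D (?T h f))) \<le> 1/2 * norm (D (?T h f))"
          using T_decay[OF Ka less_imp_le[OF h], of "D (?T h f)"] mult_right_mono[OF e norm_ge_zero[of "D (?T h f)"]] by linarith
        also have "norm (D (?T h f)) \<le> norm D * norm f"
          using norm_blinfun[of D "?T h f"] mult_left_mono[OF norm_T[OF Ka, of h f] norm_ge_zero[of D]] by linarith
        finally show ?thesis by simp
      qed
      finally show ?thesis by (simp add: algebra_simps)
    qed
    then have "norm D \<le> 3/4 * norm D" by (intro norm_blinfun_bound) auto
    then have "D = 0" by simp
    then show ?thesis by (simp add: D_def)
  qed
  then show ?thesis using a by (intro exI[of _ a]) auto
qed

lemma riccati_unique: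
  assumes "0 \<le> N"
    and 1: "mild_riccati K R1" "causal N R1" and 2: "mild_riccati K R2" "causal N R2"
  shows "R1 = R2"
proof -
  obtain a where a: "0 \<le> a" and u: "\<And>R1 R2. mild_riccati (K + a) R1 \<Longrightarrow> mild_riccati (K + a) R2 \<Longrightarrow>
    norm R1 \<le> N \<Longrightarrow> norm R2 \<le> N \<Longrightarrow> R1 = R2"
    using mild_riccati_unique[OF assms(1)] by blast
  obtain R1' :: "'e c0 \<Rightarrow>\<^sub>L 'e c0" where R1': "\<And>f. damp a (R1' f) = R1 (damp a f)" "norm R1' \<le> N"
    using causal_conj[OF 1(2) assms(1) a] by blast
  obtain R2' :: "'e c0 \<Rightarrow>\<^sub>L 'e c0" where R2': "\<And>f. damp a (R2' f) = R2 (damp a f)" "norm R2' \<le> N"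
    using causal_conj[OF 2(2) assms(1) a] by blast
  have "R1' = R2'"
    by (rule u[OF mild_riccati_conj[OF 1(1) R1'(1) a] mild_riccati_conj[OF 2(1) R2'(1) a] R1'(2) R2'(2)])
  then have eq: "R1 (damp a f) = R2 (damp a f)" for f using R1'(1) R2'(1) by metis
  show ?thesis
  proof (rule blinfun_eqI)
    fix g
    show "R1 g = R2 g"
      by (rule eq_on_damp_range[where F = "blinfun_apply R1" and G = "blinfun_apply R2", OF a _ _ eq])
        (intro continuous_on_blinfun_const continuous_on_id)+
  qed
qed

end

section \<open>Existence for one sign\<close>

lemma Cc_subset_C0: "g \<in> Cc A \<Longrightarrow> g \<in> C0 A"
proof -
  assume g: "g \<in> Cc A"
  have "((\<lambda>s. g (Some (s, i))) \<longlongrightarrow> 0) at_top" if i: "i \<in> A" for i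
  proof -
    have "compact (section_supp g i)" using g i by (auto simp: Cc_def)
    then obtain b where b: "\<And>s. s \<in> section_supp g i \<Longrightarrow> \<bar>s\<bar> \<le> b"
      using compact_imp_bounded bounded_iff by (metis real_norm_def)
    have "g (Some (s, i)) = 0" if "s \<ge> max 0 (b + 1)" for s
    proof (rule ccontr)
      assume "g (Some (s, i)) \<noteq> 0"
      then have "s \<in> section_supp g i"
        unfolding section_supp_def using that by (intro subsetD[OF closure_subset]) auto
      from b[OF this] that show False by simp
    qed
    then have "\<forall>\<^sub>F s in at_top. g (Some (s, i)) = 0" unfolding eventually_at_top_linorder by blast
    then show ?thesis by (rule tendsto_eventually)
  qed
  then show ?thesis using g by (auto simp: Cc_def C0_def)
qed

lemma supp_subset_strip_iff:
  "supp A g \<subseteq> {0..\<eta>} \<times> A \<longleftrightarrow> (\<forall>i\<in>A. \<forall>s\<ge>0. \<eta> < s \<longrightarrow> g (Some (s, i)) = 0)"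
proof
  assume l: "supp A g \<subseteq> {0..\<eta>} \<times> A"
  show "\<forall>i\<in>A. \<forall>s\<ge>0. \<eta> < s \<longrightarrow> g (Some (s, i)) = 0"
  proof (intro ballI allI impI, rule ccontr)
    fix i and s :: real assume i: "i \<in> A" "0 \<le> s" "\<eta> < s" "g (Some (s, i)) \<noteq> 0"
    then have "s \<in> section_supp g i"
      unfolding section_supp_def by (intro subsetD[OF closure_subset]) auto
    then have "(s, i) \<in> supp A g" using i by (simp add: supp_def)
    then show False using l i by auto
  qed
next
  assume r: "\<forall>i\<in>A. \<forall>s\<ge>0. \<eta> < s \<longrightarrow> g (Some (s, i)) = 0"
  have "section_supp g i \<subseteq> {0..\<eta>}" if "i \<in> A" for i
    unfolding section_supp_def
  proof (rule closure_minimal)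
    show "{s. 0 \<le> s \<and> g (Some (s, i)) \<noteq> 0} \<subseteq> {0..\<eta>}" using r that by (auto simp: not_less[symmetric])
  qed simp
  then show "supp A g \<subseteq> {0..\<eta>} \<times> A" by (auto simp: supp_def)
qed

lemma c0_of_add: "f \<in> C0 A \<Longrightarrow> g \<in> C0 A \<Longrightarrow> c0_of (\<lambda>x. f x + g x) = c0_of f + c0_of g"
  using c0_of_inverse'[OF C0_add, of f A g] by (simp add: fn_of_add c0_of_inverse' flip: fn_of_inject)

lemma c0_of_scale: "f \<in> C0 A \<Longrightarrow> c0_of (\<lambda>x. c * f x) = c *\<^sub>R c0_of f"
  using c0_of_inverse'[OF C0_scale, of f A c] by (simp add: fn_of_scaleR c0_of_inverse' flip: fn_of_inject)

lemma bounded_operator_lift: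
  assumes L: "bounded_linear L" and B: "\<And>f. restr A f = f \<Longrightarrow> restr B (L f) = L f"
    and eq: "\<And>g. g \<in> C0 A \<Longrightarrow> W g = fn_of (L (c0_of g))"
  shows "bounded_operator A B W"
proof -
  interpret L: bounded_linear L by (rule L)
  have 1: "W g \<in> C0 B" if "g \<in> C0 A" for g
    using that B[OF restr_c0_of[OF that]] by (simp add: eq C0_restr_iff)
  obtain M where M: "\<And>f. norm (L f) \<le> norm f * M" using L.bounded by blast
  have "supnorm B (W g) \<le> M * supnorm A g" if g: "g \<in> C0 A" for g
    using M[of "c0_of g"] supnorm_fn_of[OF restr_c0_of[OF g]] supnorm_fn_of[OF B[OF restr_c0_of[OF g]]]
    by (simp add: eq g c0_of_inverse'[OF g] mult.commute)
  then show ?thesis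
    unfolding bounded_operator_def
    using 1 by (auto simp: eq C0_add C0_scale c0_of_add c0_of_scale L.add L.scaleR fn_of_simps)
qed

context first_passage
begin

text \<open>
  With \<open>W\<close> for \<open>S\<close>: the part of the operator equation that involves one sign only.
\<close>

definition half_equation :: "'e oper \<Rightarrow> 'e oper \<Rightarrow> bool" where
  "half_equation W H \<longleftrightarrow> (\<forall>g\<in>C01 A. \<forall>i. \<forall>s\<ge>0.
     (i \<in> A \<longrightarrow> H g (Some (s, i)) =
        (dds A g (Some (s, i)) + (\<Sum>j\<in>UNIV. Lam s $ i $ j * (g (Some (s, j)) + W g (Some (s, j))))) / nu i) \<and>
     (i \<notin> A \<longrightarrow> W (H g) (Some (s, i)) =
        - (dds (- A) (W g) (Some (s, i)) + (\<Sum>j\<in>UNIV. Lam s $ i $ j * (g (Some (s, j)) + W g (Some (s, j))))) / nu i))"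

text \<open>
  The fictitious jumps added in \<open>rate\<close> contribute the multiple \<open>K\<close> of the identity.
\<close>

lemma val_P_Lam:
  assumes "0 \<le> s"
  shows "nu i * val (P f) i s = (\<Sum>j\<in>UNIV. Lam s $ i $ j * val f j s) + K * val f i s"
proof -
  have "(\<Sum>j\<in>UNIV. rate s i j * val f j s) =
    (\<Sum>j\<in>UNIV. Lam s $ i $ j * val f j s) + (\<Sum>j\<in>UNIV. if i = j then K * val f j s else 0)"
    unfolding sum.distrib[symmetric] using assms by (intro sum.cong) (auto simp: rate_def algebra_simps)
  then show ?thesis using assms nu_pos[of i] by (simp add: val_P)
qed

lemma genT_restr: "genT f z \<Longrightarrow> genT (restr X f) (restr X z)"
  unfolding contraction_semigroup.gen_def[OF T_semigroup[OF K0]]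
  by (drule bounded_linear.tendsto[OF blinfun.bounded_linear_right[of "restr X"]])
    (simp add: blinfun.scaleR_right blinfun.diff_right T_restr K0)

lemma genT_restr_eq: "restr X f = f \<Longrightarrow> genT f z \<Longrightarrow> restr X z = z"
  using genT_restr[of f z X] contraction_semigroup.gen_unique[OF T_semigroup[OF K0]] by metis

lemma val_zero_outside: "restr X f = f \<Longrightarrow> i \<notin> X \<Longrightarrow> val f i s = 0"
  by (metis val_restr)

lemma restr_S: "PB (S f) = S f"
  unfolding S_def by (rule c0_eqI) simp

lemma restr_Q: "PA (Q l f) = Q l f"
  unfolding Q_def by (rule c0_eqI) simp

definition Sop :: "'e oper" where
  "Sop = restrict (\<lambda>g. fn_of (S (c0_of g))) (C0 A)"

definition Qop :: "real \<Rightarrow> 'e oper" where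
  "Qop l g = fn_of (Q l (c0_of g))"

definition Hop :: "'e oper" where
  "Hop = restrict (\<lambda>g. fn_of (THE y. genQ (c0_of g) y)) (C01 A)"

lemma Sop_C0: "g \<in> C0 A \<Longrightarrow> Sop g = fn_of (S (c0_of g))"
  by (simp add: Sop_def)

lemma C01_C0: "g \<in> C01 X \<Longrightarrow> g \<in> C0 X"
  by (simp add: C01_def)

lemma genQ_unique: "genQ f y \<Longrightarrow> genQ f y' \<Longrightarrow> y = y'"
  unfolding genQ_def by (rule tendsto_unique[rotated]) auto

lemma genQ_restr: "PA f = f \<Longrightarrow> genQ f y \<Longrightarrow> PA y = y"
proof -
  assume f: "PA f = f" "genQ f y"
  have "((\<lambda>h. PA ((Q h f - f) /\<^sub>R h)) \<longlongrightarrow> PA y) (at_right 0)"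
    by (rule bounded_linear.tendsto[OF blinfun.bounded_linear_right f(2)[unfolded genQ_def]])
  then have "genQ f (PA y)"
    unfolding genQ_def by (simp add: blinfun.scaleR_right blinfun.diff_right restr_Q f(1))
  then show "PA y = y" using genQ_unique f(2) by blast
qed

lemma Hop_genQ:
  assumes g: "g \<in> C01 A"
  shows "\<exists>z y. genT (c0_of g) z \<and> genQ (c0_of g) y \<and> y = z + PA (P (c0_of g + S (c0_of g))) \<and> Hop g = fn_of y"
proof -
  let ?f = "c0_of g"
  have f: "PA ?f = ?f" using g by (intro restr_c0_of C01_C0)
  obtain z where z: "genT ?f z" using C01_gen[OF g] by blast
  let ?y = "z + PA (P (?f + S ?f))"
  have y: "genQ ?f ?y" using z genQ_iff[OF f] by (simp add: passage_0_eq[OF f])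
  then have "(THE y. genQ ?f y) = ?y" using genQ_unique by blast
  then show ?thesis using z y g by (auto simp: Hop_def)
qed

lemma admissible_Sop: "admissible_S A (- A) Sop"
  unfolding admissible_S_def
proof (intro conjI ballI allI impI)
  show "Sop \<in> C0 A \<rightarrow>\<^sub>E C0 (- A)"
    by (auto simp: Sop_def C0_restr_iff restr_S)
  show "bounded_operator A (- A) Sop"
    by (rule bounded_operator_lift[OF S_bounded_linear]) (simp_all add: restr_S Sop_C0)
  show "Sop g \<in> C01 (- A)" if g: "g \<in> C01 A" for g
  proof -
    let ?f = "c0_of g"
    have f: "PA ?f = ?f" using g by (intro restr_c0_of C01_C0)
    obtain y where "genQ ?f y" using Hop_genQ[OF g] by blast
    from S_gen[OF f this] have "genT (c0_of (fn_of (S ?f))) (- S y - PB (P (passage ?f 0)))"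
      by (simp add: fn_of_inverse)
    then have "fn_of (S ?f) \<in> C01 (- A)" by (intro gen_C01) (simp add: C0_restr_iff restr_S)
    then show ?thesis using g by (simp add: Sop_C0 C01_C0)
  qed
  fix g \<eta> assume g: "g \<in> Cc A" and \<eta>: "(0::real) < \<eta>" and s: "supp A g \<subseteq> {0..\<eta>} \<times> A"
  note g0 = Cc_subset_C0[OF g]
  have z: "val (c0_of g) j t = 0" if "j \<in> A" "\<eta> < t" for j t
    using s that \<eta> unfolding supp_subset_strip_iff by (simp add: val_def c0_of_inverse'[OF g0])
  show "supp (- A) (Sop g) \<subseteq> {0..\<eta>} \<times> (- A)"
    unfolding supp_subset_strip_iff
    using passage_support[of \<eta> "c0_of g", OF z] by (auto simp: Sop_C0 g0 fn_of_Some S_def)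
qed

lemma semigroup_Qop: "sc_pos_contr_semigroup A Qop"
  unfolding sc_pos_contr_semigroup_def
proof (intro conjI allI ballI impI)
  fix l assume "(0::real) \<le> l"
  have "bounded_linear (Q l)"
    unfolding Q_def
    by (rule bounded_linear_intro[where K = 1])
      (auto simp: blinfun.add_right blinfun.scaleR_right plus_bcontfun.rep_eq scaleR_bcontfun.rep_eq
        intro: order_trans[OF norm_restr passage_norm])
  then show "bounded_operator A A (Qop l)"
    by (rule bounded_operator_lift) (simp_all add: restr_Q Qop_def)
next
  fix f assume f: "f \<in> C0 A"
  have F: "PA (c0_of f) = c0_of f" using f by (rule restr_c0_of)
  have Q0: "Q 0 (c0_of f) = c0_of f" using F passage_zero[of "c0_of f"] by (simp add: Q_def)
  then show "Qop 0 f = f" by (simp add: Qop_def c0_of_inverse'[OF f])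
  show "((\<lambda>l. supnorm A (\<lambda>x. Qop l f x - f x)) \<longlongrightarrow> 0) (at_right 0)"
  proof -
    have "supnorm A (\<lambda>x. Qop l f x - f x) = norm (Q l (c0_of f) - c0_of f)" for l
    proof -
      have "supnorm A (fn_of (Q l (c0_of f) - c0_of f)) = norm (Q l (c0_of f) - c0_of f)"
        by (rule supnorm_fn_of) (simp add: blinfun.diff_right restr_Q F)
      then show ?thesis by (simp add: fn_of_simps Qop_def c0_of_inverse'[OF f])
    qed
    moreover have "continuous_on UNIV (\<lambda>l. Q l (c0_of f))" by (intro Q_cont continuous_on_const continuous_on_id)
    then have "((\<lambda>l. Q l (c0_of f)) \<longlongrightarrow> Q 0 (c0_of f)) (at_right 0)"
      by (simp add: continuous_on_eq_continuous_at isCont_def filterlim_at_split)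
    then have "((\<lambda>l. norm (Q l (c0_of f) - c0_of f)) \<longlongrightarrow> 0) (at_right 0)"
      unfolding Q0 by (simp add: tendsto_norm_zero LIM_zero)
    ultimately show ?thesis by simp
  qed
next
  fix k l f assume kl: "(0::real) \<le> k" "(0::real) \<le> l" and f: "f \<in> C0 A"
  show "Qop (k + l) f = Qop k (Qop l f)" by (simp add: Qop_def fn_of_inverse Q_add kl)
next
  fix l f x assume l: "(0::real) \<le> l" and f: "f \<in> C0 A" and pos: "\<forall>x. 0 \<le> f x"
  have "0 \<le> val (c0_of f) j t" for j t using pos by (simp add: val_def c0_of_inverse'[OF f])
  then show "0 \<le> Qop l f x"
    by (cases x) (auto simp: Qop_def Q_def fn_of_Some intro!: passage_nonneg)
next
  fix l f assume l: "(0::real) \<le> l" and f: "f \<in> C0 A"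
  have "norm (Q l (c0_of f)) \<le> norm (c0_of f)"
    unfolding Q_def by (rule order_trans[OF norm_restr passage_norm])
  then show "supnorm A (Qop l f) \<le> supnorm A f"
    using supnorm_fn_of[OF restr_Q[of l "c0_of f"]] supnorm_fn_of[OF restr_c0_of[OF f]]
    by (simp add: Qop_def c0_of_inverse'[OF f])
qed

text \<open>
  The pointwise difference quotients are the quotients in the Banach space, and the two norms agree
  on \<open>C0 A\<close>.
\<close>

lemma generator_limit_iff:
  assumes g: "g \<in> C0 A" and h: "h \<in> C0 A"
  shows "generator_limit A Qop g h \<longleftrightarrow> genQ (c0_of g) (c0_of h)"
proof -
  have "supnorm A (\<lambda>x. (Qop l g x - g x) / l - h x) = norm ((Q l (c0_of g) - c0_of g) /\<^sub>R l - c0_of h)" for l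
  proof -
    have "supnorm A (fn_of ((Q l (c0_of g) - c0_of g) /\<^sub>R l - c0_of h)) = norm ((Q l (c0_of g) - c0_of g) /\<^sub>R l - c0_of h)"
      by (rule supnorm_fn_of)
        (simp add: blinfun.diff_right blinfun.scaleR_right restr_Q restr_c0_of[OF g] restr_c0_of[OF h])
    moreover have "fn_of ((Q l (c0_of g) - c0_of g) /\<^sub>R l - c0_of h) = (\<lambda>x. (Qop l g x - g x) / l - h x)"
      by (simp add: fn_of_simps Qop_def c0_of_inverse'[OF g] c0_of_inverse'[OF h] divide_inverse mult.commute)
    ultimately show ?thesis by simp
  qed
  then show ?thesis
    unfolding generator_limit_def genQ_def by (simp add: tendsto_norm_zero_iff LIM_zero_iff)
qed

lemma admissible_Hop: "admissible_H A Hop"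
  unfolding admissible_H_def
proof (intro conjI exI)
  have HC0: "Hop g \<in> C0 A" if "g \<in> C01 A" for g
    using Hop_genQ[OF that] genQ_restr restr_c0_of[OF C01_C0[OF that]] by (auto simp: C0_restr_iff)
  then show "Hop \<in> C01 A \<rightarrow>\<^sub>E C0 A" by (auto simp: Hop_def)
  show "sc_pos_contr_semigroup A Qop" by (rule semigroup_Qop)
  have lim: "generator_limit A Qop g (Hop g)" if g: "g \<in> C01 A" for g
    using Hop_genQ[OF g] generator_limit_iff[OF C01_C0[OF g] HC0[OF g]] by (auto simp: fn_of_inverse)
  show "strong_generator A Qop (C01 A) Hop"
    unfolding strong_generator_def
  proof (intro conjI ballI set_eqI iffI)
    fix g assume "g \<in> C01 A"
    then show "g \<in> {g \<in> C0 A. \<exists>h\<in>C0 A. generator_limit A Qop g h}" using lim HC0 C01_C0 by blast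
  next
    fix g assume "g \<in> {g \<in> C0 A. \<exists>h\<in>C0 A. generator_limit A Qop g h}"
    then obtain h where g: "g \<in> C0 A" and h: "h \<in> C0 A" "generator_limit A Qop g h" by blast
    then have "genQ (c0_of g) (c0_of h)" by (simp add: generator_limit_iff)
    then show "g \<in> C01 A" using genQ_iff[OF restr_c0_of[OF g]] gen_C01(1)[OF g] by blast
  qed (use lim HC0 in auto)
qed

text \<open>
  In both equations the term \<open>K\<close> that the jump operator carries in excess of \<open>\<Lambda>\<close> cancels the \<open>-K\<close> in the
  generator of the translation semigroup.
\<close>

lemma half_equation_op: "half_equation Sop Hop"
  unfolding half_equation_def
proof (intro ballI allI impI conjI)
  fix g i and s :: real assume g: "g \<in> C01 A" and s: "0 \<le> s"
  let ?f = "c0_of g"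
  have g0: "g \<in> C0 A" using g by (rule C01_C0)
  have f: "PA ?f = ?f" using g0 by (rule restr_c0_of)
  obtain z y where z: "genT ?f z" and y: "genQ ?f y" and yz: "y = z + PA (P (?f + S ?f))" and H: "Hop g = fn_of y"
    using Hop_genQ[OF g] by blast
  have sum: "(\<Sum>j\<in>UNIV. Lam s $ i $ j * (g (Some (s, j)) + Sop g (Some (s, j)))) =
      (\<Sum>j\<in>UNIV. Lam s $ i $ j * val (?f + S ?f) j s)"
    using s by (simp add: Sop_C0[OF g0] fn_of_Some) (simp add: val_def c0_of_inverse'[OF g0])
  have n: "nu i \<noteq> 0" using nu_pos[of i] by simp
  show "Hop g (Some (s, i)) = (dds A g (Some (s, i)) +
      (\<Sum>j\<in>UNIV. Lam s $ i $ j * (g (Some (s, j)) + Sop g (Some (s, j))))) / nu i" if i: "i \<in> A"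
  proof -
    have "nu i * val y i s = nu i * val z i s + nu i * val (P (?f + S ?f)) i s"
      using i by (simp add: yz algebra_simps)
    also have "\<dots> = dds A g (Some (s, i)) + (\<Sum>j\<in>UNIV. Lam s $ i $ j * val (?f + S ?f) j s)"
      unfolding val_P_Lam[OF s] gen_C01(2)[OF g0 z i s]
      using val_zero_outside[OF restr_S, of i ?f s] i by (simp add: algebra_simps)
    finally show ?thesis unfolding H sum using s n by (simp add: fn_of_Some field_simps)
  qed
  show "Sop (Hop g) (Some (s, i)) = - (dds (- A) (Sop g) (Some (s, i)) +
      (\<Sum>j\<in>UNIV. Lam s $ i $ j * (g (Some (s, j)) + Sop g (Some (s, j))))) / nu i" if i: "i \<notin> A"
  proof -
    have y0: "fn_of y \<in> C0 A" using genQ_restr[OF f y] by (simp add: C0_restr_iff)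
    have S0: "fn_of (S ?f) \<in> C0 (- A)" by (simp add: C0_restr_iff restr_S)
    have "genT (c0_of (fn_of (S ?f))) (- S y - PB (P (?f + S ?f)))"
      using S_gen[OF f y] by (simp add: fn_of_inverse passage_0_eq[OF f])
    from gen_C01(2)[OF S0 this _ s, of i] i
    have "dds (- A) (Sop g) (Some (s, i)) = - nu i * val (S y) i s - nu i * val (P (?f + S ?f)) i s + K * val (S ?f) i s"
      by (simp add: Sop_C0[OF g0] fn_of_inverse algebra_simps)
    then have "dds (- A) (Sop g) (Some (s, i)) = - nu i * val (S y) i s - (\<Sum>j\<in>UNIV. Lam s $ i $ j * val (?f + S ?f) j s)"
      unfolding val_P_Lam[OF s] using val_zero_outside[OF f, of i s] i by (simp add: algebra_simps)
    then show ?thesis unfolding H sum using s n y0 by (simp add: Sop_C0 fn_of_inverse fn_of_Some field_simps)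
  qed
qed

end

section \<open>Uniqueness for one sign\<close>

context first_passage
begin

text \<open>
  An operator on \<open>C0 A\<close> as a bounded operator on the whole space, zero on functions that vanish on \<open>A\<close>.
\<close>

definition lift :: "'e oper \<Rightarrow> 'e c0 \<Rightarrow>\<^sub>L 'e c0" where
  "lift W = Blinfun (\<lambda>f. c0_of (W (fn_of (PA f))))"

lemma fn_of_PA: "fn_of (PA f) \<in> C0 A"
proof -
  have "PA (PA f) = PA f" by (rule c0_eqI) simp
  then show ?thesis by (simp add: C0_restr_iff)
qed

lemma lift:
  assumes W: "admissible_S A (- A) W"
  shows lift_apply: "lift W f = c0_of (W (fn_of (PA f)))"
    and lift_norm: "\<exists>N\<ge>0. \<forall>f. norm (lift W f) \<le> N * norm (PA f)"
proof -
  have b: "bounded_operator A (- A) W" using W by (simp add: admissible_S_def)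
  then have C: "W g \<in> C0 (- A)" if "g \<in> C0 A" for g using that by (simp add: bounded_operator_def)
  obtain M where M: "\<And>g. g \<in> C0 A \<Longrightarrow> supnorm (- A) (W g) \<le> M * supnorm A g"
    using b unfolding bounded_operator_def by blast
  have n: "norm (c0_of (W (fn_of (PA f)))) \<le> max 0 M * norm (PA f)" for f
  proof -
    have "PA (PA f) = PA f" by (rule c0_eqI) simp
    then have "norm (c0_of (W (fn_of (PA f)))) \<le> M * norm (PA f)"
      using M[OF fn_of_PA[of f]] supnorm_fn_of[of A "PA f"] supnorm_fn_of[OF restr_c0_of[OF C[OF fn_of_PA[of f]]]]
      by (simp add: c0_of_inverse'[OF C[OF fn_of_PA]])
    also have "\<dots> \<le> max 0 M * norm (PA f)" by (intro mult_right_mono) auto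
    finally show ?thesis .
  qed
  have "bounded_linear (\<lambda>f. c0_of (W (fn_of (PA f))))"
  proof (rule bounded_linear_intro[where K = "max 0 M"])
    fix f g and c :: real
    have "W (fn_of (PA (f + g))) = (\<lambda>x. W (fn_of (PA f)) x + W (fn_of (PA g)) x)"
      using b fn_of_PA unfolding blinfun.add_right fn_of_add bounded_operator_def by blast
    then show "c0_of (W (fn_of (PA (f + g)))) = c0_of (W (fn_of (PA f))) + c0_of (W (fn_of (PA g)))"
      using c0_of_add[OF C[OF fn_of_PA[of f]] C[OF fn_of_PA[of g]]] by simp
    have "W (fn_of (PA (c *\<^sub>R f))) = (\<lambda>x. c * W (fn_of (PA f)) x)"
      using b fn_of_PA unfolding blinfun.scaleR_right fn_of_scaleR bounded_operator_def by blast
    then show "c0_of (W (fn_of (PA (c *\<^sub>R f)))) = c *\<^sub>R c0_of (W (fn_of (PA f)))"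
      using c0_of_scale[OF C[OF fn_of_PA[of f]]] by simp
    show "norm (c0_of (W (fn_of (PA f)))) \<le> norm f * max 0 M"
      using n[of f] mult_left_mono[OF norm_restr[of A f], of "max 0 M"] by (simp add: mult.commute)
  qed
  then show a: "lift W f = c0_of (W (fn_of (PA f)))" for f
    by (simp add: lift_def bounded_linear_Blinfun_apply)
  show "\<exists>N\<ge>0. \<forall>f. norm (lift W f) \<le> N * norm (PA f)"
    using n by (intro exI[of _ "max 0 M"]) (simp add: a)
qed

lemma lift_C0:
  assumes W: "admissible_S A (- A) W" and g: "g \<in> C0 A"
  shows "lift W (c0_of g) = c0_of (W g)" "fn_of (lift W (c0_of g)) = W g" "W g \<in> C0 (- A)"
proof -
  show C: "W g \<in> C0 (- A)" using W g by (auto simp: admissible_S_def bounded_operator_def)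
  show 1: "lift W (c0_of g) = c0_of (W g)"
    by (simp add: lift_apply[OF W] restr_c0_of[OF g] c0_of_inverse'[OF g])
  show "fn_of (lift W (c0_of g)) = W g"
    unfolding 1 by (rule c0_of_inverse'[OF C])
qed

text \<open>
  Split \<open>g\<close> with a continuous cut-off into a part supported in \<open>[0, s - b]\<close> and a part living after
  \<open>s - 2 b\<close>. By the support condition the first part does not contribute at time \<open>s\<close>. The second is bounded by
  the supremum of \<open>g\<close> after time \<open>s\<close>, up to an error that is small by uniform continuity.
\<close>

lemma lift_causal:
  assumes W: "admissible_S A (- A) W"
  shows "\<exists>N\<ge>0. causal N (lift W)"
proof -
  obtain N where N: "0 \<le> N" "\<And>f. norm (lift W f) \<le> N * norm (PA f)" using lift_norm[OF W] by blast
  have "causal N (lift W)"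
    unfolding causal_def
  proof (intro allI impI)
    fix g :: "'e c0" and s c i
    assume s: "(0::real) \<le> s" and c: "\<forall>j t. s \<le> t \<longrightarrow> \<bar>val g j t\<bar> \<le> c"
    show "\<bar>val (lift W g) i s\<bar> \<le> N * c"
    proof (cases "s = 0")
      case True
      have c0: "0 \<le> c" using c[rule_format, of s i] by linarith
      have "norm (PA g) \<le> c" using c c0 True by (intro norm_c0_le) auto
      then have "norm (lift W g) \<le> N * c" using N(2)[of g] mult_left_mono[OF _ N(1)] order_trans by blast
      then show ?thesis using abs_val_le[of "lift W g" i s] by linarith
    next
      case False
      have c0: "0 \<le> c" using c[rule_format, of s i] by linarith
      show ?thesis
      proof (rule field_le_epsilon)
        fix e :: real assume e: "0 < e"
        \<comment> \<open>\<open>N + 1\<close> instead of \<open>N\<close>, as \<open>N\<close> may vanish\<close>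
        define e' where "e' = e / (N + 1)"
        have e': "0 < e'" "N * e' \<le> e" using e N(1) by (auto simp: e'_def field_simps)
        obtain d where d: "0 < d" "\<And>j u t. \<bar>u - t\<bar> < d \<Longrightarrow> \<bar>val g j u - val g j t\<bar> < e'"
          using val_uniform[OF e'(1), of g] by blast
        define b where "b = min (d / 3) (s / 3)"
        have b: "0 < b" "2 * b < s" "2 * b < d" using d(1) s False by (auto simp: b_def min_def)
        \<comment> \<open>equal to \<open>1\<close> on \<open>[0, s - 2 b]\<close> and to \<open>0\<close> on \<open>[s - b, \<infinity>)\<close>\<close>
        define w where "w t = max 0 (min 1 ((s - b - t) / b))" for t
        have wc: "continuous_on {0..} w" unfolding w_def using b(1) by (intro continuous_intros) auto
        have w01: "0 \<le> w t" "w t \<le> 1" for t by (auto simp: w_def)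
        have w0: "w t = 0" if "s - b \<le> t" for t using that b(1) by (simp add: w_def divide_nonpos_pos)
        have w1: "w t = 1" if "t \<le> s - 2 * b" for t using that b(1) by (simp add: w_def le_divide_eq)
        define g1 where "g1 = mulop (\<lambda>_. w) (PA g)"
        have v1: "val g1 j t = w t * val (PA g) j t" if "0 \<le> t" for j t
          unfolding g1_def using that wc w01 by (intro val_mulop[where c = 1]) auto
        have PA1: "PA g1 = g1" by (rule c0_eqI) (simp add: v1)
        have g1: "fn_of g1 \<in> C0 A" using PA1 by (simp add: C0_restr_iff)
        have z: "fn_of g1 (Some (t, j)) = 0" if "s - b < t" for t j
          using that v1[of t j] w0[of t] by (simp add: fn_of_Some)
        have "fn_of g1 \<in> Cc A"
        proof -
          have "section_supp (fn_of g1) j \<subseteq> {0..s - b}" for j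
            unfolding section_supp_def by (rule closure_minimal) (use z in \<open>auto simp: not_less[symmetric]\<close>)
          then have "bounded (section_supp (fn_of g1) j)" for j
            by (rule bounded_subset[OF bounded_closed_interval])
          then have "compact (section_supp (fn_of g1) j)" for j
            by (simp add: compact_eq_bounded_closed) (simp add: section_supp_def)
          then show ?thesis using g1 by (simp add: Cc_def C0_def)
        qed
        moreover have "supp A (fn_of g1) \<subseteq> {0..s - b} \<times> A"
          unfolding supp_subset_strip_iff using z by simp
        moreover have "0 < s - b" using b by simp
        ultimately have "supp (- A) (W (fn_of g1)) \<subseteq> {0..s - b} \<times> (- A)"
          using W by (simp add: admissible_S_def)
        then have "\<forall>i\<in>- A. W (fn_of g1) (Some (s, i)) = 0"
          using s b(1) by (simp add: supp_subset_strip_iff)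
        moreover have L1: "fn_of (lift W g1) = W (fn_of g1)" "W (fn_of g1) \<in> C0 (- A)"
          using lift_C0[OF W g1] by (simp_all add: fn_of_inverse)
        moreover have "i \<notin> - A \<Longrightarrow> val (lift W g1) i s = 0"
          by (rule val_zero_outside[of "- A"]) (simp_all add: L1 flip: C0_restr_iff)
        ultimately have z1: "val (lift W g1) i s = 0"
          using s by (cases "i \<in> A") (auto simp: val_def)
        have "norm (PA (g - g1)) \<le> c + e'"
        proof (rule norm_c0_le)
          show "0 \<le> c + e'" using c0 e'(1) by simp
          fix j and t :: real assume t: "0 \<le> t"
          show "\<bar>val (PA (g - g1)) j t\<bar> \<le> c + e'"
          proof (cases "t \<le> s - 2 * b \<or> j \<notin> A")
            case True
            then show ?thesis using t v1[OF t, of j] w1[of t] c0 e'(1) by auto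
          next
            case False
            then have t2: "s - 2 * b < t" "j \<in> A" by auto
            have "\<bar>val g j t\<bar> \<le> c + e'"
            proof (cases "s \<le> t")
              case True
              then show ?thesis using c e'(1) by (meson add_increasing2 less_imp_le)
            next
              case False
              then have "\<bar>val g j t - val g j s\<bar> < e'" using t2 b by (intro d(2)) auto
              then show ?thesis using c[rule_format, of s j] by linarith
            qed
            moreover have "val (PA (g - g1)) j t = (1 - w t) * val g j t" using t2 v1[OF t, of j] by (simp add: algebra_simps)
            moreover have "\<bar>1 - w t\<bar> * \<bar>val g j t\<bar> \<le> 1 * \<bar>val g j t\<bar>" using w01[of t] by (intro mult_right_mono) auto
            ultimately show ?thesis by (simp add: abs_mult)
          qed
        qed
        from mult_left_mono[OF this N(1)] have "norm (lift W (g - g1)) \<le> N * (c + e')"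
          using N(2)[of "g - g1"] by linarith
        then have "\<bar>val (lift W (g - g1)) i s\<bar> \<le> N * (c + e')" using abs_val_le order_trans by blast
        then show "\<bar>val (lift W g) i s\<bar> \<le> N * c + e"
          using z1 e'(2) by (simp add: blinfun.diff_right algebra_simps)
      qed
    qed
  qed
  then show ?thesis using N(1) by blast
qed

text \<open>
  The two half equations say that \<open>H g = z + PA (P (g + S g))\<close>, for \<open>z\<close> the translation generator at \<open>g\<close>, and
  that the translation generator at \<open>S g\<close> is \<open>- PB (P (g + S g)) - S (H g)\<close>. Inserting the first into the second gives the
  Riccati equation.
\<close>

lemma lift_mild:
  assumes W: "admissible_S A (- A) W" and H: "H \<in> C01 A \<rightarrow>\<^sub>E C0 A" and eq: "half_equation W H"
  shows "mild_riccati K (lift W)"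
proof (rule riccati_mild)
  show "lift W (PA f) = lift W f" for f
  proof -
    have "PA (PA f) = PA f" by (rule c0_eqI) simp
    then show ?thesis by (simp add: lift_apply[OF W])
  qed
  fix f z assume f: "PA f = f" and z: "genT f z"
  define g where "g = fn_of f"
  have fg: "f = c0_of g" by (simp add: g_def fn_of_inverse)
  have g0: "g \<in> C0 A" using f by (simp add: g_def C0_restr_iff)
  have g1: "g \<in> C01 A" using gen_C01(1)[OF g0] z fg by simp
  have Wg: "W g \<in> C01 (- A)" using W g1 by (simp add: admissible_S_def)
  note L = lift_C0[OF W g0, folded fg]
  have "\<exists>w. genT (lift W f) w" unfolding L(1) using C01_gen[OF Wg] by (rule exI)
  then obtain w where w: "genT (lift W f) w" ..
  have Hg: "H g \<in> C0 A" using H g1 by blast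
  define y where "y = c0_of (H g)"
  have y: "PA y = y" unfolding y_def by (rule restr_c0_of[OF Hg])
  have sum: "(\<Sum>j\<in>UNIV. Lam s $ i $ j * (g (Some (s, j)) + W g (Some (s, j)))) =
      (\<Sum>j\<in>UNIV. Lam s $ i $ j * val (f + lift W f) j s)" if "0 \<le> s" for s i
    using that by (simp add: val_def fn_of_add L(2)) (simp add: g_def)
  have eqA: "H g (Some (s, i)) = (dds A g (Some (s, i)) +
      (\<Sum>j\<in>UNIV. Lam s $ i $ j * (g (Some (s, j)) + W g (Some (s, j))))) / nu i" if "i \<in> A" "0 \<le> s" for i s
    using eq g1 that unfolding half_equation_def by blast
  have eqB: "W (H g) (Some (s, i)) = - (dds (- A) (W g) (Some (s, i)) +
      (\<Sum>j\<in>UNIV. Lam s $ i $ j * (g (Some (s, j)) + W g (Some (s, j))))) / nu i" if "i \<notin> A" "0 \<le> s" for i s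
    using eq g1 that unfolding half_equation_def by blast
  have RL: "PB (lift W f) = lift W f" using L by (simp flip: C0_restr_iff)
  have yz: "y = z + PA (P (f + lift W f))"
  proof (rule c0_eqI)
    fix i and s :: real assume s: "0 \<le> s"
    show "val y i s = val (z + PA (P (f + lift W f))) i s"
    proof (cases "i \<in> A")
      case True
      have "nu i * val y i s = dds A g (Some (s, i)) + (\<Sum>j\<in>UNIV. Lam s $ i $ j * val (f + lift W f) j s)"
        using eqA[OF True s] nu_pos[of i] sum[OF s, of i] s
        by (simp add: y_def val_def c0_of_inverse'[OF Hg])
      also have "\<dots> = nu i * val z i s + nu i * val (P (f + lift W f)) i s"
        unfolding val_P_Lam[OF s] using gen_C01(2)[OF g0 z[unfolded fg] True s]
          val_zero_outside[OF RL, of i s] True by (simp add: fg[symmetric] algebra_simps)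
      finally have "nu i * val y i s = nu i * (val z i s + val (P (f + lift W f)) i s)" by (simp add: algebra_simps)
      then show ?thesis using True nu_pos[of i] by simp
    next
      case False
      then show ?thesis using val_zero_outside[OF y] val_zero_outside[OF genT_restr_eq[OF f z]] by simp
    qed
  qed
  have "w = - PB (P (f + lift W f)) - lift W y"
  proof (rule c0_eqI)
    fix i and s :: real assume s: "0 \<le> s"
    have RLy: "lift W y = c0_of (W (H g))" "PB (lift W y) = lift W y"
      using lift_C0[OF W Hg] by (simp_all add: y_def flip: C0_restr_iff)
    show "val w i s = val (- PB (P (f + lift W f)) - lift W y) i s"
    proof (cases "i \<in> A")
      case True
      then show ?thesis
        using val_zero_outside[OF genT_restr_eq[OF RL w]] val_zero_outside[OF RLy(2)] by simp
    next
      case False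
      have "dds (- A) (W g) (Some (s, i)) = nu i * val w i s + K * val (lift W f) i s"
        using gen_C01(2)[OF L(3), of w i s] w False s by (simp add: L(1))
      moreover have "val (lift W y) i s = - (dds (- A) (W g) (Some (s, i)) + (\<Sum>j\<in>UNIV. Lam s $ i $ j * val (f + lift W f) j s)) / nu i"
        using eqB[OF False s] sum[OF s, of i] lift_C0(2)[OF W Hg] s
        by (simp add: y_def val_def)
      then have "nu i * val (lift W y) i s = - (dds (- A) (W g) (Some (s, i)) + (\<Sum>j\<in>UNIV. Lam s $ i $ j * val (f + lift W f) j s))"
        using nu_pos[of i] by simp
      ultimately have "nu i * val w i s = - nu i * val (P (f + lift W f)) i s - nu i * val (lift W y) i s"
        using val_P_Lam[OF s, of i "f + lift W f"] val_zero_outside[OF f False, of s]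
        by (simp add: algebra_simps)
      then have "nu i * val w i s = nu i * (- val (P (f + lift W f)) i s - val (lift W y) i s)"
        by (simp add: algebra_simps)
      then show ?thesis using False nu_pos[of i] by simp
    qed
  qed
  then show "genT (lift W f) (- PB (P (f + lift W f)) - lift W (z + PA (P (f + lift W f))))"
    using w yz by simp
qed

text \<open>
  The Riccati equation determines \<open>S\<close>, and then the first half equation determines \<open>H\<close>.
\<close>

lemma half_unique:
  assumes 1: "admissible_S A (- A) W1" "H1 \<in> C01 A \<rightarrow>\<^sub>E C0 A" "half_equation W1 H1"
    and 2: "admissible_S A (- A) W2" "H2 \<in> C01 A \<rightarrow>\<^sub>E C0 A" "half_equation W2 H2"
  shows "W1 = W2 \<and> H1 = H2"
proof -
  obtain N1 N2 where N: "0 \<le> N1" "causal N1 (lift W1)" "0 \<le> N2" "causal N2 (lift W2)"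
    using lift_causal[OF 1(1)] lift_causal[OF 2(1)] by blast
  have mono: "causal (max N1 N2) R" if "causal M R" "M \<le> max N1 N2" for M R
    unfolding causal_def
  proof (intro allI impI)
    fix g :: "'e c0" and s c i assume s: "0 \<le> s" "\<forall>j t. s \<le> t \<longrightarrow> \<bar>val g j t\<bar> \<le> c"
    then have "0 \<le> c" by (meson abs_ge_zero order_refl order_trans)
    then have "M * c \<le> max N1 N2 * c" using that(2) by (rule mult_right_mono[rotated])
    then show "\<bar>val (R g) i s\<bar> \<le> max N1 N2 * c" using that(1) s unfolding causal_def by (meson order_trans)
  qed
  have "lift W1 = lift W2"
    by (rule riccati_unique[OF _ lift_mild[OF 1] mono[OF N(2)] lift_mild[OF 2] mono[OF N(4)]]) (use N in auto)
  then have W: "W1 g = W2 g" if "g \<in> C0 A" for g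
    using lift_C0(2)[OF 1(1) that] lift_C0(2)[OF 2(1) that] by simp
  have "W1 = W2"
    by (rule PiE_ext[of _ "C0 A" "\<lambda>_. C0 (- A)"]) (use 1(1) 2(1) W in \<open>auto simp: admissible_S_def\<close>)
  moreover have "H1 = H2"
  proof (rule PiE_ext[OF 1(2) 2(2)])
    fix g assume g: "g \<in> C01 A"
    show "H1 g = H2 g"
    proof
      fix x
      have C: "H1 g \<in> C0 A" "H2 g \<in> C0 A" using 1(2) 2(2) g by blast+
      show "H1 g x = H2 g x"
      proof (cases "x \<in> Some ` ({0..} \<times> A)")
        case True
        then show ?thesis using 1(3) 2(3) g \<open>W1 = W2\<close> by (auto simp: half_equation_def)
      next
        case False
        then show ?thesis using C by (cases x) (auto simp: C0_iff Xbar_def)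
      qed
    qed
  qed
  ultimately show ?thesis ..
qed

end

section \<open>Decoupling the operator equation\<close>

lemma C01_zero: "(\<lambda>_. 0) \<in> C01 (A :: 'e::finite set)"
proof -
  have "dds A (\<lambda>_. 0) = (\<lambda>_. 0)"
  proof
    fix x :: "(real \<times> 'e) option"
    show "dds A (\<lambda>_. 0) x = 0"
      by (auto simp: dds_def split: option.split
          intro!: vector_derivative_within at_within_Ici_neq_bot)
  qed
  then show ?thesis by (simp add: C01_def C0_zero)
qed

lemma bounded_operator_zero: "bounded_operator A B W \<Longrightarrow> W (\<lambda>_. 0) = (\<lambda>_. 0)" for A :: "'e::finite set"
proof -
  assume "bounded_operator A B W"
  then have "\<forall>c. \<forall>f\<in>C0 A. W (\<lambda>x. c * f x) = (\<lambda>x. c * W f x)" unfolding bounded_operator_def by blast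
  from this[rule_format, OF C0_zero, of 0] show ?thesis by simp
qed

lemma bounded_operator_uminus: "bounded_operator A B W \<Longrightarrow> f \<in> C0 A \<Longrightarrow> W (\<lambda>x. - f x) = (\<lambda>x. - W f x)" for A :: "'e::finite set"
proof -
  assume "bounded_operator A B W" and f: "f \<in> C0 A"
  then have "\<forall>c. \<forall>f\<in>C0 A. W (\<lambda>x. c * f x) = (\<lambda>x. c * W f x)" unfolding bounded_operator_def by blast
  from this[rule_format, OF f, of "-1"] show ?thesis by simp
qed

text \<open>
  The operators \<open>H\<close> are given only as generators; their values at \<open>0\<close> are needed to set one of the two
  arguments of the operator equation to zero.
\<close>

lemma generator_zero:
  fixes A :: "'e::finite set"
  assumes "admissible_H A H" shows "H (\<lambda>_. 0) = (\<lambda>_. 0)"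
proof -
  obtain Q where Q: "sc_pos_contr_semigroup A Q" and G: "strong_generator A Q (C01 A) H"
    using assms unfolding admissible_H_def by blast
  have H: "H (\<lambda>_. 0) \<in> C0 A" "generator_limit A Q (\<lambda>_. 0) (H (\<lambda>_. 0))"
    using G C01_zero unfolding strong_generator_def by blast+
  have b: "bounded_operator A A (Q l)" if "0 \<le> l" for l
    using Q that by (simp add: sc_pos_contr_semigroup_def)
  have "Q l (\<lambda>_. 0) = (\<lambda>_. 0)" if "0 \<le> l" for l
    by (rule bounded_operator_zero[OF b[OF that]])
  then have "\<forall>\<^sub>F l in at_right 0. supnorm A (\<lambda>x. (Q l (\<lambda>_. 0) x - 0) / l - H (\<lambda>_. 0) x) = supnorm A (H (\<lambda>_. 0))"
    unfolding eventually_at_filter by (intro always_eventually) (simp add: supnorm_def)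
  then have "((\<lambda>l::real. supnorm A (H (\<lambda>_. 0))) \<longlongrightarrow> 0) (at_right 0)"
    using H(2) unfolding generator_limit_def by (rule Lim_transform_eventually[rotated])
  then have "supnorm A (H (\<lambda>_. 0)) = 0" by (simp add: tendsto_const_iff)
  then have "norm (c0_of (H (\<lambda>_. 0))) = 0"
    using supnorm_fn_of[OF restr_c0_of[OF H(1)]] by (simp add: c0_of_inverse'[OF H(1)])
  then have "c0_of (H (\<lambda>_. 0)) = 0" by simp
  then show ?thesis using c0_of_inverse'[OF H(1)] by simp
qed

text \<open>
  In every state the glued function is a sum of one component and the image of the other.
\<close>

lemma dds_section:
  assumes "\<And>r. f (Some (r, i)) = g (Some (r, i)) + h (Some (r, i))"
    and g: "g \<in> C01 A" and h: "h \<in> C01 A" and i: "i \<in> A" and s: "0 \<le> s"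
  shows "dds UNIV f (Some (s, i)) = dds A g (Some (s, i)) + dds A h (Some (s, i))"
proof -
  have d: "((\<lambda>r. k (Some (r, i))) has_vector_derivative dds A k (Some (s, i))) (at s within {0..})"
    if "k \<in> C01 A" for k
    using that i s by (simp add: C01_def dds_def vector_derivative_works[symmetric])
  have "((\<lambda>r. f (Some (r, i))) has_vector_derivative dds A g (Some (s, i)) + dds A h (Some (s, i))) (at s within {0..})"
    unfolding assms(1) by (intro has_vector_derivative_add d g h)
  from vector_derivative_within[OF at_within_Ici_neq_bot[OF s] this] show ?thesis
    using s by (simp add: dds_def)
qed

text \<open>
  Both signs share the speeds \<open>\<bar>v\<bar>\<close>; exchanging the roles of the two sets of states amounts to replacing
  \<open>v\<close> by \<open>-v\<close>.
\<close>

locale decoupling =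
  fixes v :: "'e::finite option \<Rightarrow> real" and \<Lambda> :: "real \<Rightarrow> real ^ 'e ^ 'e" and K :: real
  assumes gen: "generator_family (\<lambda>i. \<bar>v (Some i)\<bar>) \<Lambda> K"
    and v_nonzero: "v (Some i) \<noteq> 0"
begin

sublocale pos: first_passage "\<lambda>i. \<bar>v (Some i)\<bar>" \<Lambda> K "Epos v"
  using gen by (simp add: first_passage_def)

sublocale neg: first_passage "\<lambda>i. \<bar>v (Some i)\<bar>" \<Lambda> K "Eneg v"
  using gen by (simp add: first_passage_def)

lemma compl_Epos: "- Epos v = Eneg v" and compl_Eneg: "- Eneg v = Epos v"
  using v_nonzero by (auto simp: Epos_def Eneg_def not_less less_le)

lemma vanish:
  fixes A :: "'e set"
  assumes "g \<in> C0 A" "i \<notin> A \<or> s < 0" shows "g (Some (s, i)) = 0"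
proof -
  have "Some (s, i) \<notin> Xbar A" using assms(2) by (auto simp: Xbar_def)
  then show ?thesis using assms(1) by (simp add: C0_iff)
qed

context
  fixes Sp Hp Sm Hm
  assumes Sp: "admissible_S (Epos v) (Eneg v) Sp" and Sm: "admissible_S (Eneg v) (Epos v) Sm"
    and Hp: "admissible_H (Epos v) Hp" and Hm: "admissible_H (Eneg v) Hm"
begin

abbreviation "coupled gp gm \<equiv> glue v (op_matrix id Sm Sp id (gp, gm))"

lemma in_spaces:
  assumes "gp \<in> C01 (Epos v)" "gm \<in> C01 (Eneg v)"
  shows "gp \<in> C0 (Epos v)" "gm \<in> C0 (Eneg v)" "Sp gp \<in> C01 (Eneg v)" "Sm gm \<in> C01 (Epos v)"
    "Sp gp \<in> C0 (Eneg v)" "Sm gm \<in> C0 (Epos v)" "Hp gp \<in> C0 (Epos v)" "Hm gm \<in> C0 (Eneg v)"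
    "Sp (Hp gp) \<in> C0 (Eneg v)" "Sm (Hm gm) \<in> C0 (Epos v)"
proof -
  show g: "gp \<in> C0 (Epos v)" "gm \<in> C0 (Eneg v)" using assms by (simp_all add: C01_def)
  show S: "Sp gp \<in> C01 (Eneg v)" "Sm gm \<in> C01 (Epos v)"
    using assms Sp Sm by (simp_all add: admissible_S_def)
  show "Sp gp \<in> C0 (Eneg v)" "Sm gm \<in> C0 (Epos v)" using S by (simp_all add: C01_def)
  show H: "Hp gp \<in> C0 (Epos v)" "Hm gm \<in> C0 (Eneg v)"
    using assms Hp Hm unfolding admissible_H_def by blast+
  show "Sp (Hp gp) \<in> C0 (Eneg v)" "Sm (Hm gm) \<in> C0 (Epos v)"
    using H Sp Sm unfolding admissible_S_def by blast+
qed

lemma coupled_apply: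
  assumes g: "gp \<in> C01 (Epos v)" "gm \<in> C01 (Eneg v)"
  shows "coupled gp gm (Some (s, i)) =
    (gp (Some (s, i)) + Sp gp (Some (s, i))) + (gm (Some (s, i)) + Sm gm (Some (s, i)))"
  using vanish[OF in_spaces(1)[OF g], of i s] vanish[OF in_spaces(2)[OF g], of i s]
    vanish[OF in_spaces(5)[OF g], of i s] vanish[OF in_spaces(6)[OF g], of i s] v_nonzero[of i]
  by (auto simp: glue_def op_matrix_def Epos_def Eneg_def)

definition "jump_term g W s i = (\<Sum>j\<in>UNIV. \<Lambda> s $ i $ j * (g (Some (s, j)) + W g (Some (s, j))))"

abbreviation "coupled_L gp gm \<equiv> Vinv v (\<lambda>x. dds UNIV (coupled gp gm) x + mult_op \<Lambda> (coupled gp gm) x)"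

text \<open>
  Both sides of the operator equation are additive in \<open>(g\<^sup>+, g\<^sup>-)\<close>. The sign of \<open>v\<close> turns the factor \<open>v\<^sup>-\<^sup>1\<close> into
  \<open>\<bar>v\<bar>\<^sup>-\<^sup>1\<close> or \<open>- \<bar>v\<bar>\<^sup>-\<^sup>1\<close>, which is the sign in the half equations.
\<close>

lemma lhs_apply:
  assumes g: "gp \<in> C01 (Epos v)" "gm \<in> C01 (Eneg v)" and s: "0 \<le> s"
  shows "i \<in> Epos v \<Longrightarrow> coupled_L gp gm (Some (s, i)) = (dds (Epos v) gp (Some (s, i)) + dds (Epos v) (Sm gm) (Some (s, i))
      + jump_term gp Sp s i + jump_term gm Sm s i) / \<bar>v (Some i)\<bar>"
    and "i \<in> Eneg v \<Longrightarrow> coupled_L gp gm (Some (s, i)) = - (dds (Eneg v) (Sp gp) (Some (s, i)) + dds (Eneg v) gm (Some (s, i))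
      + jump_term gp Sp s i + jump_term gm Sm s i) / \<bar>v (Some i)\<bar>"
proof -
  have m: "mult_op \<Lambda> (coupled gp gm) (Some (s, i)) = jump_term gp Sp s i + jump_term gm Sm s i"
    by (simp add: mult_op_def matrix_vector_mult_def coupled_apply[OF g] jump_term_def ring_distribs sum.distrib)
  note sp = in_spaces[OF g]
  show "coupled_L gp gm (Some (s, i)) = (dds (Epos v) gp (Some (s, i)) + dds (Epos v) (Sm gm) (Some (s, i))
      + jump_term gp Sp s i + jump_term gm Sm s i) / \<bar>v (Some i)\<bar>" if i: "i \<in> Epos v"
  proof -
    have "i \<notin> Eneg v" using i by (auto simp: Epos_def Eneg_def)
    then have "dds UNIV (coupled gp gm) (Some (s, i)) = dds (Epos v) gp (Some (s, i)) + dds (Epos v) (Sm gm) (Some (s, i))"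
      using vanish[OF sp(2), of i] vanish[OF sp(5), of i]
      by (intro dds_section g sp i s) (simp add: coupled_apply[OF g])
    then show ?thesis using i by (simp add: Vinv_def m Epos_def divide_inverse mult.commute add.assoc)
  qed
  show "coupled_L gp gm (Some (s, i)) = - (dds (Eneg v) (Sp gp) (Some (s, i)) + dds (Eneg v) gm (Some (s, i))
      + jump_term gp Sp s i + jump_term gm Sm s i) / \<bar>v (Some i)\<bar>" if i: "i \<in> Eneg v"
  proof -
    have "i \<notin> Epos v" using i by (auto simp: Epos_def Eneg_def)
    then have "dds UNIV (coupled gp gm) (Some (s, i)) = dds (Eneg v) (Sp gp) (Some (s, i)) + dds (Eneg v) gm (Some (s, i))"
      using vanish[OF sp(1), of i] vanish[OF sp(6), of i]
      by (intro dds_section g sp i s) (simp add: coupled_apply[OF g])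
    moreover have "\<bar>v (Some i)\<bar> = - v (Some i)" using i by (simp add: Eneg_def)
    ultimately show ?thesis by (simp add: Vinv_def m) (simp add: divide_inverse algebra_simps)
  qed
qed

abbreviation "coupled_H gp gm \<equiv> glue v (op_matrix id Sm Sp id
  (op_matrix Hp (\<lambda>_ _. 0) (\<lambda>_ _. 0) (\<lambda>f x. - Hm f x) (gp, gm)))"

lemma rhs_apply:
  assumes g: "gp \<in> C01 (Epos v)" "gm \<in> C01 (Eneg v)"
  shows "i \<in> Epos v \<Longrightarrow> coupled_H gp gm (Some (s, i)) = Hp gp (Some (s, i)) - Sm (Hm gm) (Some (s, i))"
    and "i \<in> Eneg v \<Longrightarrow> coupled_H gp gm (Some (s, i)) = Sp (Hp gp) (Some (s, i)) - Hm gm (Some (s, i))"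
proof -
  have "Sm (\<lambda>x. - Hm gm x) = (\<lambda>x. - Sm (Hm gm) x)"
    using Sm in_spaces(8)[OF g] by (intro bounded_operator_uminus[of "Eneg v" "Epos v"]) (simp_all add: admissible_S_def)
  then show "i \<in> Epos v \<Longrightarrow> coupled_H gp gm (Some (s, i)) = Hp gp (Some (s, i)) - Sm (Hm gm) (Some (s, i))"
    and "i \<in> Eneg v \<Longrightarrow> coupled_H gp gm (Some (s, i)) = Sp (Hp gp) (Some (s, i)) - Hm gm (Some (s, i))"
    by (auto simp: glue_def op_matrix_def Epos_def Eneg_def)
qed

text \<open>
  One direction sets one argument to zero, the other adds the two half equations.
\<close>

lemma operator_equation_iff:
  "operator_equation v \<Lambda> Sp Hp Sm Hm \<longleftrightarrow> pos.half_equation Sp Hp \<and> neg.half_equation Sm Hm"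
proof -
  let ?D = "\<lambda>A g s i. dds A g (Some (s, i))"
  have pos_iff: "pos.half_equation Sp Hp \<longleftrightarrow> (\<forall>g\<in>C01 (Epos v). \<forall>i. \<forall>s\<ge>0.
     (i \<in> Epos v \<longrightarrow> Hp g (Some (s, i)) = (?D (Epos v) g s i + jump_term g Sp s i) / \<bar>v (Some i)\<bar>) \<and>
     (i \<in> Eneg v \<longrightarrow> Sp (Hp g) (Some (s, i)) = - (?D (Eneg v) (Sp g) s i + jump_term g Sp s i) / \<bar>v (Some i)\<bar>))"
    unfolding pos.half_equation_def jump_term_def compl_Epos by (simp flip: compl_Epos)
  have neg_iff: "neg.half_equation Sm Hm \<longleftrightarrow> (\<forall>g\<in>C01 (Eneg v). \<forall>i. \<forall>s\<ge>0.
     (i \<in> Eneg v \<longrightarrow> Hm g (Some (s, i)) = (?D (Eneg v) g s i + jump_term g Sm s i) / \<bar>v (Some i)\<bar>) \<and>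
     (i \<in> Epos v \<longrightarrow> Sm (Hm g) (Some (s, i)) = - (?D (Epos v) (Sm g) s i + jump_term g Sm s i) / \<bar>v (Some i)\<bar>))"
    unfolding neg.half_equation_def jump_term_def compl_Eneg by (simp flip: compl_Eneg)
  have cases: "i \<in> Epos v \<or> i \<in> Eneg v" for i using compl_Epos by blast
  show ?thesis
  proof
    assume "operator_equation v \<Lambda> Sp Hp Sm Hm"
    then have eq: "Vinv v (\<lambda>x. dds UNIV (coupled gp gm) x + mult_op \<Lambda> (coupled gp gm) x) = coupled_H gp gm"
      if "gp \<in> C01 (Epos v)" "gm \<in> C01 (Eneg v)" for gp gm
      using that unfolding operator_equation_def Let_def by blast
    have S0: "Sp (\<lambda>_. 0) = (\<lambda>_. 0)" "Sm (\<lambda>_. 0) = (\<lambda>_. 0)"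
      using Sp Sm bounded_operator_zero unfolding admissible_S_def by blast+
    have H0: "Hp (\<lambda>_. 0) = (\<lambda>_. 0)" "Hm (\<lambda>_. 0) = (\<lambda>_. 0)"
      by (rule generator_zero[OF Hp], rule generator_zero[OF Hm])
    have jump_term0: "jump_term (\<lambda>_. 0) Sp s i = 0" "jump_term (\<lambda>_. 0) Sm s i = 0" for s i by (simp_all add: jump_term_def S0)
    have D0: "?D A (\<lambda>_. 0) s i = 0" if "0 \<le> s" for A :: "'e set" and s i
      using that by (auto simp: dds_def intro!: vector_derivative_within at_within_Ici_neq_bot)
    have "pos.half_equation Sp Hp"
      unfolding pos_iff
    proof (intro ballI allI impI conjI)
      fix g i and s :: real assume g: "g \<in> C01 (Epos v)" and s: "0 \<le> s"
      note e = fun_cong[OF eq[OF g C01_zero], of "Some (s, i)"]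
      show "Hp g (Some (s, i)) = (?D (Epos v) g s i + jump_term g Sp s i) / \<bar>v (Some i)\<bar>" if i: "i \<in> Epos v"
        using e[unfolded lhs_apply(1)[OF g C01_zero s i] rhs_apply(1)[OF g C01_zero i]]
        by (simp add: S0 H0 jump_term0 D0 s add_divide_distrib diff_divide_distrib)
      show "Sp (Hp g) (Some (s, i)) = - (?D (Eneg v) (Sp g) s i + jump_term g Sp s i) / \<bar>v (Some i)\<bar>" if i: "i \<in> Eneg v"
        using e[unfolded lhs_apply(2)[OF g C01_zero s i] rhs_apply(2)[OF g C01_zero i]]
        by (simp add: S0 H0 jump_term0 D0 s add_divide_distrib diff_divide_distrib)
    qed
    moreover have "neg.half_equation Sm Hm"
      unfolding neg_iff
    proof (intro ballI allI impI conjI)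
      fix g i and s :: real assume g: "g \<in> C01 (Eneg v)" and s: "0 \<le> s"
      note e = fun_cong[OF eq[OF C01_zero g], of "Some (s, i)"]
      show "Hm g (Some (s, i)) = (?D (Eneg v) g s i + jump_term g Sm s i) / \<bar>v (Some i)\<bar>" if i: "i \<in> Eneg v"
        using e[unfolded lhs_apply(2)[OF C01_zero g s i] rhs_apply(2)[OF C01_zero g i]]
        by (simp add: S0 H0 jump_term0 D0 s add_divide_distrib diff_divide_distrib)
      show "Sm (Hm g) (Some (s, i)) = - (?D (Epos v) (Sm g) s i + jump_term g Sm s i) / \<bar>v (Some i)\<bar>" if i: "i \<in> Epos v"
        using e[unfolded lhs_apply(1)[OF C01_zero g s i] rhs_apply(1)[OF C01_zero g i]]
        by (simp add: S0 H0 jump_term0 D0 s add_divide_distrib diff_divide_distrib)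
    qed
    ultimately show "pos.half_equation Sp Hp \<and> neg.half_equation Sm Hm" ..
  next
    assume h: "pos.half_equation Sp Hp \<and> neg.half_equation Sm Hm"
    show "operator_equation v \<Lambda> Sp Hp Sm Hm"
      unfolding operator_equation_def Let_def
    proof (intro ballI ext)
      fix gp gm x assume gp: "gp \<in> C01 (Epos v)" and gm: "gm \<in> C01 (Eneg v)"
      note sp = in_spaces[OF gp gm]
      show "Vinv v (\<lambda>x. dds UNIV (coupled gp gm) x + mult_op \<Lambda> (coupled gp gm) x) x = coupled_H gp gm x"
      proof (cases x)
        case None
        then show ?thesis by (simp add: Vinv_def glue_def)
      next
        case (Some p)
        then obtain s i where x: "x = Some (s, i)" by (cases p) auto
        show ?thesis
        proof (cases "0 \<le> s")
          case True
          have p: "(i \<in> Epos v \<longrightarrow> Hp gp (Some (s, i)) = (?D (Epos v) gp s i + jump_term gp Sp s i) / \<bar>v (Some i)\<bar>) \<and>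
             (i \<in> Eneg v \<longrightarrow> Sp (Hp gp) (Some (s, i)) = - (?D (Eneg v) (Sp gp) s i + jump_term gp Sp s i) / \<bar>v (Some i)\<bar>)"
            using h gp True unfolding pos_iff by blast
          have n: "(i \<in> Eneg v \<longrightarrow> Hm gm (Some (s, i)) = (?D (Eneg v) gm s i + jump_term gm Sm s i) / \<bar>v (Some i)\<bar>) \<and>
             (i \<in> Epos v \<longrightarrow> Sm (Hm gm) (Some (s, i)) = - (?D (Epos v) (Sm gm) s i + jump_term gm Sm s i) / \<bar>v (Some i)\<bar>)"
            using h gm True unfolding neg_iff by blast
          from cases[of i] show ?thesis
          proof
            assume i: "i \<in> Epos v"
            then show ?thesis unfolding x lhs_apply(1)[OF gp gm True i] rhs_apply(1)[OF gp gm i]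
              using p n by (simp add: add_divide_distrib diff_divide_distrib)
          next
            assume i: "i \<in> Eneg v"
            then show ?thesis unfolding x lhs_apply(2)[OF gp gm True i] rhs_apply(2)[OF gp gm i]
              using p n by (simp add: add_divide_distrib diff_divide_distrib)
          qed
        next
          case False
          then have s: "s < 0" by simp
          have "coupled gp gm (Some (s, j)) = 0" for j
            using s vanish[OF sp(1), of j s] vanish[OF sp(2), of j s] vanish[OF sp(5), of j s] vanish[OF sp(6), of j s]
            by (simp add: coupled_apply[OF gp gm])
          then have "Vinv v (\<lambda>x. dds UNIV (coupled gp gm) x + mult_op \<Lambda> (coupled gp gm) x) x = 0"
            using s by (simp add: x Vinv_def dds_def mult_op_def matrix_vector_mult_def)
          moreover have "coupled_H gp gm x = 0"
            using cases[of i] rhs_apply[OF gp gm, of i s] s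
              vanish[OF sp(7), of i s] vanish[OF sp(8), of i s] vanish[OF sp(9), of i s] vanish[OF sp(10), of i s]
            by (auto simp: x)
          ultimately show ?thesis by simp
        qed
      qed
    qed
  qed
qed

end

end

theorem theorem3p1:
  fixes \<Lambda> :: "real \<Rightarrow> real ^ 'e ^ 'e" and v :: "'e::finite option \<Rightarrow> real" and K :: real
  assumes "CARD('e) > 1"
    and "\<And>s. s \<ge> 0 \<Longrightarrow> generator_matrix (\<Lambda> s)"
    and "K > 0"
    and "\<And>s i j. s \<ge> 0 \<Longrightarrow> \<bar>\<Lambda> s $ i $ j\<bar> \<le> K"
    and "continuous_on {0..} \<Lambda>"
    and "\<And>i. v (Some i) \<noteq> 0" and "v None = 0"
    and "Epos v \<noteq> {}" and "Eneg v \<noteq> {}"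
  shows "\<exists>!q. case q of (Sp, Hp, Sm, Hm) \<Rightarrow>
           operator_equation v \<Lambda> Sp Hp Sm Hm \<and>
           admissible_S (Epos v) (Eneg v) Sp \<and> admissible_S (Eneg v) (Epos v) Sm \<and>
           admissible_H (Epos v) Hp \<and> admissible_H (Eneg v) Hm"
    (is "\<exists>!q. ?P q")
proof -
  interpret decoupling v \<Lambda> K
    by unfold_locales (use assms in auto)
  have Sp: "admissible_S (Epos v) (Eneg v) pos.Sop" and Sm: "admissible_S (Eneg v) (Epos v) neg.Sop"
    using pos.admissible_Sop neg.admissible_Sop unfolding compl_Epos compl_Eneg .
  have "?P (pos.Sop, pos.Hop, neg.Sop, neg.Hop)"
    using operator_equation_iff[OF Sp Sm pos.admissible_Hop neg.admissible_Hop]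
      pos.half_equation_op neg.half_equation_op Sp Sm pos.admissible_Hop neg.admissible_Hop
    by simp
  moreover have "q = (pos.Sop, pos.Hop, neg.Sop, neg.Hop)" if "?P q" for q
  proof -
    obtain Sp' Hp' Sm' Hm' where q: "q = (Sp', Hp', Sm', Hm')" by (cases q)
    have e: "operator_equation v \<Lambda> Sp' Hp' Sm' Hm'" and S: "admissible_S (Epos v) (Eneg v) Sp'" "admissible_S (Eneg v) (Epos v) Sm'"
      and H: "admissible_H (Epos v) Hp'" "admissible_H (Eneg v) Hm'"
      using that by (simp_all add: q)
    have h: "pos.half_equation Sp' Hp'" "neg.half_equation Sm' Hm'"
      using operator_equation_iff[OF S H] e by auto
    have "Sp' = pos.Sop \<and> Hp' = pos.Hop"
      by (rule pos.half_unique)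
        (use S H h pos.admissible_Sop pos.admissible_Hop pos.half_equation_op in \<open>auto simp: compl_Epos admissible_H_def\<close>)
    moreover have "Sm' = neg.Sop \<and> Hm' = neg.Hop"
      by (rule neg.half_unique)
        (use S H h neg.admissible_Sop neg.admissible_Hop neg.half_equation_op in \<open>auto simp: compl_Eneg admissible_H_def\<close>)
    ultimately show ?thesis by (simp add: q)
  qed
  ultimately show ?thesis by (intro ex1I)
qed

end
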